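(* Assume that the group $U$, the spaces $D$, $F=F_1\cap F_2$ and the maps $N$, $N_1,\dots,N_p$ described in the context satisfy Assumptions (H1) and (H2) given there, and assume furthermore that $U(\cdot)$ is uniformly continuous in $D$ (i.e. the operators $U(t):D\to D$ are bounded uniformly in $t\in\mathbb R$). Let $\underline u\in F$ solve $\underline u(t)=U(t)\underline u_0+N(\underline u)(t)$ with $\underline u_0\in D$, let $u_0\in D$, and let $(w_k)_{k\in\mathbb N}$ be the family constructed by induction through $$w_0(t)=U(t)u_0+N_1(\underline u,w_0)(t),\qquad w_m=\sum_{j=1}^p\ \sum_{\substack{j+\ell_1+\dots+\ell_j=m+1\\ \ell_i\ge0}}N_j(\underline u,w_{\ell_1},\dots,w_{\ell_j})\quad(m\ge1),$$ with the convention that an empty sum is $0$. Then $U(-t)\underline u(t)$ converges to a limit $\underline u_+$ in $D$ as $t\to+\infty$, and for all $k\ge0$, $U(-t)w_k(t)$ has a limit in $D$ as $t\to+\infty$, denoted by $w_k^+$. Moreover, for $\varepsilon>0$ sufficiently small, the series $\sum_{k\in\mathbb N}\varepsilon^kw_k^+$ converges normally in $D$, and $$u_+^\varepsilon:=\underline u_++\varepsilon\sum_{k\in\mathbb N}\varepsilon^kw_k^+$$ is the limit of $U(-t)u^\varepsilon(t)$ in $D$ as $t\to+\infty$, where $u^\varepsilon:=\underline u+\varepsilon\sum_{k\in\mathbb N}\varepsilon^kw_k$ is the solution in $F$ of $u^\varepsilon(t)=U(t)(\underline u_0+\varepsilon u_0)+N(u^\varepsilon)(t)$. In particular, the scattering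 operator is real analytic from $D$ to $D$.
   Context: Setting. $D$ (the space of data), $X_1$, $X_2$ are Banach spaces of functions on $\mathbb R^n$; $U(t)$, $t\in\mathbb R$, is the group describing the evolution of a linear equation $\partial_tu=L(\partial_x)u$. Let $F=F_1\cap F_2$ with $$F_1=(C\cap L^\infty)(\mathbb R;D),\qquad F_2=L^{q_1}(\mathbb R;X_1)\cap L^{q_2}(\mathbb R;X_2),\quad 1\le q_1,q_2<\infty .$$ The nonlinearity $\Phi$ is a power law of degree $p\ge2$ ($p$ an integer). One writes $\Phi(a+b)-\Phi(a)=\sum_{j=1}^p\Phi_j(a,b,\dots,b)$, where $\Phi_j(\alpha_0,\alpha_1,\dots,\alpha_j)$ is $(p-j)$-linear in $\alpha_0$ (i.e. homogeneous polynomial of degree $p-j$) and linear in each of $\alpha_1,\dots,\alpha_j$, multilinearity being in general over $\mathbb R$ only. The initial time $t_0$ of the problem is fixed and may be $-\infty$ (in which case $\underline u_0$ and $u_0$ are asymptotic states). Set $$N(u)(t)=\int_{t_0}^tU(t-s)\Phi(u(s))\,ds,\qquad N_j(u,u_1,\dots,u_j)(t)=\int_{t_0}^tU(t-s)\Phi_j(u(s),u_1(s),\dots,u_j(s))\,ds ,$$ so that $N(a+b)-N(a)=\sum_{j=1}^pN_j(a,b,\dots,b)$ for all $a,b$. Since $N_p$ does not depend on its first argument, it is also written $N_p(u_1,\dots,u_p)$. For an interval $I$, $\|\mathbf 1_{t\in I}f\|_F$ and $\|\mathbf 1_{t\in I}f\|_{F_2}$ denote the norms of $F$ and $F_2$ with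 the time variable restricted to $I$. Assumption (H1): there exists $C_0>0$ such that $\|U(\cdot)g\|_F\le C_0\|g\|_D$ for all $g\in D$. Assumption (H2): there exist $\delta,C>0$ such that for all $\underline u,u_1,\dots,u_j\in F$ and all intervals $I$ in $\mathbb R$, $$\|\mathbf 1_{t\in I}N_j(\underline u,u_1,\dots,u_j)\|_F\le C\|\mathbf 1_{t\in I}\underline u\|_{F_2}^{\delta}\|\underline u\|_F^{p-\delta-j}\prod_{\ell=1}^j\|u_\ell\|_F\quad\text{if }1\le j\le p-1,$$ $$\|\mathbf 1_{t\in I}N_p(u_1,\dots,u_p)\|_F\le C\sum_{\ell=1}^p\|\mathbf 1_{t\in I}u_\ell\|_{F_2}^{\delta}\|u_\ell\|_F^{1-\delta}\prod_{\ell'\ne\ell}\|u_{\ell'}\|_F .$$ Scattering operator (case $t_0=-\infty$): it is supposed throughout that the equation has global solutions and that a nonlinear scattering theory is available, i.e. for each $u_-\in D$ there is a solution $u\in F$ of $u(t)=U(t)u_-+\int_{-\infty}^tU(t-s)\Phi(u(s))\,ds$. The scattering operator is $S:u_-\mapsto u_+=\lim_{t\to+\infty}U(-t)u(t)$ (limit in $D$). Real analyticity: an operator $A:X\to Y$ between Banach spaces is real analytic if it is infinitely Fréchet-differentiable at every point of $X$, with a locally norm-convergent series: for all $f\in X$ there exists $\varepsilon_0>0$ such that for all $g\in X$ with $\|g\|_X\le1$ one can find $(v_j)_{j\in\mathbb N}\in Y^{\mathbb N}$ such that for $0<\varepsilon\le\varepsilon_0$, $\sum_j\varepsilon^j\|v_j\|_Y<\infty$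 and $A(f+\varepsilon g)=A(f)+\varepsilon\sum_j\varepsilon^jv_j$. *)

theory Defs
  imports "HOL-Analysis.Analysis"
begin

section \<open>Multilinear maps and homogeneous polynomials (over the reals)\<close>

definition multilinear_on ::
  "'a::real_vector set \<Rightarrow> nat \<Rightarrow> ('a list \<Rightarrow> 'b::real_vector) \<Rightarrow> bool" where
  "multilinear_on V d M \<longleftrightarrow>
     (\<forall>xs ys. length xs + 1 + length ys = d \<and> set xs \<subseteq> V \<and> set ys \<subseteq> V \<longrightarrow>
        (\<forall>x\<in>V. \<forall>y\<in>V. \<forall>a b.
           M (xs @ (a *\<^sub>R x + b *\<^sub>R y) # ys) =
             a *\<^sub>R M (xs @ x # ys) + b *\<^sub>R M (xs @ y # ys)))"

definition homogeneous_poly_on ::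
  "'a::real_vector set \<Rightarrow> nat \<Rightarrow> ('a \<Rightarrow> 'b::real_vector) \<Rightarrow> bool" where
  "homogeneous_poly_on V d P \<longleftrightarrow>
     (\<exists>M. multilinear_on V d M \<and> (\<forall>x\<in>V. P x = M (replicate d x)))"

definition bounded_multilinear ::
  "nat \<Rightarrow> ('a::real_normed_vector list \<Rightarrow> 'b::real_normed_vector) \<Rightarrow> bool" where
  "bounded_multilinear d M \<longleftrightarrow> multilinear_on UNIV d M \<and>
     (\<exists>K. \<forall>vs. length vs = d \<longrightarrow> norm (M vs) \<le> K * prod_list (map norm vs))"


section \<open>Real analyticity\<close>

text \<open>
  The witness \<open>T n x\<close> is the \<open>n\<close>-th Frechet derivative at \<open>x\<close>, seen as a bounded
  \<open>n\<close>-linear map. The last conjunct says that \<open>x \<mapsto> T n x\<close> is Frechet differentiable for the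
  operator norm of \<open>n\<close>-linear maps, with derivative \<open>h \<mapsto> T (n + 1) x (h, \<dots>)\<close>.
\<close>

definition infinitely_frechet_differentiable ::
  "('a::real_normed_vector \<Rightarrow> 'b::real_normed_vector) \<Rightarrow> bool" where
  "infinitely_frechet_differentiable A \<longleftrightarrow>
     (\<exists>T :: nat \<Rightarrow> 'a \<Rightarrow> 'a list \<Rightarrow> 'b.
        (\<forall>x. T 0 x [] = A x) \<and>
        (\<forall>n x. bounded_multilinear n (T n x)) \<and>
        (\<forall>n x. \<forall>e>0. \<exists>d>0. \<forall>h. norm h < d \<longrightarrow>
           (\<forall>vs. length vs = n \<longrightarrow>
              norm (T n (x + h) vs - T n x vs - T (Suc n) x (h # vs))
                \<le> e * norm h * prod_list (map norm vs))))"

definition locally_norm_convergent_series ::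
  "('a::banach \<Rightarrow> 'b::banach) \<Rightarrow> bool" where
  "locally_norm_convergent_series A \<longleftrightarrow>
     (\<forall>f. \<exists>\<epsilon>\<^sub>0>0. \<forall>g. norm g \<le> 1 \<longrightarrow>
        (\<exists>v :: nat \<Rightarrow> 'b. \<forall>\<epsilon>::real. 0 < \<epsilon> \<and> \<epsilon> \<le> \<epsilon>\<^sub>0 \<longrightarrow>
           summable (\<lambda>j. \<epsilon> ^ j * norm (v j)) \<and>
           A (f + \<epsilon> *\<^sub>R g) = A f + \<epsilon> *\<^sub>R (\<Sum>j. \<epsilon> ^ j *\<^sub>R v j)))"

definition real_analytic :: "('a::banach \<Rightarrow> 'b::banach) \<Rightarrow> bool" where
  "real_analytic A \<longleftrightarrow>
     infinitely_frechet_differentiable A \<and> locally_norm_convergent_series A"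


section \<open>The evolution problem\<close>

text \<open>
  The spaces \<open>D\<close>, \<open>X\<^sub>1\<close>, \<open>X\<^sub>2\<close> are Banach types \<open>'d\<close>, \<open>'x\<close>, \<open>'y\<close>, continuously embedded by
  \<open>emb_D\<close>, \<open>emb_1\<close>, \<open>emb_2\<close> into a large Banach space \<open>'z\<close> of functions or distributions (for
  instance a Sobolev space of negative index). The values of the nonlinearity need only lie in
  \<open>'z\<close>, which is also where the Duhamel integrals are computed. \<open>UD\<close> is the group on \<open>D\<close>
  and \<open>UZ\<close> its extension to \<open>'z\<close>.
\<close>

record ('d, 'x, 'y, 'z) evolution =
  emb_D :: "'d \<Rightarrow> 'z"
  emb_1 :: "'x \<Rightarrow> 'z"
  emb_2 :: "'y \<Rightarrow> 'z"
  UD :: "real \<Rightarrow> 'd \<Rightarrow> 'd"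
  UZ :: "real \<Rightarrow> 'z \<Rightarrow> 'z"
  expo_1 :: real
  expo_2 :: real
  init_time :: ereal
  deg :: nat
  Phi :: "'z \<Rightarrow> 'z"
  Phi_j :: "nat \<Rightarrow> 'z \<Rightarrow> 'z list \<Rightarrow> 'z"

subsection \<open>The spaces of functions of time\<close>

text \<open>Bochner's strong measurability; the Banach spaces need not be separable.\<close>

definition strongly_measurable :: "(real \<Rightarrow> 'a::real_normed_vector) \<Rightarrow> bool" where
  "strongly_measurable f \<longleftrightarrow>
     (\<exists>s. (\<forall>n. simple_function lebesgue (s n)) \<and>
          (AE t in lebesgue. (\<lambda>n. s n t) \<longlonglongrightarrow> f t))"

text \<open>
  A \<open>D\<close>-valued function of time is seen as a function with values in another space by passing
  through \<open>'z\<close>: \<open>in_Lq iD i q u\<close> means that \<open>u(t)\<close> belongs to the space embedded by \<open>i\<close>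
  for almost every \<open>t\<close>, and is \<open>L\<^sup>q\<close> in time with values there.
\<close>

definition in_Lq ::
  "('d \<Rightarrow> 'z) \<Rightarrow> ('x::real_normed_vector \<Rightarrow> 'z) \<Rightarrow> real \<Rightarrow> (real \<Rightarrow> 'd) \<Rightarrow> bool" where
  "in_Lq iD i q u \<longleftrightarrow>
     (AE t in lebesgue. iD (u t) \<in> range i) \<and>
     strongly_measurable (\<lambda>t. inv i (iD (u t))) \<and>
     integrable lebesgue (\<lambda>t. norm (inv i (iD (u t))) powr q)"

definition Lq_norm ::
  "('d \<Rightarrow> 'z) \<Rightarrow> ('x::real_normed_vector \<Rightarrow> 'z) \<Rightarrow> real \<Rightarrow> real set \<Rightarrow> (real \<Rightarrow> 'd) \<Rightarrow> real" where
  "Lq_norm iD i q I u =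
     (LINT t:I|lebesgue. norm (inv i (iD (u t))) powr q) powr (1 / q)"

definition F_space ::
  "('d::banach, 'x::banach, 'y::banach, 'z::banach) evolution \<Rightarrow> (real \<Rightarrow> 'd) set" where
  "F_space E = {u. continuous_on UNIV u \<and> bounded (range u) \<and>
     in_Lq (emb_D E) (emb_1 E) (expo_1 E) u \<and> in_Lq (emb_D E) (emb_2 E) (expo_2 E) u}"

text \<open>Intersections carry the sum of the norms; \<open>0\<close> is inserted to cover \<open>I = {}\<close>.\<close>

definition F1_norm :: "real set \<Rightarrow> (real \<Rightarrow> 'd::banach) \<Rightarrow> real" where
  "F1_norm I u = Sup (insert 0 ((\<lambda>t. norm (u t)) ` I))"

definition F2_norm ::
  "('d::banach, 'x::banach, 'y::banach, 'z::banach) evolution \<Rightarrow> real set \<Rightarrow> (real \<Rightarrow> 'd) \<Rightarrow> real" where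
  "F2_norm E I u =
     Lq_norm (emb_D E) (emb_1 E) (expo_1 E) I u + Lq_norm (emb_D E) (emb_2 E) (expo_2 E) I u"

definition F_norm ::
  "('d::banach, 'x::banach, 'y::banach, 'z::banach) evolution \<Rightarrow> real set \<Rightarrow> (real \<Rightarrow> 'd) \<Rightarrow> real" where
  "F_norm E I u = F1_norm I u + F2_norm E I u"

subsection \<open>Standing assumptions on the group and the nonlinearity\<close>

text \<open>
  For \<open>u\<close> in \<open>F\<close>, almost every \<open>u(t)\<close> lies in \<open>D \<inter> X\<^sub>1 \<inter> X\<^sub>2\<close>; the nonlinearity only has to
  make sense there.
\<close>

definition phi_domain :: "('d, 'x, 'y, 'z) evolution \<Rightarrow> 'z set" where
  "phi_domain E = range (emb_D E) \<inter> range (emb_1 E) \<inter> range (emb_2 E)"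

definition power_law :: "('d, 'x, 'y, 'z::real_vector) evolution \<Rightarrow> bool" where
  "power_law E \<longleftrightarrow>
     homogeneous_poly_on (phi_domain E) (deg E) (Phi E) \<and>
     (\<forall>j\<in>{1..deg E}.
        (\<forall>\<alpha>s. length \<alpha>s = j \<and> set \<alpha>s \<subseteq> phi_domain E \<longrightarrow>
           homogeneous_poly_on (phi_domain E) (deg E - j) (\<lambda>\<alpha>. Phi_j E j \<alpha> \<alpha>s)) \<and>
        (\<forall>\<alpha>\<in>phi_domain E. multilinear_on (phi_domain E) j (Phi_j E j \<alpha>))) \<and>
     (\<forall>a\<in>phi_domain E. \<forall>b\<in>phi_domain E.
        Phi E (a + b) - Phi E a = (\<Sum>j=1..deg E. Phi_j E j a (replicate j b)))"

definition evolution_setting ::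
  "('d::banach, 'x::banach, 'y::banach, 'z::banach) evolution \<Rightarrow> bool" where
  "evolution_setting E \<longleftrightarrow>
     bounded_linear (emb_D E) \<and> inj (emb_D E) \<and>
     bounded_linear (emb_1 E) \<and> inj (emb_1 E) \<and>
     bounded_linear (emb_2 E) \<and> inj (emb_2 E) \<and>
     (\<forall>t. bounded_linear (UZ E t)) \<and>
     (\<forall>z. UZ E 0 z = z) \<and>
     (\<forall>s t z. UZ E (s + t) z = UZ E s (UZ E t z)) \<and>
     (\<forall>t g. UZ E t (emb_D E g) = emb_D E (UD E t g)) \<and>
     1 \<le> expo_1 E \<and> 1 \<le> expo_2 E \<and>
     init_time E \<noteq> \<infinity> \<and>
     2 \<le> deg E \<and> power_law E"

subsection \<open>The Duhamel operators\<close>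

text \<open>The set of times between \<open>t\<^sub>0\<close> and \<open>t\<close>, which is \<open>{..t}\<close> if \<open>t\<^sub>0\<close> is \<open>-\<infinity>\<close>.\<close>

definition time_span :: "ereal \<Rightarrow> real \<Rightarrow> real set" where
  "time_span t\<^sub>0 t = {s. min t\<^sub>0 (ereal t) \<le> ereal s \<and> ereal s \<le> max t\<^sub>0 (ereal t)}"

text \<open>
  The oriented integral from \<open>t\<^sub>0\<close> to \<open>t\<close>. Over \<open>{..t}\<close> the library's Henstock-Kurzweil
  integral is the improper one, that is, the limit of the integrals over \<open>{a..t}\<close> as
  \<open>a \<rightarrow> -\<infinity>\<close>.
\<close>

definition oriented_integral :: "ereal \<Rightarrow> real \<Rightarrow> (real \<Rightarrow> 'z::banach) \<Rightarrow> 'z" where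
  "oriented_integral t\<^sub>0 t f =
     (if t\<^sub>0 \<le> ereal t then integral (time_span t\<^sub>0 t) f else - integral (time_span t\<^sub>0 t) f)"

definition Duhamel_exists ::
  "('d::banach, 'x::banach, 'y::banach, 'z::banach) evolution \<Rightarrow> (real \<Rightarrow> 'z) \<Rightarrow> bool" where
  "Duhamel_exists E h \<longleftrightarrow> (\<forall>t.
     (\<lambda>s. UZ E (t - s) (h s)) integrable_on time_span (init_time E) t \<and>
     oriented_integral (init_time E) t (\<lambda>s. UZ E (t - s) (h s)) \<in> range (emb_D E))"

definition Duhamel ::
  "('d::banach, 'x::banach, 'y::banach, 'z::banach) evolution \<Rightarrow> (real \<Rightarrow> 'z) \<Rightarrow> real \<Rightarrow> 'd" where
  "Duhamel E h t =
     inv (emb_D E) (oriented_integral (init_time E) t (\<lambda>s. UZ E (t - s) (h s)))"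

definition N ::
  "('d::banach, 'x::banach, 'y::banach, 'z::banach) evolution \<Rightarrow> (real \<Rightarrow> 'd) \<Rightarrow> real \<Rightarrow> 'd" where
  "N E u = Duhamel E (\<lambda>s. Phi E (emb_D E (u s)))"

definition N_source ::
  "('d, 'x, 'y, 'z) evolution \<Rightarrow> nat \<Rightarrow> (real \<Rightarrow> 'd) \<Rightarrow> (real \<Rightarrow> 'd) list \<Rightarrow> real \<Rightarrow> 'z" where
  "N_source E j u us s = Phi_j E j (emb_D E (u s)) (map (\<lambda>v. emb_D E (v s)) us)"

definition N_j ::
  "('d::banach, 'x::banach, 'y::banach, 'z::banach) evolution \<Rightarrow>
     nat \<Rightarrow> (real \<Rightarrow> 'd) \<Rightarrow> (real \<Rightarrow> 'd) list \<Rightarrow> real \<Rightarrow> 'd" where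
  "N_j E j u us = Duhamel E (N_source E j u us)"

subsection \<open>The assumptions on the evolution\<close>

definition H1 ::
  "('d::banach, 'x::banach, 'y::banach, 'z::banach) evolution \<Rightarrow> bool" where
  "H1 E \<longleftrightarrow> (\<exists>C\<^sub>0>0. \<forall>g.
     (\<lambda>t. UD E t g) \<in> F_space E \<and> F_norm E UNIV (\<lambda>t. UD E t g) \<le> C\<^sub>0 * norm g)"

text \<open>
  The estimates (H2) bound \<open>N\<^sub>j\<close> on \<open>I\<close> by the size of its arguments on \<open>I\<close>. This is meant
  for intervals \<open>I\<close> on which the Duhamel integral from \<open>t\<^sub>0\<close> to \<open>t\<close> only involves times in
  \<open>I\<close>. For arbitrary \<open>I\<close> and fixed \<open>t\<^sub>0\<close>, shrinking \<open>I\<close> to a point makes the right-hand side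
  tend to \<open>0\<close> and forces \<open>N\<^sub>j = 0\<close>. Restricting to these \<open>I\<close> weakens the hypothesis.
\<close>

definition causal_interval :: "ereal \<Rightarrow> real set \<Rightarrow> bool" where
  "causal_interval t\<^sub>0 I \<longleftrightarrow> is_interval I \<and> (\<forall>t\<in>I. time_span t\<^sub>0 t \<subseteq> I)"

definition H2 ::
  "('d::banach, 'x::banach, 'y::banach, 'z::banach) evolution \<Rightarrow> bool" where
  "H2 E \<longleftrightarrow>
     (\<forall>j\<in>{1..deg E}. \<forall>u\<in>F_space E. \<forall>us. length us = j \<and> set us \<subseteq> F_space E \<longrightarrow>
        Duhamel_exists E (N_source E j u us) \<and> N_j E j u us \<in> F_space E) \<and>
     (\<exists>\<delta>>0. \<exists>C>0. \<forall>u\<in>F_space E. \<forall>us I. set us \<subseteq> F_space E \<and> causal_interval (init_time E) I \<longrightarrow>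
        (\<forall>j. 1 \<le> j \<and> j \<le> deg E - 1 \<and> length us = j \<longrightarrow>
           F_norm E I (N_j E j u us) \<le>
             C * F2_norm E I u powr \<delta> * F_norm E UNIV u powr (real (deg E) - \<delta> - real j) *
             (\<Prod>l<j. F_norm E UNIV (us ! l))) \<and>
        (length us = deg E \<longrightarrow>
           F_norm E I (N_j E (deg E) u us) \<le>
             C * (\<Sum>l<deg E. F2_norm E I (us ! l) powr \<delta> * F_norm E UNIV (us ! l) powr (1 - \<delta>) *
                   (\<Prod>m\<in>{..<deg E} - {l}. F_norm E UNIV (us ! m)))))"

definition group_uniformly_bounded ::
  "('d::banach, 'x::banach, 'y::banach, 'z::banach) evolution \<Rightarrow> bool" where
  "group_uniformly_bounded E \<longleftrightarrow> (\<exists>M. \<forall>t g. norm (UD E t g) \<le> M * norm g)"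

subsection \<open>Solutions, the cascade of correctors, and scattering\<close>

definition solves ::
  "('d::banach, 'x::banach, 'y::banach, 'z::banach) evolution \<Rightarrow> 'd \<Rightarrow> (real \<Rightarrow> 'd) \<Rightarrow> bool" where
  "solves E g u \<longleftrightarrow> u \<in> F_space E \<and> (\<forall>t. u t = UD E t g + N E u t)"

text \<open>The equation for \<open>w m\<close> is implicit: \<open>w m\<close> also occurs on the right, for \<open>j = 1\<close>.\<close>

definition is_cascade ::
  "('d::banach, 'x::banach, 'y::banach, 'z::banach) evolution \<Rightarrow>
     (real \<Rightarrow> 'd) \<Rightarrow> 'd \<Rightarrow> (nat \<Rightarrow> real \<Rightarrow> 'd) \<Rightarrow> bool" where
  "is_cascade E u g w \<longleftrightarrow>
     (\<forall>k. w k \<in> F_space E) \<and>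
     (\<forall>t. w 0 t = UD E t g + N_j E 1 u [w 0] t) \<and>
     (\<forall>m\<ge>1. \<forall>t. w m t =
        (\<Sum>j=1..deg E. \<Sum>ls | length ls = j \<and> j + sum_list ls = m + 1. N_j E j u (map w ls) t))"

definition scatters_to ::
  "('d::banach, 'x::banach, 'y::banach, 'z::banach) evolution \<Rightarrow> (real \<Rightarrow> 'd) \<Rightarrow> 'd \<Rightarrow> bool" where
  "scatters_to E u v \<longleftrightarrow> ((\<lambda>t. UD E (- t) (u t)) \<longlongrightarrow> v) at_top"

text \<open>When every datum has a solution, there is at most one such \<open>S\<close>.\<close>

definition is_scattering_operator ::
  "('d::banach, 'x::banach, 'y::banach, 'z::banach) evolution \<Rightarrow> ('d \<Rightarrow> 'd) \<Rightarrow> bool" where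
  "is_scattering_operator E S \<longleftrightarrow> (\<forall>g u. solves E g u \<longrightarrow> scatters_to E u (S g))"

end

theory Submission
  imports Defs
begin

text \<open>
  Write the solution with datum \<open>ubar\<^sub>0 + g\<close> as \<open>ubar + v\<close>. Then \<open>v\<close> solves
  \<open>v = U(\<cdot>)g + (\<Sum>j. N\<^sub>j(ubar, v, \<dots>, v))\<close>, a polynomial equation in the Banach space \<open>F\<close> whose
  linear part is \<open>v - N\<^sub>1(ubar, v)\<close>. If this linear part is invertible on \<open>F\<close>, the equation can
  be solved by a power series in \<open>g\<close>, whose terms are the correctors, and everything else
  follows: the terms are bounded by a geometric sequence, scattering is a bounded operation that
  passes through the series, and an operator that is locally a power series with bounded
  multilinear coefficients is real analytic.

  \<^bold>\<open>Inverting the linear part\<close> (\<open>linear_solvable\<close>). The operator \<open>N\<^sub>1(ubar, \<cdot>)\<close> is a contraction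
  when \<open>ubar\<close> has a small \<open>F\<^sub>2\<close> norm. Since the exponents of \<open>F\<^sub>2\<close> are finite, time can be cut into
  finitely many slices on each of which \<open>ubar\<close> is small. Sharp cutoffs in time would destroy
  continuity, but multiplication by a continuous function of time acts on \<open>F\<close>, and by causality
  the coefficient \<open>ubar\<close> may be replaced by a smoothly cut off one as long as the unknown vanishes
  before the slice. Slices are measured with a clock \<open>\<rho>\<close> that increases away from the initial time
  (\<open>time_slices\<close>), which treats both directions of time, and an initial time \<open>-\<infinity>\<close>, alike.

  \<^bold>\<open>Uniqueness\<close> (\<open>difference_vanishes\<close>). The difference \<open>d\<close> of two solutions is not small in the sup
  norm, so the term \<open>N\<^sub>p(d, \<dots>, d)\<close> is not a contraction applied to \<open>d\<close>. It is however bounded by a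
  small multiple of the norm of \<open>d\<close> on a slightly longer time interval. Iterating this over many
  nested intervals inside one slice shows that \<open>d\<close> vanishes there.

  \<^bold>\<open>The series\<close> (\<open>cascade\<close>, \<open>cascade_bound\<close>, \<open>series_solution\<close>). The \<open>m\<close>-th corrector is the value on
  the diagonal of an \<open>(m + 1)\<close>-linear map of the datum, defined by recursion on \<open>m\<close>. The norms of
  these maps satisfy the recursion of the coefficients of a power series with positive radius of
  convergence.

  \<^bold>\<open>Scattering\<close> (\<open>N_j_scatters\<close>). If the arguments of \<open>N\<^sub>j\<close> are cut off to late times, the operator
  changes by a free evolution at late times and becomes small. Hence \<open>U(-t)N\<^sub>j(\<dots>)(t)\<close> is Cauchy.

  \<^bold>\<open>Analyticity\<close> (\<open>analytic_from_expansions\<close>). The directional derivative of a power series is again a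
  power series near the same center, uniformly in the direction. So all iterated directional
  derivatives have expansions, and the expansion at the center gives the Frechet estimate.
\<close>

section \<open>Lebesgue norms in time and Minkowski's inequality\<close>

text \<open>
  A norm bound as an inequality between upper integrals: integrability is then a consequence,
  and the class of functions with a given bound is stable under Fatou limits.
\<close>
definition Lq_bound :: "'a measure \<Rightarrow> real \<Rightarrow> ('a \<Rightarrow> real) \<Rightarrow> real \<Rightarrow> bool" where
  "Lq_bound M q a A \<longleftrightarrow> a \<in> borel_measurable M \<and> (\<forall>t. 0 \<le> a t) \<and> 0 \<le> A \<and>
     (\<integral>\<^sup>+ t. ennreal (a t powr q) \<partial>M) \<le> ennreal (A powr q)"

text \<open>
  Convexity of \<open>x \<mapsto> x powr q\<close> at \<open>(x + y) / (A + B)\<close>, the mean of \<open>x / A\<close> and \<open>y / B\<close> with weights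
  \<open>A / (A + B)\<close> and \<open>B / (A + B)\<close>. If \<open>A\<close> and \<open>B\<close> are the norms of two functions \<open>x\<close> and \<open>y\<close>, the
  integral of the right-hand side is \<open>(A + B) powr q\<close>.
\<close>
lemma powr_convex_combination:
  fixes x y A B q :: real
  assumes "1 \<le> q" "0 \<le> x" "0 \<le> y" "0 < A" "0 < B"
  shows "(x + y) powr q \<le>
    (A + B) powr (q - 1) * (A powr (1 - q) * x powr q + B powr (1 - q) * y powr q)"
proof -
  have *: "(x + y) powr q \<le>
    (A + B) powr (q - 1) * (A powr (1 - q) * x powr q + B powr (1 - q) * y powr q)"
    if "0 < x" "0 < y" for x y
  proof -
    have c: "convex_on {0<..} (\<lambda>x::real. x powr q)" by (rule powr_convex[OF assms(1)])
    have "(A / (A + B)) *\<^sub>R (x / A) + (B / (A + B)) *\<^sub>R (y / B) = (x + y) / (A + B)"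
      using assms by (simp add: add_divide_distrib)
    moreover have "((A / (A + B)) *\<^sub>R (x / A) + (B / (A + B)) *\<^sub>R (y / B)) powr q
        \<le> (A / (A + B)) * (x / A) powr q + (B / (A + B)) * (y / B) powr q"
      using c[unfolded convex_on_def, THEN conjunct2, rule_format,
          of "x/A" "y/B" "A/(A+B)" "B/(A+B)"] assms that
      by (simp add: add_divide_distrib[symmetric])
    ultimately have "((x + y) / (A + B)) powr q \<le>
        (A / (A + B)) * (x / A) powr q + (B / (A + B)) * (y / B) powr q" by simp
    then have "(A+B) powr q * ((x + y) / (A + B)) powr q \<le> (A+B) powr q *
        ((A / (A + B)) * (x / A) powr q + (B / (A + B)) * (y / B) powr q)"
      by (intro mult_left_mono) auto
    moreover have "(A+B) powr q * ((x + y) / (A + B)) powr q = (x + y) powr q"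
      using assms that by (simp add: powr_divide)
    moreover have "(A+B) powr q * ((A / (A + B)) * (x / A) powr q + (B / (A + B)) * (y / B) powr q)
       = (A + B) powr (q - 1) * (A powr (1 - q) * x powr q + B powr (1 - q) * y powr q)"
      using assms that by (simp add: powr_divide powr_diff distrib_left)
    ultimately show ?thesis by simp
  qed
  show ?thesis
  proof (cases "0 < x \<and> 0 < y")
    case False
    \<comment> \<open>One of the two is zero, where the convexity statement on the open half-line says nothing.\<close>
    have A1: "1 \<le> (A + B) powr (q - 1) * C powr (1 - q)"
      if "0 < C" "C \<le> A + B" for C
    proof -
      have "1 = C powr (q - 1) * C powr (1 - q)" using that by (simp add: powr_add[symmetric])
      also have "\<dots> \<le> (A + B) powr (q - 1) * C powr (1 - q)"
        using that assms by (intro mult_right_mono powr_mono2) auto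
      finally show ?thesis .
    qed
    consider "x = 0" | "y = 0" using False assms by linarith
    then show ?thesis
    proof cases
      case 1 then show ?thesis
        using mult_right_mono[OF A1[of B], of "y powr q"] assms by (simp add: mult.assoc)
    next
      case 2 then show ?thesis
        using mult_right_mono[OF A1[of A], of "x powr q"] assms by (simp add: mult.assoc)
    qed
  qed (use * in blast)
qed

text \<open>
  Minkowski's inequality. The norms are enlarged by \<open>e > 0\<close> before dividing by them, since they may
  vanish.
\<close>
lemma Lq_bound_add:
  assumes "1 \<le> q" "Lq_bound M q a A" "Lq_bound M q b B"
  shows "Lq_bound M q (\<lambda>t. a t + b t) (A + B)"
proof -
  note [measurable] = assms(2,3)[unfolded Lq_bound_def, THEN conjunct1]
  have a0: "0 \<le> a t" "0 \<le> b t" for t using assms by (auto simp: Lq_bound_def)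
  have A0: "0 \<le> A" "0 \<le> B" using assms by (auto simp: Lq_bound_def)
  have main: "(\<integral>\<^sup>+ t. ennreal ((a t + b t) powr q) \<partial>M) \<le> ennreal ((A + B + 2 * e) powr q)"
    if e: "0 < e" for e
  proof -
    define A' where "A' = A + e"
    define B' where "B' = B + e"
    have p: "0 < A'" "0 < B'" "A \<le> A'" "B \<le> B'" using A0 e by (auto simp: A'_def B'_def)
    define c where "c = (A' + B') powr (q - 1)"
    define ca where "ca = A' powr (1 - q)"
    define cb where "cb = B' powr (1 - q)"
    have c0: "0 \<le> c" "0 \<le> ca" "0 \<le> cb" by (auto simp: c_def ca_def cb_def)
    have "(\<integral>\<^sup>+ t. ennreal ((a t + b t) powr q) \<partial>M) \<le>
       (\<integral>\<^sup>+ t. ennreal c * (ennreal ca * ennreal (a t powr q) + ennreal cb * ennreal (b t powr q)) \<partial>M)"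
    proof (rule nn_integral_mono)
      fix t
      have "ennreal ((a t + b t) powr q) \<le> ennreal (c * (ca * a t powr q + cb * b t powr q))"
        unfolding c_def ca_def cb_def
        by (intro ennreal_leI powr_convex_combination) (use assms a0 p in auto)
      then show "ennreal ((a t + b t) powr q) \<le> ennreal c * (ennreal ca * ennreal (a t powr q) + ennreal cb * ennreal (b t powr q))"
        using c0 by (simp add: ennreal_mult ennreal_plus)
    qed
    also have "\<dots> = ennreal c * (ennreal ca * (\<integral>\<^sup>+ t. ennreal (a t powr q) \<partial>M)
        + ennreal cb * (\<integral>\<^sup>+ t. ennreal (b t powr q) \<partial>M))"
      by (simp add: nn_integral_cmult nn_integral_add)
    also have "\<dots> \<le> ennreal c * (ennreal ca * ennreal (A' powr q) + ennreal cb * ennreal (B' powr q))"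
    proof (intro mult_left_mono add_mono)
      show "(\<integral>\<^sup>+ t. ennreal (a t powr q) \<partial>M) \<le> ennreal (A' powr q)"
        using assms(2) p A0 assms(1) unfolding Lq_bound_def
        by (meson ennreal_leI order_trans powr_mono2 zero_le_one)
      show "(\<integral>\<^sup>+ t. ennreal (b t powr q) \<partial>M) \<le> ennreal (B' powr q)"
        using assms(3) p A0 assms(1) unfolding Lq_bound_def
        by (meson ennreal_leI order_trans powr_mono2 zero_le_one)
    qed auto
    also have "\<dots> = ennreal (c * (ca * A' powr q + cb * B' powr q))"
      using c0 by (simp add: ennreal_mult ennreal_plus)
    also have "c * (ca * A' powr q + cb * B' powr q) = (A' + B') powr q"
      using p by (simp add: c_def ca_def cb_def powr_add[symmetric] powr_mult_base mult.commute)
    finally show ?thesis by (simp add: A'_def B'_def algebra_simps)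
  qed
  have lim: "((\<lambda>e. ennreal ((A + B + 2 * e) powr q)) \<longlongrightarrow> ennreal ((A + B) powr q)) (at_right 0)"
  proof (rule tendsto_ennrealI)
    have "((\<lambda>e. A + B + 2 * e) \<longlongrightarrow> A + B) (at_right 0)"
      by (auto intro!: tendsto_eq_intros)
    then show "((\<lambda>e. (A + B + 2 * e) powr q) \<longlongrightarrow> (A + B) powr q) (at_right 0)"
      by (rule tendsto_powr'[OF _ tendsto_const])
        (use assms(1) A0 in \<open>auto intro!: eventually_mono[OF eventually_at_right_less]\<close>)
  qed
  have "(\<integral>\<^sup>+ t. ennreal ((a t + b t) powr q) \<partial>M) \<le> ennreal ((A + B) powr q)"
    by (rule tendsto_lowerbound[OF lim]) (auto intro!: main eventually_at_right_less[THEN eventually_mono])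
  then show ?thesis using assms a0 A0 by (auto simp: Lq_bound_def)
qed

lemma Lq_bound_dominated:
  assumes "Lq_bound M q a A" "AE t in M. b t \<le> a t" "b \<in> borel_measurable M" "\<And>t. 0 \<le> b t" "1 \<le> q"
  shows "Lq_bound M q b A"
proof -
  have "(\<integral>\<^sup>+ t. ennreal (b t powr q) \<partial>M) \<le> (\<integral>\<^sup>+ t. ennreal (a t powr q) \<partial>M)"
    by (rule nn_integral_mono_AE)
      (use assms in \<open>auto elim!: eventually_mono intro!: ennreal_leI powr_mono2\<close>)
  then show ?thesis using assms by (auto simp: Lq_bound_def)
qed

lemma Lq_bound_mono: "Lq_bound M q a A \<Longrightarrow> A \<le> B \<Longrightarrow> 1 \<le> q \<Longrightarrow> Lq_bound M q a B"
  unfolding Lq_bound_def by (meson ennreal_leI order_trans powr_mono2 zero_le_one)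

lemma Lq_bound_sum:
  assumes "1 \<le> q" "\<And>k. Lq_bound M q (a k) (A k)"
  shows "Lq_bound M q (\<lambda>t. \<Sum>k<n::nat. a k t) (\<Sum>k<n. A k)"
proof (induction n)
  case 0 then show ?case by (simp add: Lq_bound_def)
next
  case (Suc n) then show ?case using Lq_bound_add[OF assms(1) Suc assms(2)[of n]] by simp
qed

text \<open>
  By Fatou's lemma, since the bound is uniform in \<open>n\<close>.
\<close>
lemma Lq_bound_limit:
  assumes "1 \<le> q" "\<And>n. Lq_bound M q (a n) A" "AE t in M. (\<lambda>n::nat. a n t) \<longlonglongrightarrow> b t"
    and [measurable]: "b \<in> borel_measurable M" and "\<And>t. 0 \<le> b t"
  shows "Lq_bound M q b A"
proof -
  have [measurable]: "a n \<in> borel_measurable M" for n using assms(2) by (simp add: Lq_bound_def)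
  have "(\<integral>\<^sup>+ t. ennreal (b t powr q) \<partial>M) = (\<integral>\<^sup>+ t. liminf (\<lambda>n. ennreal (a n t powr q)) \<partial>M)"
  proof (rule nn_integral_cong_AE)
    show "AE t in M. ennreal (b t powr q) = liminf (\<lambda>n. ennreal (a n t powr q))"
      using assms(3)
    proof eventually_elim
      case (elim t)
      have nn: "0 \<le> a n t" for n using assms(2) by (simp add: Lq_bound_def)
      have "(\<lambda>n. ennreal (a n t powr q)) \<longlonglongrightarrow> ennreal (b t powr q)"
        by (intro tendsto_ennrealI tendsto_powr'[OF elim tendsto_const]) (use assms nn in auto)
      then show ?case by (simp add: lim_imp_Liminf[symmetric])
    qed
  qed
  also have "\<dots> \<le> liminf (\<lambda>n. \<integral>\<^sup>+ t. ennreal (a n t powr q) \<partial>M)"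
    by (rule nn_integral_liminf) measurable
  also have "\<dots> \<le> ennreal (A powr q)"
    using assms(2) by (intro Liminf_le always_eventually) (auto simp: Lq_bound_def)
  finally show ?thesis using assms by (auto simp: Lq_bound_def)
qed

lemma Lq_bound_iff_integral:
  assumes "1 \<le> q" "a \<in> borel_measurable M" "\<And>t. 0 \<le> a t" "0 \<le> A"
  shows "Lq_bound M q a A \<longleftrightarrow>
    integrable M (\<lambda>t. a t powr q) \<and> (\<integral>t. a t powr q \<partial>M) powr (1 / q) \<le> A"
proof -
  note [measurable] = assms(2)
  have *: "(x powr (1/q) \<le> A) = (x \<le> A powr q)" if "0 \<le> x" for x
  proof
    assume "x powr (1/q) \<le> A" then have "(x powr (1/q)) powr q \<le> A powr q"
      using assms by (intro powr_mono2) auto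
    then show "x \<le> A powr q" using assms that by (simp add: powr_powr)
  next
    assume "x \<le> A powr q" then have "x powr (1/q) \<le> (A powr q) powr (1/q)"
      using assms that by (intro powr_mono2) auto
    then show "x powr (1/q) \<le> A" using assms that by (simp add: powr_powr)
  qed
  have I: "(\<integral>\<^sup>+ t. ennreal (a t powr q) \<partial>M) = ennreal (\<integral>t. a t powr q \<partial>M)"
    if "integrable M (\<lambda>t. a t powr q)"
    using that by (intro nn_integral_eq_integral) auto
  have J: "integrable M (\<lambda>t. a t powr q)" if "(\<integral>\<^sup>+ t. ennreal (a t powr q) \<partial>M) \<le> ennreal (A powr q)"
    using that by (intro integrableI_nonneg) (auto simp: less_top[symmetric] top_unique)
  have P: "0 \<le> (\<integral>t. a t powr q \<partial>M)" by simp
  show ?thesis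
  proof
    assume "Lq_bound M q a A"
    then have le: "(\<integral>\<^sup>+ t. ennreal (a t powr q) \<partial>M) \<le> ennreal (A powr q)" by (simp add: Lq_bound_def)
    then show "integrable M (\<lambda>t. a t powr q) \<and> (\<integral>t. a t powr q \<partial>M) powr (1 / q) \<le> A"
      using J[OF le] I[OF J[OF le]] *[OF P] by simp
  next
    assume "integrable M (\<lambda>t. a t powr q) \<and> (\<integral>t. a t powr q \<partial>M) powr (1 / q) \<le> A"
    then show "Lq_bound M q a A" using I *[OF P] assms by (simp add: Lq_bound_def ennreal_leI)
  qed
qed

section \<open>Strong measurability in spaces that need not be separable\<close>

text \<open>
  Simple functions have finitely many values, so an approximating sequence takes values in a
  countable set \<open>range c\<close>. Conversely, sending \<open>t\<close> to the nearest of the first \<open>m\<close> points of \<open>c\<close> defines a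
  simple function, as soon as the distances to these points are measurable. This description
  passes to limits more easily than the existence of an approximating sequence.
\<close>
lemma strongly_measurable_iff:
  "strongly_measurable f \<longleftrightarrow> (\<exists>c :: nat \<Rightarrow> 'a::real_normed_vector.
     (\<forall>i. (\<lambda>t. norm (f t - c i)) \<in> borel_measurable lebesgue) \<and>
     (AE t in lebesgue. f t \<in> closure (range c)))"
proof
  assume "strongly_measurable f"
  then obtain s where s: "\<And>n. simple_function lebesgue (s n)"
    and lim: "AE t in lebesgue. (\<lambda>n. s n t) \<longlonglongrightarrow> f t"
    by (auto simp: strongly_measurable_def)
  define S where "S = (\<Union>n. range (s n))"
  have "finite (range (s n))" for n using simple_functionD(1)[OF s[of n]] by simp
  then have "countable S" unfolding S_def by (simp add: countable_finite)
  moreover have "S \<noteq> {}" by (simp add: S_def)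
  ultimately obtain c :: "nat \<Rightarrow> 'a" where c: "S = range c"
    using range_from_nat_into[of S] by metis
  have "(\<lambda>t. norm (f t - c i)) \<in> borel_measurable lebesgue" for i
  proof -
    let ?g = "\<lambda>t. lim (\<lambda>n. norm (s n t - c i))"
    have [measurable]: "(\<lambda>t. norm (s n t - c i)) \<in> borel_measurable lebesgue" for n
      using simple_function_compose1[OF s[of n], where g="\<lambda>x. norm (x - c i)"]
      by (rule borel_measurable_simple_function)
    have "AE t in lebesgue. ?g t = norm (f t - c i)"
      using lim by eventually_elim (rule limI, intro tendsto_norm tendsto_diff tendsto_const)
    moreover have "?g \<in> borel_measurable lebesgue" by measurable
    ultimately show ?thesis by (rule borel_measurable_AE[rotated])
  qed
  moreover have "AE t in lebesgue. f t \<in> closure (range c)"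
    using lim
  proof eventually_elim
    case (elim t)
    show ?case
      unfolding closure_sequential
      by (rule exI[of _ "\<lambda>n. s n t"]) (use elim in \<open>auto simp: c[symmetric] S_def\<close>)
  qed
  ultimately show "\<exists>c :: nat \<Rightarrow> 'a. (\<forall>i. (\<lambda>t. norm (f t - c i)) \<in> borel_measurable lebesgue) \<and>
     (AE t in lebesgue. f t \<in> closure (range c))" by blast
next
  assume "\<exists>c :: nat \<Rightarrow> 'a. (\<forall>i. (\<lambda>t. norm (f t - c i)) \<in> borel_measurable lebesgue) \<and>
     (AE t in lebesgue. f t \<in> closure (range c))"
  then obtain c :: "nat \<Rightarrow> 'a" where [measurable]: "\<And>i. (\<lambda>t. norm (f t - c i)) \<in> borel_measurable lebesgue"
    and cl: "AE t in lebesgue. f t \<in> closure (range c)" by blast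
  \<comment> \<open>the indices of the points nearest to \<open>f t\<close> among the first ones; the least of them is a measurable choice\<close>
  define P where "P m i t \<longleftrightarrow> i \<le> m \<and> (\<forall>j\<le>m. norm (f t - c i) \<le> norm (f t - c j))" for m i t
  define k where "k m t = (LEAST i. P m i t)" for m t
  have ex: "\<exists>i. P m i t" for m t
  proof -
    have "finite ((\<lambda>j. norm (f t - c j)) ` {..m})" "(\<lambda>j. norm (f t - c j)) ` {..m} \<noteq> {}" by auto
    then have "Min ((\<lambda>j. norm (f t - c j)) ` {..m}) \<in> (\<lambda>j. norm (f t - c j)) ` {..m}"
      by (rule Min_in)
    then obtain i where "Min ((\<lambda>j. norm (f t - c j)) ` {..m}) = norm (f t - c i)" "i \<in> {..m}"
      by (rule imageE)
    then have "P m i t" unfolding P_def by (metis Min_le atMost_iff finite_atMost finite_imageI imageI)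
    then show ?thesis ..
  qed
  have Pk: "P m (k m t) t" for m t unfolding k_def using ex by (rule LeastI_ex)
  have [measurable]: "Measurable.pred lebesgue (P m i)" for m i
    unfolding P_def by measurable
  have [measurable]: "k m \<in> measurable lebesgue (count_space UNIV)" for m
    unfolding k_def by measurable
  have "simple_function lebesgue (k m)" for m
  proof -
    have "range (k m) \<subseteq> {..m}" using Pk by (auto simp: P_def)
    then show ?thesis by (auto simp: simple_function_eq_measurable intro: finite_subset)
  qed
  then have "simple_function lebesgue (\<lambda>t. c (k m t))" for m
    by (rule simple_function_compose1)
  moreover have "AE t in lebesgue. (\<lambda>m. c (k m t)) \<longlonglongrightarrow> f t"
    using cl
  proof eventually_elim
    case (elim t)
    show ?case
    proof (rule LIMSEQ_I)
      fix e :: real assume "0 < e"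
      then obtain i where i: "norm (f t - c i) < e"
        using elim by (auto simp: closure_approachable dist_norm norm_minus_commute)
      show "\<exists>no. \<forall>n\<ge>no. norm (c (k n t) - f t) < e"
      proof (intro exI allI impI)
        fix n assume "i \<le> n"
        then have "norm (f t - c (k n t)) \<le> norm (f t - c i)" using Pk[of n t] by (auto simp: P_def)
        then show "norm (c (k n t) - f t) < e" using i by (simp add: norm_minus_commute)
      qed
    qed
  qed
  ultimately show "strongly_measurable f" unfolding strongly_measurable_def
    by (intro exI[of _ "\<lambda>m t. c (k m t)"]) auto
qed

lemma strongly_measurable_norm:
  assumes "strongly_measurable f" shows "(\<lambda>t. norm (f t)) \<in> borel_measurable lebesgue"
proof -
  obtain s where s: "\<And>n. simple_function lebesgue (s n)"
    and lim: "AE t in lebesgue. (\<lambda>n. s n t) \<longlonglongrightarrow> f t"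
    using assms by (auto simp: strongly_measurable_def)
  let ?g = "\<lambda>t. lim (\<lambda>n. norm (s n t))"
  have [measurable]: "(\<lambda>t. norm (s n t)) \<in> borel_measurable lebesgue" for n
    using simple_function_compose1[OF s[of n], where g=norm]
    by (rule borel_measurable_simple_function)
  have "AE t in lebesgue. ?g t = norm (f t)"
    using lim by eventually_elim (rule limI, intro tendsto_norm tendsto_diff tendsto_const)
  moreover have "?g \<in> borel_measurable lebesgue" by measurable
  ultimately show ?thesis by (rule borel_measurable_AE[rotated])
qed

lemma strongly_measurable_cong_AE:
  assumes "strongly_measurable f" "AE t in lebesgue. f t = g t"
  shows "strongly_measurable g"
proof -
  obtain s where s: "\<And>n. simple_function lebesgue (s n)" "AE t in lebesgue. (\<lambda>n. s n t) \<longlonglongrightarrow> f t"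
    using assms(1) by (auto simp: strongly_measurable_def)
  have "AE t in lebesgue. (\<lambda>n. s n t) \<longlonglongrightarrow> g t"
    using s(2) assms(2) by eventually_elim simp
  then show ?thesis using s(1) unfolding strongly_measurable_def by blast
qed

lemma strongly_measurable_add:
  assumes "strongly_measurable f" "strongly_measurable g"
  shows "strongly_measurable (\<lambda>t. f t + g t)"
proof -
  obtain s where s: "\<And>n. simple_function lebesgue (s n)" "AE t in lebesgue. (\<lambda>n. s n t) \<longlonglongrightarrow> f t"
    using assms(1) by (auto simp: strongly_measurable_def)
  obtain r where r: "\<And>n. simple_function lebesgue (r n)" "AE t in lebesgue. (\<lambda>n. r n t) \<longlonglongrightarrow> g t"
    using assms(2) by (auto simp: strongly_measurable_def)
  have "AE t in lebesgue. (\<lambda>n. s n t + r n t) \<longlonglongrightarrow> f t + g t"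
    using s(2) r(2) by eventually_elim (rule tendsto_add)
  then show ?thesis unfolding strongly_measurable_def
    using simple_function_add[OF s(1) r(1)] by (intro exI[of _ "\<lambda>n t. s n t + r n t"]) auto
qed

lemma strongly_measurable_scaleR:
  assumes "h \<in> borel_measurable lebesgue" "strongly_measurable f"
  shows "strongly_measurable (\<lambda>t. h t *\<^sub>R f t)"
proof -
  obtain s where s: "\<And>n. simple_function lebesgue (s n)" "AE t in lebesgue. (\<lambda>n. s n t) \<longlonglongrightarrow> f t"
    using assms(2) by (auto simp: strongly_measurable_def)
  obtain r where r: "\<And>n. simple_function lebesgue (r n)" "\<And>t. (\<lambda>n. r n t) \<longlonglongrightarrow> h t"
    using borel_measurable_implies_sequence_metric[OF assms(1), of 0] by auto
  have "AE t in lebesgue. (\<lambda>n. r n t *\<^sub>R s n t) \<longlonglongrightarrow> h t *\<^sub>R f t"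
    using s(2) by eventually_elim (intro tendsto_scaleR r)
  then show ?thesis unfolding strongly_measurable_def
    using simple_function_compose2[OF r(1) s(1), of "(*\<^sub>R)"]
    by (intro exI[of _ "\<lambda>n t. r n t *\<^sub>R s n t"]) auto
qed

lemma strongly_measurable_zero: "strongly_measurable (\<lambda>t. 0)"
  unfolding strongly_measurable_def by (intro exI[of _ "\<lambda>n t. 0"]) auto

text \<open>
  The values of the limit lie in the closure of the union of the countable sets that belong to
  the \<open>f n\<close>.
\<close>
lemma strongly_measurable_limit:
  fixes g :: "real \<Rightarrow> 'a::real_normed_vector"
  assumes "\<And>n. strongly_measurable (f n)" "AE t in lebesgue. (\<lambda>n::nat. f n t) \<longlonglongrightarrow> g t"
  shows "strongly_measurable g"
proof -
  have "\<exists>c :: nat \<Rightarrow> 'a. AE t in lebesgue. f n t \<in> closure (range c)" for n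
    using assms(1)[of n] unfolding strongly_measurable_iff by blast
  then have "\<forall>n. \<exists>c :: nat \<Rightarrow> 'a. AE t in lebesgue. f n t \<in> closure (range c)" by blast
  from choice[OF this] obtain c :: "nat \<Rightarrow> nat \<Rightarrow> 'a"
    where c: "\<And>n. AE t in lebesgue. f n t \<in> closure (range (c n))" by blast
  define C where "C i = (case prod_decode i of (n, k) \<Rightarrow> c n k)" for i
  have C: "range (c n) \<subseteq> range C" for n
  proof -
    have "c n k = C (prod_encode (n, k))" for k by (simp add: C_def)
    then show ?thesis by auto
  qed
  have "(\<lambda>t. norm (g t - C i)) \<in> borel_measurable lebesgue" for i
  proof -
    let ?g = "\<lambda>t. lim (\<lambda>n. norm (f n t + (- C i)))"
    have [measurable]: "(\<lambda>t. norm (f n t + (- C i))) \<in> borel_measurable lebesgue" for n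
    proof -
      have "strongly_measurable (\<lambda>t. - C i)"
        unfolding strongly_measurable_def by (intro exI[of _ "\<lambda>n t. - C i"]) auto
      then show ?thesis
        by (intro strongly_measurable_norm strongly_measurable_add assms)
    qed
    have "AE t in lebesgue. ?g t = norm (g t - C i)"
      using assms(2)
    proof eventually_elim
      case (elim t)
      have "(\<lambda>n. norm (f n t + (- C i))) \<longlonglongrightarrow> norm (g t + (- C i))"
        by (intro tendsto_norm tendsto_add tendsto_const elim)
      then show ?case by (simp add: limI)
    qed
    moreover have "?g \<in> borel_measurable lebesgue" by measurable
    ultimately show ?thesis by (rule borel_measurable_AE[rotated])
  qed
  moreover have "AE t in lebesgue. g t \<in> closure (range C)"
  proof -
    have "AE t in lebesgue. \<forall>n. f n t \<in> closure (range (c n))"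
      using c by (simp add: AE_all_countable)
    then show ?thesis using assms(2)
    proof eventually_elim
      case (elim t)
      show ?case
        by (rule Lim_in_closed_set[OF closed_closure _ _ elim(2)])
          (use elim(1) closure_mono[OF C] in \<open>auto simp: eventually_sequentially\<close>)
    qed
  qed
  ultimately show ?thesis unfolding strongly_measurable_iff by blast
qed

section \<open>Functions of time seen in an embedded space\<close>

locale Lq_embedding =
  fixes iD :: "'d::banach \<Rightarrow> 'z::banach" and i :: "'x::banach \<Rightarrow> 'z" and q :: real
  assumes lin_D: "bounded_linear iD" and lin: "bounded_linear i" and inj: "inj i" and q1: "1 \<le> q"
begin

text \<open>
  Meaningful only where \<open>iD x\<close> lies in the range of \<open>i\<close>, which is the case at almost every time for
  the functions considered.
\<close>
definition rep :: "'d \<Rightarrow> 'x" where "rep x = inv i (iD x)"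

text \<open>
  Membership in \<open>L\<^sup>q\<close> and a bound on the norm in one predicate, because both pass through sums,
  products with functions of time and series by the same argument.
\<close>
definition Lq_le :: "(real \<Rightarrow> 'd) \<Rightarrow> real \<Rightarrow> bool" where
  "Lq_le u A \<longleftrightarrow> (AE t in lebesgue. iD (u t) \<in> range i) \<and>
     strongly_measurable (\<lambda>t. rep (u t)) \<and> Lq_bound lebesgue q (\<lambda>t. norm (rep (u t))) A"

lemma rep_eq: "iD x \<in> range i \<Longrightarrow> i (rep x) = iD x"
  by (simp add: rep_def f_inv_into_f)

lemma rep_unique: "iD x = i y \<Longrightarrow> rep x = y"
  by (simp add: rep_def inj)

lemma Lq_le_iff: "0 \<le> A \<Longrightarrow> Lq_le u A \<longleftrightarrow> in_Lq iD i q u \<and> Lq_norm iD i q UNIV u \<le> A"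
proof -
  assume A: "0 \<le> A"
  have "Lq_bound lebesgue q (\<lambda>t. norm (rep (u t))) A \<longleftrightarrow>
      integrable lebesgue (\<lambda>t. norm (rep (u t)) powr q) \<and>
      (LINT t|lebesgue. norm (rep (u t)) powr q) powr (1 / q) \<le> A"
    if "strongly_measurable (\<lambda>t. rep (u t))"
    by (rule Lq_bound_iff_integral[OF q1 strongly_measurable_norm[OF that] _ A]) simp
  then show ?thesis
    by (auto simp: Lq_le_def in_Lq_def Lq_norm_def rep_def set_lebesgue_integral_def)
qed

lemma Lq_norm_nonneg: "0 \<le> Lq_norm iD i q I u"
  by (simp add: Lq_norm_def)

lemma in_LqD: "in_Lq iD i q u \<Longrightarrow> Lq_le u (Lq_norm iD i q UNIV u)"
  by (simp add: Lq_le_iff Lq_norm_nonneg)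

lemma Lq_le_nonneg: "Lq_le u A \<Longrightarrow> 0 \<le> A" by (simp add: Lq_le_def Lq_bound_def)

lemma Lq_le_mono: "Lq_le u A \<Longrightarrow> A \<le> B \<Longrightarrow> Lq_le u B"
  unfolding Lq_le_def using Lq_bound_mono q1 by blast

lemma rep_add: "iD x \<in> range i \<Longrightarrow> iD y \<in> range i \<Longrightarrow>
    rep (x + y) = rep x + rep y \<and> iD (x + y) \<in> range i"
proof -
  interpret D: bounded_linear iD by (rule lin_D)
  interpret X: bounded_linear i by (rule lin)
  assume "iD x \<in> range i" "iD y \<in> range i"
  then have "iD (x + y) = i (rep x + rep y)" by (simp add: D.add X.add rep_eq)
  then show ?thesis using rep_unique by blast
qed

lemma rep_scaleR: "iD x \<in> range i \<Longrightarrow> rep (c *\<^sub>R x) = c *\<^sub>R rep x \<and> iD (c *\<^sub>R x) \<in> range i"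
proof -
  interpret D: bounded_linear iD by (rule lin_D)
  interpret X: bounded_linear i by (rule lin)
  assume "iD x \<in> range i"
  then have "iD (c *\<^sub>R x) = i (c *\<^sub>R rep x)" by (simp add: D.scaleR X.scaleR rep_eq)
  then show ?thesis using rep_unique by blast
qed

lemma Lq_le_zero: "Lq_le (\<lambda>t. 0) 0"
proof -
  interpret D: bounded_linear iD by (rule lin_D)
  interpret X: bounded_linear i by (rule lin)
  have "0 \<in> range i" using X.zero by (metis rangeI)
  moreover have "iD 0 = i 0" by (simp add: D.zero X.zero)
  moreover from this have "rep 0 = 0" by (rule rep_unique)
  ultimately show ?thesis
    by (auto simp: Lq_le_def Lq_bound_def strongly_measurable_zero D.zero)
qed

lemma Lq_le_add:
  assumes "Lq_le u A" "Lq_le v B" shows "Lq_le (\<lambda>t. u t + v t) (A + B)"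
proof -
  have ae: "AE t in lebesgue. rep (u t) + rep (v t) = rep (u t + v t) \<and> iD (u t + v t) \<in> range i"
    using assms[unfolded Lq_le_def, THEN conjunct1]
    by eventually_elim (use rep_add in auto)
  have sm: "strongly_measurable (\<lambda>t. rep (u t + v t))"
    by (rule strongly_measurable_cong_AE[OF strongly_measurable_add[of "\<lambda>t. rep (u t)" "\<lambda>t. rep (v t)"]])
      (use assms ae in \<open>auto simp: Lq_le_def\<close>)
  have "Lq_bound lebesgue q (\<lambda>t. norm (rep (u t)) + norm (rep (v t))) (A + B)"
    using assms by (intro Lq_bound_add q1) (auto simp: Lq_le_def)
  then have "Lq_bound lebesgue q (\<lambda>t. norm (rep (u t + v t))) (A + B)"
  proof (rule Lq_bound_dominated)
    show "AE t in lebesgue. norm (rep (u t + v t)) \<le> norm (rep (u t)) + norm (rep (v t))"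
      using ae by eventually_elim (metis norm_triangle_ineq)
  qed (auto intro: strongly_measurable_norm sm q1)
  with sm ae show ?thesis by (auto simp: Lq_le_def)
qed

lemma Lq_le_multiplier_aux:
  assumes "Lq_le u A" "h \<in> borel_measurable lebesgue"
    "Lq_bound lebesgue q (\<lambda>t. \<bar>h t\<bar> * norm (rep (u t))) B"
  shows "Lq_le (\<lambda>t. h t *\<^sub>R u t) B"
proof -
  have ae: "AE t in lebesgue. h t *\<^sub>R rep (u t) = rep (h t *\<^sub>R u t) \<and> iD (h t *\<^sub>R u t) \<in> range i"
    using assms(1)[unfolded Lq_le_def, THEN conjunct1]
    by eventually_elim (use rep_scaleR in auto)
  have sm: "strongly_measurable (\<lambda>t. rep (h t *\<^sub>R u t))"
    by (rule strongly_measurable_cong_AE[OF strongly_measurable_scaleR[OF assms(2)]])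
      (use assms ae in \<open>auto simp: Lq_le_def\<close>)
  have "Lq_bound lebesgue q (\<lambda>t. norm (rep (h t *\<^sub>R u t))) B"
    using assms(3)
  proof (rule Lq_bound_dominated)
    show "AE t in lebesgue. norm (rep (h t *\<^sub>R u t)) \<le> \<bar>h t\<bar> * norm (rep (u t))"
      using ae by eventually_elim (metis norm_scaleR order_refl)
  qed (auto intro: strongly_measurable_norm sm q1)
  with sm ae show ?thesis by (auto simp: Lq_le_def)
qed

lemma Lq_le_multiplier:
  assumes "Lq_le u A" "h \<in> borel_measurable lebesgue" "\<And>t. \<bar>h t\<bar> \<le> c"
  shows "Lq_le (\<lambda>t. h t *\<^sub>R u t) (c * A)"
proof -
  note [measurable] = assms(2)
  have c: "0 \<le> c" using assms(3)[of 0] by linarith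
  have A: "0 \<le> A" using assms(1) by (rule Lq_le_nonneg)
  have b: "Lq_bound lebesgue q (\<lambda>t. norm (rep (u t))) A" using assms(1) by (simp add: Lq_le_def)
  have [measurable]: "(\<lambda>t. norm (rep (u t))) \<in> borel_measurable lebesgue" using b by (simp add: Lq_bound_def)
  have "(\<integral>\<^sup>+ t. ennreal ((c * norm (rep (u t))) powr q) \<partial>lebesgue)
      = (\<integral>\<^sup>+ t. ennreal (c powr q) * ennreal (norm (rep (u t)) powr q) \<partial>lebesgue)"
    by (simp add: powr_mult ennreal_mult)
  also have "\<dots> = ennreal (c powr q) * (\<integral>\<^sup>+ t. ennreal (norm (rep (u t)) powr q) \<partial>lebesgue)"
    by (rule nn_integral_cmult) measurable
  also have "\<dots> \<le> ennreal (c powr q) * ennreal (A powr q)"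
    using b by (intro mult_left_mono) (auto simp: Lq_bound_def)
  also have "\<dots> = ennreal ((c * A) powr q)" using c A by (simp add: powr_mult ennreal_mult)
  finally have "Lq_bound lebesgue q (\<lambda>t. c * norm (rep (u t))) (c * A)"
    using c A by (simp add: Lq_bound_def)
  then have "Lq_bound lebesgue q (\<lambda>t. \<bar>h t\<bar> * norm (rep (u t))) (c * A)"
    by (rule Lq_bound_dominated) (auto intro!: mult_right_mono assms(3) q1)
  then show ?thesis by (rule Lq_le_multiplier_aux[OF assms(1,2)])
qed

text \<open>
  The bound only sees the times at which \<open>h\<close> does not vanish: this is where the smallness of cut
  off functions comes from.
\<close>
lemma Lq_le_cutoff:
  assumes "Lq_le u A" "h \<in> borel_measurable lebesgue" "\<And>t. \<bar>h t\<bar> \<le> 1"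
  shows "integrable lebesgue (\<lambda>t. norm (rep (u t)) powr q)"
    and "Lq_le (\<lambda>t. h t *\<^sub>R u t)
      ((LINT t:{t. h t \<noteq> 0}|lebesgue. norm (rep (u t)) powr q) powr (1 / q))"
proof -
  note [measurable] = assms(2)
  have b: "Lq_bound lebesgue q (\<lambda>t. norm (rep (u t))) A" using assms(1) by (simp add: Lq_le_def)
  have [measurable]: "(\<lambda>t. norm (rep (u t))) \<in> borel_measurable lebesgue" using b by (simp add: Lq_bound_def)
  show I: "integrable lebesgue (\<lambda>t. norm (rep (u t)) powr q)"
    using b Lq_bound_iff_integral[OF q1, of "\<lambda>t. norm (rep (u t))" lebesgue A] Lq_le_nonneg[OF assms(1)] by simp
  have "{t \<in> space lebesgue. h t \<noteq> 0} \<in> sets lebesgue" by measurable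
  then have M [measurable]: "{t. h t \<noteq> 0} \<in> sets lebesgue" by simp
  have e: "indicator {t. h t \<noteq> 0} t *\<^sub>R norm (rep (u t)) powr q =
    (indicator {t. h t \<noteq> 0} t * norm (rep (u t))) powr q" for t
    by (simp add: indicator_def)
  have "integrable lebesgue (\<lambda>t. indicator {t. h t \<noteq> 0} t *\<^sub>R norm (rep (u t)) powr q)"
    by (rule integrable_mult_indicator[OF M I])
  then have "Lq_bound lebesgue q (\<lambda>t. indicator {t. h t \<noteq> 0} t * norm (rep (u t)))
     ((LINT t:{t. h t \<noteq> 0}|lebesgue. norm (rep (u t)) powr q) powr (1 / q))"
    by (subst Lq_bound_iff_integral[OF q1]) (auto simp: set_lebesgue_integral_def e[unfolded real_scaleR_def, symmetric])
  then have "Lq_bound lebesgue q (\<lambda>t. \<bar>h t\<bar> * norm (rep (u t)))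
     ((LINT t:{t. h t \<noteq> 0}|lebesgue. norm (rep (u t)) powr q) powr (1 / q))"
    by (rule Lq_bound_dominated) 
      (use assms(3) in \<open>auto intro!: mult_left_le_one_le q1 simp: indicator_def mult_left_le_one_le\<close>)
  then show "Lq_le (\<lambda>t. h t *\<^sub>R u t)
      ((LINT t:{t. h t \<noteq> 0}|lebesgue. norm (rep (u t)) powr q) powr (1 / q))"
    by (rule Lq_le_multiplier_aux[OF assms(1,2)])
qed

text \<open>
  Completeness of \<open>L\<^sup>q\<close>. The sum of the norms is finite at almost every time by monotone convergence,
  so the series converges in the embedded space; as both embeddings are continuous, its sum there
  represents \<open>U t\<close>.
\<close>
lemma Lq_le_suminf:
  assumes u: "\<And>k. Lq_le (u k) (A k)" and A: "summable A" and s: "\<And>t. (\<lambda>k. u k t) sums U t"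
  shows "Lq_le U (suminf A)"
proof -
  interpret D: bounded_linear iD by (rule lin_D)
  interpret X: bounded_linear i by (rule lin)
  have A0: "0 \<le> A k" for k using u by (rule Lq_le_nonneg)
  have sm: "strongly_measurable (\<lambda>t. rep (u k t))" for k using u by (simp add: Lq_le_def)
  define a where "a n t = (\<Sum>k<n. norm (rep (u k t)))" for n t
  have [measurable]: "(\<lambda>t. norm (rep (u k t))) \<in> borel_measurable lebesgue" for k
    by (rule strongly_measurable_norm[OF sm])
  have [measurable]: "a n \<in> borel_measurable lebesgue" for n unfolding a_def by measurable
  have ab: "Lq_bound lebesgue q (a n) (suminf A)" for n
    unfolding a_def
    by (rule Lq_bound_mono[OF Lq_bound_sum[OF q1]])
      (use u A A0 q1 in \<open>auto simp: Lq_le_def intro: sum_le_suminf\<close>)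
  have mono: "a m t \<le> a n t" if "m \<le> n" for m n t
    unfolding a_def by (rule sum_mono2) (use that in auto)
  have a0: "0 \<le> a n t" for n t by (simp add: a_def sum_nonneg)
  have "(\<integral>\<^sup>+ t. (SUP n. ennreal (a n t powr q)) \<partial>lebesgue) = (SUP n. \<integral>\<^sup>+ t. ennreal (a n t powr q) \<partial>lebesgue)"
    by (rule nn_integral_monotone_convergence_SUP)
      (use q1 in \<open>auto simp: incseq_def le_fun_def intro!: ennreal_leI powr_mono2 a0 mono\<close>)
  also have "\<dots> \<le> ennreal (suminf A powr q)"
    using ab by (auto simp: Lq_bound_def intro: SUP_least)
  finally have fin: "(\<integral>\<^sup>+ t. (SUP n. ennreal (a n t powr q)) \<partial>lebesgue) \<noteq> \<infinity>"
    using less_top[symmetric] top_unique by (metis ennreal_less_top infinity_ennreal_def leD)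
  have meas: "(\<lambda>t. SUP n. ennreal (a n t powr q)) \<in> borel_measurable lebesgue" by measurable
  from fin have "AE t in lebesgue. (SUP n. ennreal (a n t powr q)) \<noteq> \<infinity>"
    by (intro nn_integral_PInf_AE meas) auto
  then have summ: "AE t in lebesgue. summable (\<lambda>k. norm (rep (u k t)))"
  proof eventually_elim
    case (elim t)
    then obtain B where B: "(SUP n. ennreal (a n t powr q)) = ennreal B" "0 \<le> B"
      by (cases "SUP n. ennreal (a n t powr q)") auto
    have aB: "a n t \<le> B powr (1/q)" for n
    proof -
      have "ennreal (a n t powr q) \<le> ennreal B" using B(1) by (metis SUP_upper UNIV_I)
      then have "(a n t powr q) powr (1/q) \<le> B powr (1/q)"
        using B(2) q1 by (intro powr_mono2) (auto simp: ennreal_le_iff)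
      then show ?thesis using q1 a0 by (simp add: powr_powr)
    qed
    then show ?case
      using aB[of "Suc _"]
      by (intro bounded_imp_summable[where B="B powr (1/q)"])
        (auto simp only: a_def lessThan_Suc_atMost norm_ge_zero)
  qed
  have rng: "AE t in lebesgue. \<forall>k. iD (u k t) \<in> range i"
    unfolding AE_all_countable using u by (simp add: Lq_le_def)
  have ae: "AE t in lebesgue. (\<lambda>n. \<Sum>k<n. rep (u k t)) \<longlonglongrightarrow> rep (U t) \<and> iD (U t) \<in> range i"
    using summ rng
  proof eventually_elim
    case (elim t)
    have c: "summable (\<lambda>k. rep (u k t))" using elim(1) by (rule summable_norm_cancel)
    have "(\<lambda>k. i (rep (u k t))) sums i (\<Sum>k. rep (u k t))"
      by (rule X.sums[OF summable_sums[OF c]])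
    then have "(\<lambda>k. iD (u k t)) sums i (\<Sum>k. rep (u k t))" using elim(2) by (simp add: rep_eq)
    moreover have "(\<lambda>k. iD (u k t)) sums iD (U t)" by (rule D.sums[OF s])
    ultimately have e: "iD (U t) = i (\<Sum>k. rep (u k t))" by (rule sums_unique2[symmetric])
    then show ?case using summable_LIMSEQ[OF c] rep_unique[OF e] by auto
  qed
  have sms: "strongly_measurable (\<lambda>t. \<Sum>k<n. rep (u k t))" for n
    by (induction n) (auto intro: strongly_measurable_zero strongly_measurable_add sm)
  have smU: "strongly_measurable (\<lambda>t. rep (U t))"
    by (rule strongly_measurable_limit[OF sms]) (use ae in auto)
  have "Lq_bound lebesgue q (\<lambda>t. norm (rep (U t))) (suminf A)"
  proof (rule Lq_bound_limit[OF q1])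
    show "Lq_bound lebesgue q (\<lambda>t. norm (\<Sum>k<n. rep (u k t))) (suminf A)" for n
      by (rule Lq_bound_dominated[OF ab])
        (auto simp: a_def intro!: norm_sum strongly_measurable_norm sms q1)
    show "AE t in lebesgue. (\<lambda>n. norm (\<Sum>k<n. rep (u k t))) \<longlonglongrightarrow> norm (rep (U t))"
      using ae by eventually_elim (auto intro: tendsto_norm)
  qed (auto intro: strongly_measurable_norm smU)
  with smU ae show ?thesis by (auto simp: Lq_le_def)
qed

end

section \<open>Slicing time along the Duhamel integral\<close>

text \<open>
  The clock \<open>\<rho>\<close>. Time is truncated to an interval \<open>[-A, A]\<close> outside of which \<open>g\<close> has little mass, and
  \<open>\<rho>\<close> is the distance of the truncated time to the truncated initial time. It increases along every
  time span, so its sublevel sets are causal. A slab \<open>a < \<rho> < a + \<delta>\<close> consists of at most two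
  intervals of length \<open>\<delta>\<close>, one on each side of the initial time, and perhaps the tails.
\<close>
lemma time_slices:
  fixes g :: "real \<Rightarrow> real"
  assumes g: "integrable lebesgue g" "\<And>t. 0 \<le> g t" and "0 < \<eta>" and t0: "t\<^sub>0 \<noteq> (\<infinity>::ereal)"
  obtains \<rho> :: "real \<Rightarrow> real" and \<delta> B :: real where
    "continuous_on UNIV \<rho>" "0 < \<delta>" "\<And>t. 0 \<le> \<rho> t" "\<And>t. \<rho> t \<le> B"
    "\<And>s t. s \<in> time_span t\<^sub>0 t \<Longrightarrow> \<rho> s \<le> \<rho> t"
    "\<And>a. (LINT t:{t. a < \<rho> t \<and> \<rho> t < a + \<delta>}|lebesgue. g t) \<le> \<eta>"
proof -
  have ind: "integrable lebesgue (\<lambda>t. indicator S t * g t)" if "S \<in> sets lebesgue" for S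
    using integrable_mult_indicator[OF that g(1)] by simp
  have "(\<lambda>n. \<integral>t. indicator {t. real n \<le> \<bar>t\<bar>} t * g t \<partial>lebesgue) \<longlonglongrightarrow> (\<integral>t. 0 \<partial>(lebesgue :: real measure))"
  proof (rule integral_dominated_convergence[where w=g])
    show "AE t in lebesgue. (\<lambda>n. indicator {t. real n \<le> \<bar>t\<bar>} t * g t) \<longlonglongrightarrow> 0"
    proof (rule AE_I2)
      fix t :: real
      have "\<forall>\<^sub>F n in sequentially. \<bar>t\<bar> < real n" using filterlim_real_sequentially by (simp add: filterlim_at_top_dense)
      then show "(\<lambda>n. indicator {t. real n \<le> \<bar>t\<bar>} t * g t) \<longlonglongrightarrow> 0"
        by (intro tendsto_eventually) (erule eventually_mono, simp)
    qed
    show "(\<lambda>t. indicator {t. real n \<le> \<bar>t\<bar>} t * g t) \<in> borel_measurable lebesgue" for n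
      by (intro borel_measurable_integrable ind) auto
  qed (use g in \<open>auto simp: indicator_def\<close>)
  then have "\<forall>\<^sub>F n in sequentially. (\<integral>t. indicator {t. real n \<le> \<bar>t\<bar>} t * g t \<partial>lebesgue) < \<eta> / 3"
    using assms(3) by (intro order_tendstoD(2)) auto
  then obtain n where n: "(\<integral>t. indicator {t. real n \<le> \<bar>t\<bar>} t * g t \<partial>lebesgue) < \<eta> / 3"
    by (auto simp: eventually_sequentially)
  define A where "A = real n"
  have A: "0 \<le> A" by (simp add: A_def)
  \<comment> \<open>Above a high level \<open>m\<close> there is little mass, and below it the mass of an interval is at most \<open>m\<close> times its length.\<close>
  have "(\<lambda>n. \<integral>t. g t - min (g t) (real n) \<partial>lebesgue) \<longlonglongrightarrow> (\<integral>t. 0 \<partial>(lebesgue :: real measure))"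
  proof (rule integral_dominated_convergence[where w=g])
    have [measurable]: "g \<in> borel_measurable lebesgue" using g by auto
    show "(\<lambda>t. g t - min (g t) (real n)) \<in> borel_measurable lebesgue" for n by measurable
    show "AE t in lebesgue. (\<lambda>n. g t - min (g t) (real n)) \<longlonglongrightarrow> 0"
    proof (rule AE_I2)
      fix t :: real
      obtain N where "g t \<le> real N" using real_arch_simple by blast
      then have "\<forall>\<^sub>F n in sequentially. g t - min (g t) (real n) = 0"
        unfolding eventually_sequentially by (intro exI[of _ N]) auto
      then show "(\<lambda>n. g t - min (g t) (real n)) \<longlonglongrightarrow> 0" by (rule tendsto_eventually)
    qed
  qed (use g in \<open>auto simp: min_def\<close>)
  then have "\<forall>\<^sub>F n in sequentially. (\<integral>t. g t - min (g t) (real n) \<partial>lebesgue) < \<eta> / 6"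
    using assms(3) by (intro order_tendstoD(2)) auto
  then obtain m where m: "(\<integral>t. g t - min (g t) (real m) \<partial>lebesgue) < \<eta> / 6"
    by (auto simp: eventually_sequentially)
  define \<delta> where "\<delta> = \<eta> / (6 * (real m + 1))"
  have d: "0 < \<delta>" "real m * \<delta> \<le> \<eta> / 6"
    using assms(3) by (auto simp: \<delta>_def field_simps)
  have I1: "integrable lebesgue (\<lambda>t. g t - min (g t) (real m))"
    by (rule Bochner_Integration.integrable_bound[OF g(1)]) (use g in \<open>auto simp: min_def\<close>)
  have I2: "integrable lebesgue (indicator {x..y} :: real \<Rightarrow> real)" for x y :: real
    by (rule integrable_real_indicator) (auto simp: emeasure_lborel_Icc_eq)
  have short: "(\<integral>t. indicator {x..x+\<delta>} t * g t \<partial>lebesgue) \<le> \<eta> / 3" for x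
  proof -
    have "(\<integral>t. indicator {x..x+\<delta>} t * g t \<partial>lebesgue) \<le>
      (\<integral>t. (g t - min (g t) (real m)) + real m * indicator {x..x+\<delta>} t \<partial>lebesgue)"
      by (intro integral_mono ind Bochner_Integration.integrable_add I1 integrable_mult_right I2)
        (use g(2) in \<open>auto simp: indicator_def min_def\<close>)
    also have "\<dots> = (\<integral>t. g t - min (g t) (real m) \<partial>lebesgue) + real m * measure lebesgue {x..x+\<delta>}"
      by (subst Bochner_Integration.integral_add[OF I1 integrable_mult_right[OF I2]]) simp
    also have "measure lebesgue {x..x+\<delta>} = \<delta>" using d by simp
    finally show ?thesis using m d by linarith
  qed
  define cl where "cl t = max (- A) (min A t)" for t
  define c where "c = (if t\<^sub>0 = -\<infinity> then - A else cl (real_of_ereal t\<^sub>0))"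
  define \<rho> where "\<rho> t = \<bar>cl t - c\<bar>" for t
  have clb: "- A \<le> cl t" "cl t \<le> A" for t using A by (auto simp: cl_def)
  have clm: "cl s \<le> cl t" if "s \<le> t" for s t using that by (auto simp: cl_def)
  have cb: "- A \<le> c" "c \<le> A" using clb A by (auto simp: c_def)
  show ?thesis
  proof (rule that[of \<rho> \<delta> "2 * A"])
    show "continuous_on UNIV \<rho>" unfolding \<rho>_def cl_def by (intro continuous_intros)
    show "\<rho> t \<le> 2 * A" for t using clb[of t] cb by (auto simp: \<rho>_def)
    show "\<rho> s \<le> \<rho> t" if "s \<in> time_span t\<^sub>0 t" for s t
    proof (cases t\<^sub>0)
      case (real r)
      then have "(r \<le> s \<and> s \<le> t) \<or> (t \<le> s \<and> s \<le> r)"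
        using that by (auto simp: time_span_def min_def max_def split: if_splits)
      then show ?thesis using clm[of r s] clm[of s t] clm[of t s] clm[of s r] real
        by (auto simp: \<rho>_def c_def)
    next
      case MInf
      then have "s \<le> t" using that by (auto simp: time_span_def)
      then show ?thesis using clm[of s t] clb[of s] MInf by (auto simp: \<rho>_def c_def)
    next
      case PInf
      then show ?thesis using t0 by simp
    qed
    show "(LINT t:{t. a < \<rho> t \<and> \<rho> t < a + \<delta>}|lebesgue. g t) \<le> \<eta>" for a
    proof -
      have i1: "integrable lebesgue (\<lambda>t. indicator {t. A \<le> \<bar>t\<bar>} t * g t)"
        by (intro ind) auto
      have i2: "integrable lebesgue (\<lambda>t. indicator {c+a..c+a+\<delta>} t * g t)"
        by (intro ind) auto
      have i3: "integrable lebesgue (\<lambda>t. indicator {c-a-\<delta>..c-a-\<delta>+\<delta>} t * g t)"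
        by (intro ind) auto
      have "(\<integral>t. indicator {t. a < \<rho> t \<and> \<rho> t < a + \<delta>} t * g t \<partial>lebesgue) \<le>
         (\<integral>t. indicator {t. A \<le> \<bar>t\<bar>} t * g t + (indicator {c+a..c+a+\<delta>} t * g t
           + indicator {c-a-\<delta>..c-a-\<delta>+\<delta>} t * g t) \<partial>lebesgue)"
      proof (intro integral_mono_AE' Bochner_Integration.integrable_add i1 i2 i3 AE_I2)
        fix t
        show "indicator {t. a < \<rho> t \<and> \<rho> t < a + \<delta>} t * g t \<le> indicator {t. A \<le> \<bar>t\<bar>} t * g t + (indicator {c+a..c+a+\<delta>} t * g t
           + indicator {c-a-\<delta>..c-a-\<delta>+\<delta>} t * g t)"
          using g(2)[of t] by (auto simp: indicator_def \<rho>_def cl_def abs_if split: if_splits)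
      qed (use g in auto)
      also have "\<dots> = (\<integral>t. indicator {t. A \<le> \<bar>t\<bar>} t * g t \<partial>lebesgue)
         + ((\<integral>t. indicator {c+a..c+a+\<delta>} t * g t \<partial>lebesgue)
           + (\<integral>t. indicator {c-a-\<delta>..c-a-\<delta>+\<delta>} t * g t \<partial>lebesgue))"
        by (simp only: Bochner_Integration.integral_add i1 i2 i3 Bochner_Integration.integrable_add)
      also have "\<dots> \<le> \<eta>" using n short[of "c+a"] short[of "c-a-\<delta>"] by (simp add: A_def)
      finally show ?thesis by (simp add: set_lebesgue_integral_def)
    qed
  qed (auto simp: \<rho>_def d)
qed

section \<open>The space of solutions\<close>

locale evolution_problem =
  fixes E :: "('d::banach, 'x::banach, 'y::banach, 'z::banach) evolution"
  assumes setting: "evolution_setting E" and H1: "H1 E" and H2: "H2 E"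
    and grp: "group_uniformly_bounded E"

sublocale evolution_problem \<subseteq> L1: Lq_embedding "emb_D E" "emb_1 E" "expo_1 E"
  by (rule Lq_embedding.intro) (use setting in \<open>simp_all only: evolution_setting_def\<close>)

sublocale evolution_problem \<subseteq> L2: Lq_embedding "emb_D E" "emb_2 E" "expo_2 E"
  by (rule Lq_embedding.intro) (use setting in \<open>simp_all only: evolution_setting_def\<close>)

context evolution_problem
begin

abbreviation "F \<equiv> F_space E"
abbreviation "nF \<equiv> F_norm E UNIV"
abbreviation "n2 \<equiv> F2_norm E UNIV"

lemma F_iff: "u \<in> F \<longleftrightarrow> continuous_on UNIV u \<and> bounded (range u) \<and> (\<exists>A. L1.Lq_le u A) \<and> (\<exists>A. L2.Lq_le u A)"
  unfolding F_space_def
  using L1.in_LqD L2.in_LqD L1.Lq_le_iff L2.Lq_le_iff L1.Lq_le_nonneg L2.Lq_le_nonneg by blast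

lemma F_continuous: "u \<in> F \<Longrightarrow> continuous_on UNIV u" by (simp add: F_iff)

lemma F1_le:
  assumes "\<And>t. norm (u t) \<le> c" shows "F1_norm UNIV u \<le> c"
  unfolding F1_norm_def
  using assms norm_ge_zero[of "u 0"] order_trans[OF norm_ge_zero assms[of 0]]
  by (intro cSup_least) auto

lemma F1_ge:
  assumes "bounded (range u)" shows "norm (u t) \<le> F1_norm UNIV u"
proof -
  obtain b where "\<And>t. norm (u t) \<le> b" using assms by (auto simp: bounded_iff)
  then have "bdd_above (insert 0 ((\<lambda>t. norm (u t)) ` UNIV))"
    by (intro bdd_aboveI[of _ "max 0 b"]) (auto intro: le_max_iff_disj[THEN iffD2])
  then show ?thesis unfolding F1_norm_def by (intro cSup_upper) auto
qed

lemma F1_nonneg: "bounded (range u) \<Longrightarrow> 0 \<le> F1_norm UNIV u"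
  using F1_ge[of u 0] norm_ge_zero order_trans by blast

text \<open>
  The three parts of the norm of \<open>F\<close> are bounded separately, so that membership in \<open>F\<close> and norm bounds
  are proved together.
\<close>
definition F_le :: "(real \<Rightarrow> 'd) \<Rightarrow> real \<Rightarrow> real \<Rightarrow> real \<Rightarrow> bool" where
  "F_le u a b c \<longleftrightarrow> continuous_on UNIV u \<and> (\<forall>t. norm (u t) \<le> a) \<and> L1.Lq_le u b \<and> L2.Lq_le u c"

lemma F_leD:
  assumes "F_le u a b c"
  shows "u \<in> F" "n2 u \<le> b + c" "nF u \<le> a + b + c"
proof -
  have "b \<ge> 0" "c \<ge> 0" using assms L1.Lq_le_nonneg L2.Lq_le_nonneg by (auto simp: F_le_def)
  show "u \<in> F" unfolding F_iff using assms by (auto simp: F_le_def bounded_iff)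
  have 1: "Lq_norm (emb_D E) (emb_1 E) (expo_1 E) UNIV u \<le> b"
    using assms \<open>b \<ge> 0\<close> by (simp add: F_le_def L1.Lq_le_iff)
  have 2: "Lq_norm (emb_D E) (emb_2 E) (expo_2 E) UNIV u \<le> c"
    using assms \<open>c \<ge> 0\<close> by (simp add: F_le_def L2.Lq_le_iff)
  from 1 2 show n2: "n2 u \<le> b + c" unfolding F2_norm_def by linarith
  show "nF u \<le> a + b + c"
    using n2 F1_le[of u a] assms unfolding F_norm_def F_le_def by fastforce
qed

lemma F_leI:
  assumes "u \<in> F"
  obtains a b c where "F_le u a b c" "n2 u = b + c" "nF u = a + b + c" "0 \<le> a" "0 \<le> b" "0 \<le> c"
proof (rule that)
  let ?b = "Lq_norm (emb_D E) (emb_1 E) (expo_1 E) UNIV u"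
  let ?c = "Lq_norm (emb_D E) (emb_2 E) (expo_2 E) UNIV u"
  show "F_le u (F1_norm UNIV u) ?b ?c"
    using assms by (auto simp: F_le_def F_space_def intro: F1_ge L1.in_LqD L2.in_LqD)
  show "0 \<le> F1_norm UNIV u" using assms by (auto simp: F_space_def intro: F1_nonneg)
qed (auto simp: F2_norm_def F_norm_def L1.Lq_norm_nonneg L2.Lq_norm_nonneg)

lemma n2_nonneg [simp]: "0 \<le> n2 u"
  by (simp add: F2_norm_def L1.Lq_norm_nonneg L2.Lq_norm_nonneg)

lemma n2_le_nF: "u \<in> F \<Longrightarrow> n2 u \<le> nF u"
  by (erule F_leI) auto

lemma nF_nonneg: "u \<in> F \<Longrightarrow> 0 \<le> nF u"
  using n2_nonneg n2_le_nF order_trans by blast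

lemma norm_le_nF: "u \<in> F \<Longrightarrow> norm (u t) \<le> nF u"
  by (erule F_leI) (auto simp: F_le_def intro: order_trans add_increasing2)

lemma F_zero: "(\<lambda>t. 0) \<in> F" "nF (\<lambda>t. 0) \<le> 0"
  using F_leD[of "\<lambda>t. 0" 0 0 0] L1.Lq_le_zero L2.Lq_le_zero by (auto simp: F_le_def)

lemma F_add:
  assumes "u \<in> F" "v \<in> F"
  shows "(\<lambda>t. u t + v t) \<in> F" "nF (\<lambda>t. u t + v t) \<le> nF u + nF v"
proof -
  obtain a b c where u: "F_le u a b c" "nF u = a + b + c" using assms(1) by (rule F_leI)
  obtain a' b' c' where v: "F_le v a' b' c'" "nF v = a' + b' + c'" using assms(2) by (rule F_leI)
  have "F_le (\<lambda>t. u t + v t) (a + a') (b + b') (c + c')"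
    using u v by (auto simp: F_le_def intro!: continuous_intros L1.Lq_le_add L2.Lq_le_add
      intro: norm_triangle_mono)
  from F_leD[OF this] u v show "(\<lambda>t. u t + v t) \<in> F" "nF (\<lambda>t. u t + v t) \<le> nF u + nF v" by auto
qed

lemma F_le_multiplier:
  assumes "F_le u a b c" "continuous_on UNIV h" "\<And>t. \<bar>h t\<bar> \<le> k"
  shows "F_le (\<lambda>t. h t *\<^sub>R u t) (k * a) (k * b) (k * c)"
proof -
  have h: "h \<in> borel_measurable lebesgue"
    using borel_measurable_continuous_onI[OF assms(2)] by (simp add: measurable_completion)
  have "norm (h t *\<^sub>R u t) \<le> k * a" for t
    using assms(1,3) by (auto simp: F_le_def intro!: mult_mono order_trans[OF abs_ge_zero assms(3)])
  then show ?thesis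
    using assms h by (auto simp: F_le_def intro!: continuous_intros L1.Lq_le_multiplier L2.Lq_le_multiplier)
qed

text \<open>
  \<open>F\<close> is a module over the bounded continuous functions of time, so that continuous cutoffs in time
  are available in \<open>F\<close>.
\<close>
lemma F_multiplier:
  assumes "u \<in> F" "continuous_on UNIV h" "\<And>t. \<bar>h t\<bar> \<le> k"
  shows "(\<lambda>t. h t *\<^sub>R u t) \<in> F" "nF (\<lambda>t. h t *\<^sub>R u t) \<le> k * nF u"
proof -
  obtain a b c where u: "F_le u a b c" "nF u = a + b + c" using assms(1) by (rule F_leI)
  from F_leD[OF F_le_multiplier[OF u(1) assms(2,3)]] u
  show "(\<lambda>t. h t *\<^sub>R u t) \<in> F" "nF (\<lambda>t. h t *\<^sub>R u t) \<le> k * nF u"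
    by (auto simp: algebra_simps)
qed

lemma F_scaleR:
  assumes "u \<in> F" shows "(\<lambda>t. c *\<^sub>R u t) \<in> F" "nF (\<lambda>t. c *\<^sub>R u t) \<le> \<bar>c\<bar> * nF u"
  using F_multiplier[OF assms, of "\<lambda>t. c" "\<bar>c\<bar>"] by auto

lemma F_diff:
  assumes "u \<in> F" "v \<in> F"
  shows "(\<lambda>t. u t - v t) \<in> F" "nF (\<lambda>t. u t - v t) \<le> nF u + nF v"
  using F_add[OF assms(1) F_scaleR(1)[OF assms(2), of "-1"]] F_scaleR(2)[OF assms(2), of "-1"]
  by auto

lemma F_sum:
  assumes "finite S" "\<And>k. k \<in> S \<Longrightarrow> u k \<in> F"
  shows "(\<lambda>t. \<Sum>k\<in>S. u k t) \<in> F \<and> nF (\<lambda>t. \<Sum>k\<in>S. u k t) \<le> (\<Sum>k\<in>S. nF (u k))"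
  using assms
proof (induction S)
  case empty then show ?case using F_zero by simp
next
  case (insert x S)
  then show ?case using F_add[of "u x" "\<lambda>t. \<Sum>k\<in>S. u k t"] by fastforce
qed

text \<open>
  The density whose integral over the support of a cutoff controls the \<open>F\<^sub>2\<close> norm of the cut off
  function.
\<close>
definition mass :: "(real \<Rightarrow> 'd) \<Rightarrow> real \<Rightarrow> real" where
  "mass u t = norm (L1.rep (u t)) powr expo_1 E + norm (L2.rep (u t)) powr expo_2 E"

lemma mass_nonneg: "0 \<le> mass u t" by (simp add: mass_def)

lemma mass_integrable: "u \<in> F \<Longrightarrow> integrable lebesgue (mass u)"
  unfolding mass_def
  using L1.Lq_le_cutoff(1)[of u _ "\<lambda>t. 0"] L2.Lq_le_cutoff(1)[of u _ "\<lambda>t. 0"]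
  by (auto simp: F_iff)

lemma cutoff_small:
  assumes "0 < e"
  obtains \<eta> where "0 < \<eta>" "\<And>u h. u \<in> F \<Longrightarrow> continuous_on UNIV h \<Longrightarrow> (\<And>t. \<bar>h t\<bar> \<le> 1) \<Longrightarrow>
     (LINT t:{t. h t \<noteq> 0}|lebesgue. mass u t) \<le> \<eta> \<Longrightarrow> n2 (\<lambda>t. h t *\<^sub>R u t) \<le> e"
proof (rule that)
  define \<eta> where "\<eta> = min ((e/2) powr expo_1 E) ((e/2) powr expo_2 E)"
  show "0 < \<eta>" using assms by (simp add: \<eta>_def)
  fix u and h :: "real \<Rightarrow> real"
  assume u: "u \<in> F" and ch: "continuous_on UNIV h" and h1: "\<And>t. \<bar>h t\<bar> \<le> 1"
    and small: "(LINT t:{t. h t \<noteq> 0}|lebesgue. mass u t) \<le> \<eta>"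
  have h: "h \<in> borel_measurable lebesgue"
    using borel_measurable_continuous_onI[OF ch] by (simp add: measurable_completion)
  note [measurable] = h
  have "{t \<in> space lebesgue. h t \<noteq> 0} \<in> sets lebesgue" by measurable
  then have S: "{t. h t \<noteq> 0} \<in> sets lebesgue" by simp
  obtain A B where A: "L1.Lq_le u A" and B: "L2.Lq_le u B" using u by (auto simp: F_iff)
  note c1 = L1.Lq_le_cutoff[OF A h h1] and c2 = L2.Lq_le_cutoff[OF B h h1]
  note im = mass_integrable[OF u]
  have le: "(LINT t:{t. h t \<noteq> 0}|lebesgue. f t) \<le> \<eta>" "0 \<le> (LINT t:{t. h t \<noteq> 0}|lebesgue. f t)"
    if "integrable lebesgue f" "\<And>t. f t \<le> mass u t" "\<And>t. 0 \<le> f t" for f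
  proof -
    have "(LINT t:{t. h t \<noteq> 0}|lebesgue. f t) \<le> (LINT t:{t. h t \<noteq> 0}|lebesgue. mass u t)"
      unfolding set_lebesgue_integral_def
      by (intro integral_mono integrable_mult_indicator S im that(1) scaleR_left_mono that) auto
    then show "(LINT t:{t. h t \<noteq> 0}|lebesgue. f t) \<le> \<eta>" using small by simp
    show "0 \<le> (LINT t:{t. h t \<noteq> 0}|lebesgue. f t)"
      unfolding set_lebesgue_integral_def using that(3) by (intro integral_nonneg_AE) auto
  qed
  have root: "x powr (1/q) \<le> e / 2" if "0 \<le> x" "x \<le> (e/2) powr q" "1 \<le> q" for x q
  proof -
    have "x powr (1/q) \<le> ((e/2) powr q) powr (1/q)" using that by (intro powr_mono2) auto
    then show ?thesis using that assms by (simp add: powr_powr)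
  qed
  have "L1.Lq_le (\<lambda>t. h t *\<^sub>R u t) (e/2)"
    by (rule L1.Lq_le_mono[OF c1(2)], rule root)
      (use le[OF c1(1)] L1.q1 in \<open>auto simp: mass_def \<eta>_def\<close>)
  moreover have "L2.Lq_le (\<lambda>t. h t *\<^sub>R u t) (e/2)"
    by (rule L2.Lq_le_mono[OF c2(2)], rule root)
      (use le[OF c2(1)] L2.q1 in \<open>auto simp: mass_def \<eta>_def\<close>)
  ultimately show "n2 (\<lambda>t. h t *\<^sub>R u t) \<le> e"
    using assms by (simp add: L1.Lq_le_iff L2.Lq_le_iff F2_norm_def)
qed

text \<open>
  Completeness of \<open>F\<close>: absolutely convergent series converge in \<open>F\<close>, to the sum formed pointwise in \<open>D\<close>.
\<close>
lemma F_suminf: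
  assumes u: "\<And>k. u k \<in> F" and s: "summable (\<lambda>k. nF (u k))"
  shows "\<And>t. summable (\<lambda>k. u k t)" "(\<lambda>t. \<Sum>k. u k t) \<in> F" "nF (\<lambda>t. \<Sum>k. u k t) \<le> (\<Sum>k. nF (u k))"
proof -
  have "\<forall>k. \<exists>a b c. F_le (u k) a b c \<and> nF (u k) = a + b + c \<and> 0 \<le> a \<and> 0 \<le> b \<and> 0 \<le> c"
    using F_leI[OF u] by metis
  then obtain a b c where abc: "\<And>k. F_le (u k) (a k) (b k) (c k)" "\<And>k. nF (u k) = a k + b k + c k"
    "\<And>k. 0 \<le> a k" "\<And>k. 0 \<le> b k" "\<And>k. 0 \<le> c k" by metis
  have sa: "summable a" by (rule summable_comparison_test'[OF s, of 0]) (use abc in auto)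
  have sb: "summable b" by (rule summable_comparison_test'[OF s, of 0]) (use abc in auto)
  have sc: "summable c" by (rule summable_comparison_test'[OF s, of 0]) (use abc in auto)
  have le: "norm (u k t) \<le> a k" for k t using abc(1) by (simp add: F_le_def)
  have sn: "summable (\<lambda>k. norm (u k t))" for t
    by (rule summable_comparison_test'[OF sa, of 0]) (use le in auto)
  then show su: "summable (\<lambda>k. u k t)" for t by (rule summable_norm_cancel)
  have "uniform_limit UNIV (\<lambda>n t. \<Sum>k<n. u k t) (\<lambda>t. \<Sum>k. u k t) sequentially"
    by (rule Weierstrass_m_test[OF _ sa]) (use le in auto)
  then have cont: "continuous_on UNIV (\<lambda>t. \<Sum>k. u k t)"
    by (rule uniform_limit_theorem[rotated])
      (simp, intro always_eventually allI continuous_on_sum F_continuous[OF u])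
  have "norm (\<Sum>k. u k t) \<le> suminf a" for t
    by (rule order_trans[OF summable_norm[OF sn] suminf_le[OF _ sn sa]]) (rule le)
  then have "F_le (\<lambda>t. \<Sum>k. u k t) (suminf a) (suminf b) (suminf c)"
    using cont abc(1) unfolding F_le_def
    by (auto intro!: L1.Lq_le_suminf[OF _ sb] L2.Lq_le_suminf[OF _ sc] summable_sums su)
  moreover have "suminf a + suminf b + suminf c = (\<Sum>k. nF (u k))"
    using sa sb sc abc(2) by (simp add: suminf_add summable_add)
  ultimately show "(\<lambda>t. \<Sum>k. u k t) \<in> F" "nF (\<lambda>t. \<Sum>k. u k t) \<le> (\<Sum>k. nF (u k))"
    using F_leD by fastforce+
qed

end

section \<open>The Duhamel operators\<close>

lemma AE_lebesgueE:
  fixes P :: "real \<Rightarrow> bool"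
  assumes "AE s in lebesgue. P s"
  obtains S where "negligible S" "\<And>s. s \<notin> S \<Longrightarrow> P s"
proof -
  obtain S where "S \<in> null_sets lebesgue" "{s \<in> space lebesgue. \<not> P s} \<subseteq> S"
    using assms by (auto simp: eventually_ae_filter)
  then show ?thesis using that[of S] by (auto simp: negligible_iff_null_sets)
qed

text \<open>
  The exponent \<open>d\<close> of the small norm \<open>x\<close> can be lowered at the expense of the large norm \<open>y\<close>. This turns
  the possibly negative power \<open>q - d\<close> of \<open>y\<close> into the nonnegative power \<open>q - d'\<close>, which is bounded for
  bounded \<open>y\<close>.
\<close>
lemma powr_interpolate:
  fixes x y R q :: real
  assumes "0 \<le> x" "x \<le> y" "y \<le> R" "0 < d'" "d' \<le> d" "d' \<le> q"
  shows "x powr d * y powr (q - d) \<le> x powr d' * (R + 1) powr (q - d')"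
proof (cases "x = 0")
  case False
  then have p: "0 < x" "0 < y" using assms by auto
  have "x powr d * y powr (q - d) = x powr d' * (x powr (d - d') * y powr (q - d))"
    using p by (simp add: powr_add[symmetric] mult.assoc[symmetric])
  also have "\<dots> \<le> x powr d' * (y powr (d - d') * y powr (q - d))"
    using p assms by (intro mult_left_mono mult_right_mono powr_mono2) auto
  also have "\<dots> = x powr d' * y powr (q - d')"
    using p by (simp add: powr_add[symmetric])
  also have "\<dots> \<le> x powr d' * (R + 1) powr (q - d')"
    using p assms by (intro mult_left_mono powr_mono2) auto
  finally show ?thesis .
qed (use assms in simp)

lemma prod_list_map_nth: "prod_list (map f xs) = (\<Prod>l<length xs. f (xs ! l))"
  for f :: "'a \<Rightarrow> 'b::comm_monoid_mult"
  using prod.list_conv_set_nth[of "map f xs"] by (simp add: atLeast0LessThan)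

lemma prod_list_nonneg_map: "(\<And>x. x \<in> set xs \<Longrightarrow> 0 \<le> f x) \<Longrightarrow> (0::real) \<le> prod_list (map f xs)"
  by (induction xs) auto

context evolution_problem
begin

abbreviation "t0 \<equiv> init_time E"
abbreviation "p \<equiv> deg E"
abbreviation "iD \<equiv> emb_D E"

lemma p_ge_2: "2 \<le> p" and power_law: "power_law E" and t0_fin: "t0 \<noteq> \<infinity>"
  and inj_D: "inj iD" and UZ_linear: "bounded_linear (UZ E t)" and lin_D: "bounded_linear iD"
  and UZ_add: "UZ E (s + t) z = UZ E s (UZ E t z)" and UZ_0: "UZ E 0 z = z"
  and UZ_D: "UZ E t (iD g) = iD (UD E t g)"
  using setting by (simp_all only: evolution_setting_def simp_thms)

lemma iD_eq: "iD x = iD y \<longleftrightarrow> x = y"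
  using inj_D by (simp add: inj_eq)

lemma UD_add: "UD E (s + t) g = UD E s (UD E t g)"
  unfolding iD_eq[symmetric] by (simp add: UZ_D[symmetric] UZ_add)

lemma UD_0: "UD E 0 g = g"
  unfolding iD_eq[symmetric] by (simp add: UZ_D[symmetric] UZ_0)

lemma UD_inverse: "UD E (- t) (UD E t g) = g" "UD E t (UD E (- t) g) = g"
  by (simp_all add: UD_add[symmetric] UD_0)

lemma UD_lincomb: "UD E t (a *\<^sub>R x + b *\<^sub>R y) = a *\<^sub>R UD E t x + b *\<^sub>R UD E t y"
proof -
  interpret Z: bounded_linear "UZ E t" by (rule UZ_linear)
  interpret D: bounded_linear iD by (rule lin_D)
  show ?thesis
    unfolding iD_eq[symmetric]
    by (simp add: D.add D.scaleR UZ_D[symmetric] Z.add Z.scaleR)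
qed

lemma UD_bound: obtains M where "0 \<le> M" "\<And>t g. norm (UD E t g) \<le> M * norm g"
proof -
  obtain M where "\<And>t g. norm (UD E t g) \<le> M * norm g"
    using grp by (auto simp: group_uniformly_bounded_def)
  then have "norm (UD E t g) \<le> max 0 M * norm g" for t g
    by (meson max.cobounded2 mult_right_mono norm_ge_zero order_trans)
  then show ?thesis using that[of "max 0 M"] by simp
qed

lemma UD_bounded_linear: "bounded_linear (UD E t)"
proof -
  obtain M where M: "0 \<le> M" "\<And>t g. norm (UD E t g) \<le> M * norm g" by (rule UD_bound) blast
  show ?thesis
    by (rule bounded_linear_intro[where K=M])
      (use UD_lincomb[of t 1 _ 1] UD_lincomb[of t _ _ 0] M in \<open>auto simp: mult.commute\<close>)
qed

text \<open>
  The Duhamel integral as a relation between source and solution, which combines the existence of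
  the integral with its value. Before the initial time the oriented integral carries a minus sign.
\<close>
definition solves_Duhamel :: "(real \<Rightarrow> 'z) \<Rightarrow> (real \<Rightarrow> 'd) \<Rightarrow> bool" where
  "solves_Duhamel h u \<longleftrightarrow> (\<forall>t. ((\<lambda>s. UZ E (t - s) (h s)) has_integral
     (if t0 \<le> ereal t then iD (u t) else - iD (u t))) (time_span t0 t))"

lemma solves_Duhamel_iff: "solves_Duhamel h u \<longleftrightarrow> Duhamel_exists E h \<and> Duhamel E h = u"
proof
  assume l: "solves_Duhamel h u"
  have o: "oriented_integral t0 t (\<lambda>s. UZ E (t - s) (h s)) = iD (u t)" for t
    using l[unfolded solves_Duhamel_def, rule_format, of t]
    by (auto simp: oriented_integral_def dest!: integral_unique split: if_splits)
  have "Duhamel_exists E h"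
    using l unfolding Duhamel_exists_def solves_Duhamel_def o by blast
  moreover have "Duhamel E h = u"
    by (rule ext) (simp add: Duhamel_def o inj_D)
  ultimately show "Duhamel_exists E h \<and> Duhamel E h = u" ..
next
  assume r: "Duhamel_exists E h \<and> Duhamel E h = u"
  show "solves_Duhamel h u" unfolding solves_Duhamel_def
  proof
    fix t
    have i: "(\<lambda>s. UZ E (t - s) (h s)) integrable_on time_span t0 t"
      and o: "oriented_integral t0 t (\<lambda>s. UZ E (t - s) (h s)) \<in> range iD"
      using r by (auto simp: Duhamel_exists_def)
    have "iD (u t) = oriented_integral t0 t (\<lambda>s. UZ E (t - s) (h s))"
      using r o by (auto simp: Duhamel_def f_inv_into_f)
    then show "((\<lambda>s. UZ E (t - s) (h s)) has_integral (if t0 \<le> ereal t then iD (u t) else - iD (u t))) (time_span t0 t)"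
      using integrable_integral[OF i] by (auto simp: oriented_integral_def)
  qed
qed

lemma Duhamel_lincomb:
  assumes "solves_Duhamel h u" "solves_Duhamel k v"
  shows "solves_Duhamel (\<lambda>s. a *\<^sub>R h s + b *\<^sub>R k s) (\<lambda>t. a *\<^sub>R u t + b *\<^sub>R v t)"
  unfolding solves_Duhamel_def
proof
  fix t
  interpret D: bounded_linear iD by (rule lin_D)
  have e: "UZ E (t - s) (a *\<^sub>R h s + b *\<^sub>R k s) = a *\<^sub>R UZ E (t - s) (h s) + b *\<^sub>R UZ E (t - s) (k s)" for s
  proof -
    interpret Z: bounded_linear "UZ E (t - s)" by (rule UZ_linear)
    show ?thesis by (simp add: Z.add Z.scaleR)
  qed
  have "((\<lambda>s. a *\<^sub>R UZ E (t - s) (h s) + b *\<^sub>R UZ E (t - s) (k s)) has_integral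
    a *\<^sub>R (if t0 \<le> ereal t then iD (u t) else - iD (u t)) + b *\<^sub>R (if t0 \<le> ereal t then iD (v t) else - iD (v t)))
     (time_span t0 t)"
    by (intro has_integral_add has_integral_cmul) (use assms in \<open>simp_all only: solves_Duhamel_def\<close>)
  then show "((\<lambda>s. UZ E (t - s) (a *\<^sub>R h s + b *\<^sub>R k s)) has_integral
       (if t0 \<le> ereal t then iD (a *\<^sub>R u t + b *\<^sub>R v t) else - iD (a *\<^sub>R u t + b *\<^sub>R v t))) (time_span t0 t)"
    by (cases "t0 \<le> ereal t") (simp_all add: e D.add D.scaleR)
qed

lemma Duhamel_zero: "solves_Duhamel (\<lambda>s. 0) (\<lambda>t. 0)"
proof -
  interpret D: bounded_linear iD by (rule lin_D)
  have "UZ E t 0 = 0" for t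
  proof -
    interpret Z: bounded_linear "UZ E t" by (rule UZ_linear)
    show ?thesis by (rule Z.zero)
  qed
  then show ?thesis by (simp add: solves_Duhamel_def D.zero)
qed

lemma Duhamel_sum:
  assumes "finite S" "\<And>k. k \<in> S \<Longrightarrow> solves_Duhamel (h k) (u k)"
  shows "solves_Duhamel (\<lambda>s. \<Sum>k\<in>S. h k s) (\<lambda>t. \<Sum>k\<in>S. u k t)"
  using assms
proof (induction S)
  case (insert x S)
  then show ?case using Duhamel_lincomb[of "h x" "u x" "\<lambda>s. \<Sum>k\<in>S. h k s" "\<lambda>s. \<Sum>k\<in>S. u k s" 1 1] by simp
qed (simp add: Duhamel_zero)

text \<open>
  Causality: the value at \<open>t\<close> depends on the source between the initial time and \<open>t\<close>.
\<close>
lemma Duhamel_local: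
  assumes "solves_Duhamel h u" "solves_Duhamel k v"
    "AE s in lebesgue. s \<in> time_span t0 t \<longrightarrow> h s = k s"
  shows "u t = v t"
proof -
  obtain S where S: "negligible S" "\<And>s. s \<notin> S \<Longrightarrow> s \<in> time_span t0 t \<longrightarrow> h s = k s"
    using AE_lebesgueE[OF assms(3)] by blast
  have "((\<lambda>s. UZ E (t - s) (h s)) has_integral (if t0 \<le> ereal t then iD (v t) else - iD (v t))) (time_span t0 t)"
    by (rule has_integral_spike[OF S(1) _ assms(2)[unfolded solves_Duhamel_def, rule_format]]) (use S(2) in auto)
  then have "(if t0 \<le> ereal t then iD (u t) else - iD (u t)) = (if t0 \<le> ereal t then iD (v t) else - iD (v t))"
    using assms(1) has_integral_unique unfolding solves_Duhamel_def by blast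
  then show ?thesis by (auto simp: iD_eq split: if_splits)
qed

lemma Duhamel_cong_AE:
  assumes "solves_Duhamel h u" "AE s in lebesgue. h s = k s"
  shows "solves_Duhamel k u"
proof -
  obtain S where S: "negligible S" "\<And>s. s \<notin> S \<Longrightarrow> h s = k s"
    using AE_lebesgueE[OF assms(2)] by blast
  show ?thesis unfolding solves_Duhamel_def
  proof
    fix t
    show "((\<lambda>s. UZ E (t - s) (k s)) has_integral (if t0 \<le> ereal t then iD (u t) else - iD (u t))) (time_span t0 t)"
      by (rule has_integral_spike[OF S(1) _ assms(1)[unfolded solves_Duhamel_def, rule_format]]) (use S(2) in auto)
  qed
qed

text \<open>
  A source that is switched off at time \<open>T\<close> leaves a free evolution.
\<close>
lemma Duhamel_free_after:
  assumes "solves_Duhamel h u" "AE s in lebesgue. T \<le> s \<longrightarrow> h s = 0"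
    "t0 \<le> ereal t'" "T \<le> t'" "t' \<le> t"
  shows "u t = UD E (t - t') (u t')"
proof -
  have t: "t0 \<le> ereal t" using assms(3,5) by (meson ereal_less_eq(3) order_trans)
  obtain S where S: "negligible S" "\<And>s. s \<notin> S \<Longrightarrow> T \<le> s \<longrightarrow> h s = 0"
    using AE_lebesgueE[OF assms(2)] by blast
  have "((\<lambda>s. UZ E (t' - s) (h s)) has_integral iD (u t')) (time_span t0 t')"
    using assms(1)[unfolded solves_Duhamel_def, rule_format, of t'] assms(3) by simp
  then have "((\<lambda>s. UZ E (t - t') (UZ E (t' - s) (h s))) has_integral UZ E (t - t') (iD (u t'))) (time_span t0 t')"
    using has_integral_linear[OF _ UZ_linear] unfolding o_def by blast
  then have i': "((\<lambda>s. UZ E (t - s) (h s)) has_integral iD (UD E (t - t') (u t'))) (time_span t0 t')"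
    by (simp add: UZ_add[symmetric] UZ_D)
  have "((\<lambda>s. UZ E (t - s) (h s)) has_integral iD (UD E (t - t') (u t'))) (time_span t0 t)"
  proof (rule has_integral_spike_set_eq[THEN iffD1, OF _ _ i'])
    have z: "UZ E (t - s) 0 = 0" for s
    proof -
      interpret Z: bounded_linear "UZ E (t - s)" by (rule UZ_linear)
      show ?thesis by (rule Z.zero)
    qed
    have sub: "time_span t0 t' \<subseteq> time_span t0 t"
      using assms(3,5) t by (auto simp: time_span_def max_def min_def intro: order_trans split: if_splits)
    have "s \<in> S" if "s \<in> time_span t0 t - time_span t0 t'" "UZ E (t - s) (h s) \<noteq> 0" for s
    proof (rule ccontr)
      assume "s \<notin> S"
      moreover have "t' \<le> s"
        using that(1) assms(3,5) t by (auto simp: time_span_def max_def min_def split: if_splits)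
      ultimately have "h s = 0" using S(2)[of s] assms(4) by simp
      then show False using that(2) z by simp
    qed
    then show "negligible {x \<in> time_span t0 t - time_span t0 t'. UZ E (t - x) (h x) \<noteq> 0}"
      by (intro negligible_subset[OF S(1)]) auto
    show "negligible {x \<in> time_span t0 t' - time_span t0 t. UZ E (t - x) (h x) \<noteq> 0}"
      using sub by (auto intro: negligible_subset[OF negligible_empty])
  qed
  moreover have "((\<lambda>s. UZ E (t - s) (h s)) has_integral iD (u t)) (time_span t0 t)"
    using assms(1)[unfolded solves_Duhamel_def, rule_format, of t] t by simp
  ultimately have "iD (UD E (t - t') (u t')) = iD (u t)" by (rule has_integral_unique)
  then show ?thesis by (simp add: iD_eq)
qed

lemma F_in_domain: "u \<in> F \<Longrightarrow> AE s in lebesgue. iD (u s) \<in> phi_domain E"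
proof -
  assume "u \<in> F"
  then have "AE s in lebesgue. iD (u s) \<in> range (emb_1 E)" "AE s in lebesgue. iD (u s) \<in> range (emb_2 E)"
    by (auto simp: F_space_def in_Lq_def)
  then show ?thesis by eventually_elim (auto simp: phi_domain_def)
qed

lemma F_in_domain_list: "set us \<subseteq> F \<Longrightarrow> AE s in lebesgue. set (map (\<lambda>v. iD (v s)) us) \<subseteq> phi_domain E"
proof (induction us)
  case (Cons a us)
  have "AE s in lebesgue. iD (a s) \<in> phi_domain E" using Cons.prems by (intro F_in_domain) auto
  moreover have "AE s in lebesgue. set (map (\<lambda>v. iD (v s)) us) \<subseteq> phi_domain E" using Cons by auto
  ultimately show ?case by eventually_elim auto
qed simp

lemma domain_zero: "0 \<in> phi_domain E"
proof -
  interpret D: bounded_linear iD by (rule lin_D)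
  interpret X: bounded_linear "emb_1 E" by (rule L1.lin)
  interpret Y: bounded_linear "emb_2 E" by (rule L2.lin)
  show ?thesis unfolding phi_domain_def using D.zero X.zero Y.zero by (metis IntI rangeI)
qed

lemma N_j_Duhamel:
  assumes "j \<in> {1..p}" "u \<in> F" "set us \<subseteq> F" "length us = j"
  shows "solves_Duhamel (N_source E j u us) (N_j E j u us)" "N_j E j u us \<in> F"
  using H2 assms unfolding H2_def solves_Duhamel_iff N_j_def by blast+

lemma Phi_j_multilinear:
  "j \<in> {1..p} \<Longrightarrow> \<alpha> \<in> phi_domain E \<Longrightarrow> multilinear_on (phi_domain E) j (Phi_j E j \<alpha>)"
  using power_law by (simp add: power_law_def)

lemma N_j_multilinear:
  assumes "j \<in> {1..p}" "u \<in> F" "set xs \<subseteq> F" "set ys \<subseteq> F" "x \<in> F" "y \<in> F"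
    "length xs + 1 + length ys = j"
  shows "N_j E j u (xs @ (\<lambda>t. a *\<^sub>R x t + b *\<^sub>R y t) # ys) t =
    a *\<^sub>R N_j E j u (xs @ x # ys) t + b *\<^sub>R N_j E j u (xs @ y # ys) t"
proof -
  have xy: "(\<lambda>t. a *\<^sub>R x t + b *\<^sub>R y t) \<in> F"
    using assms by (intro F_add F_scaleR) auto
  have 1: "solves_Duhamel (\<lambda>s. a *\<^sub>R N_source E j u (xs @ x # ys) s + b *\<^sub>R N_source E j u (xs @ y # ys) s)
    (\<lambda>t. a *\<^sub>R N_j E j u (xs @ x # ys) t + b *\<^sub>R N_j E j u (xs @ y # ys) t)"
    by (intro Duhamel_lincomb N_j_Duhamel) (use assms in auto)
  have 2: "solves_Duhamel (N_source E j u (xs @ (\<lambda>t. a *\<^sub>R x t + b *\<^sub>R y t) # ys))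
      (N_j E j u (xs @ (\<lambda>t. a *\<^sub>R x t + b *\<^sub>R y t) # ys))"
    by (intro N_j_Duhamel) (use assms xy in auto)
  have "AE s in lebesgue. N_source E j u (xs @ (\<lambda>t. a *\<^sub>R x t + b *\<^sub>R y t) # ys) s =
      a *\<^sub>R N_source E j u (xs @ x # ys) s + b *\<^sub>R N_source E j u (xs @ y # ys) s"
    using F_in_domain[OF assms(2)] F_in_domain[OF assms(5)] F_in_domain[OF assms(6)]
      F_in_domain_list[OF assms(3)] F_in_domain_list[OF assms(4)]
  proof eventually_elim
    case (elim s)
    interpret D: bounded_linear iD by (rule lin_D)
    show ?case
      using Phi_j_multilinear[OF assms(1) elim(1), unfolded multilinear_on_def, rule_format,
          OF _ elim(2,3), of "map (\<lambda>v. iD (v s)) xs" "map (\<lambda>v. iD (v s)) ys" a b]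
        elim(4,5) assms(7)
      by (simp add: N_source_def D.add D.scaleR)
  qed
  then show ?thesis by (intro Duhamel_local[OF 2 1]) (auto elim: eventually_mono)
qed

lemma Phi_j_zero_slot:
  assumes "j \<in> {1..p}" "\<alpha> \<in> phi_domain E" "length zs = j" "set zs \<subseteq> phi_domain E" "0 \<in> set zs"
  shows "Phi_j E j \<alpha> zs = 0"
proof -
  obtain xs ys where zs: "zs = xs @ 0 # ys" using assms(5) by (meson split_list)
  show ?thesis
    using Phi_j_multilinear[OF assms(1,2), unfolded multilinear_on_def, rule_format,
      of xs ys 0 0 0 0] assms domain_zero by (auto simp: zs)
qed

text \<open>
  A term that vanishes in one slot vanishes altogether, whatever its coefficient. So the coefficient
  may be changed arbitrarily at the times at which one of the arguments is zero.
\<close>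
lemma N_j_local:
  assumes "j \<in> {1..p}" "u \<in> F" "u' \<in> F" "set us \<subseteq> F" "set us' \<subseteq> F" "length us = j" "length us' = j"
    and "\<And>s. s \<in> time_span t0 t \<Longrightarrow> map (\<lambda>v. v s) us = map (\<lambda>v. v s) us' \<and> (u s = u' s \<or> 0 \<in> set (map (\<lambda>v. v s) us))"
  shows "N_j E j u us t = N_j E j u' us' t"
proof -
  have "AE s in lebesgue. s \<in> time_span t0 t \<longrightarrow> N_source E j u us s = N_source E j u' us' s"
    using F_in_domain[OF assms(2)] F_in_domain[OF assms(3)]
      F_in_domain_list[OF assms(4)] F_in_domain_list[OF assms(5)]
  proof eventually_elim
    case (elim s)
    show ?case
    proof
      assume s: "s \<in> time_span t0 t"
      interpret D: bounded_linear iD by (rule lin_D)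
      have e: "map (\<lambda>v. iD (v s)) us = map (\<lambda>v. iD (v s)) us'"
        using arg_cong[OF assms(8)[OF s, THEN conjunct1], of "map iD"] by (simp add: o_def)
      consider "u s = u' s" | "0 \<in> set (map (\<lambda>v. v s) us)" using assms(8)[OF s] by blast
      then show "N_source E j u us s = N_source E j u' us' s"
      proof cases
        case 1 then show ?thesis by (simp add: N_source_def e)
      next
        case 2
        then have "0 \<in> set (map (\<lambda>v. iD (v s)) us)" using D.zero by (force simp: image_iff)
        then show ?thesis
          using Phi_j_zero_slot[OF assms(1) elim(1), of "map (\<lambda>v. iD (v s)) us"]
            Phi_j_zero_slot[OF assms(1) elim(2), of "map (\<lambda>v. iD (v s)) us"] elim(3) assms(6)
          by (simp add: N_source_def e[symmetric])
      qed
    qed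
  qed
  then show ?thesis by (rule Duhamel_local[OF N_j_Duhamel(1)[OF assms(1,2,4,6)] N_j_Duhamel(1)[OF assms(1,3,5,7)]])
qed

text \<open>
  In the expansion of \<open>\<Phi>(0 + b) - \<Phi>(0)\<close> the terms with \<open>j < p\<close> have positive degree in their first
  argument, which is \<open>0\<close>.
\<close>
lemma Phi_top: assumes "b \<in> phi_domain E" shows "Phi E b = Phi_j E p 0 (replicate p b)"
proof -
  have h0: "P 0 = 0" if "homogeneous_poly_on (phi_domain E) d P" "0 < d" for d and P :: "'z \<Rightarrow> 'z"
  proof -
    obtain M where M: "multilinear_on (phi_domain E) d M" "\<And>x. x \<in> phi_domain E \<Longrightarrow> P x = M (replicate d x)"
      using \<open>homogeneous_poly_on (phi_domain E) d P\<close> unfolding homogeneous_poly_on_def by blast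
    have "M ([] @ (0 *\<^sub>R 0 + 0 *\<^sub>R 0) # replicate (d - 1) 0) = 0"
      using M(1)[unfolded multilinear_on_def, rule_format, of "[]" "replicate (d - 1) 0" 0 0 0 0] domain_zero \<open>0 < d\<close>
      by (auto simp: set_replicate_conv_if)
    moreover have "replicate d (0::'z) = 0 # replicate (d - 1) 0" using \<open>0 < d\<close> by (cases d) auto
    ultimately show ?thesis using M(2)[OF domain_zero] by simp
  qed
  have P0: "Phi E 0 = 0" using power_law p_ge_2 by (intro h0[of p]) (auto simp: power_law_def)
  have Pj: "Phi_j E j 0 (replicate j b) = 0" if "j \<in> {1..<p}" for j
    using power_law that assms by (intro h0[of "p - j"]) (auto simp: power_law_def set_replicate_conv_if)
  have "Phi E (0 + b) - Phi E 0 = (\<Sum>j=1..p. Phi_j E j 0 (replicate j b))"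
    using power_law assms domain_zero unfolding power_law_def by blast
  also have "\<dots> = (\<Sum>j\<in>{p}. Phi_j E j 0 (replicate j b))"
    using p_ge_2 Pj by (intro sum.mono_neutral_right) auto
  finally show ?thesis by (simp add: P0)
qed

text \<open>
  This brings \<open>N\<close> under the estimates of \<open>H2\<close>, which concern the operators \<open>N\<^sub>j\<close>.
\<close>
lemma N_as_top_form: assumes "u \<in> F"
  shows "N E u = N_j E p (\<lambda>t. 0) (replicate p u)"
    "solves_Duhamel (\<lambda>s. Phi E (iD (u s))) (N E u)" "N E u \<in> F"
proof -
  interpret D: bounded_linear iD by (rule lin_D)
  have 1: "solves_Duhamel (N_source E p (\<lambda>t. 0) (replicate p u)) (N_j E p (\<lambda>t. 0) (replicate p u))"
    and 2: "N_j E p (\<lambda>t. 0) (replicate p u) \<in> F"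
    using p_ge_2 assms F_zero by (auto intro!: N_j_Duhamel simp: set_replicate_conv_if)
  have "AE s in lebesgue. N_source E p (\<lambda>t. 0) (replicate p u) s = Phi E (iD (u s))"
    using F_in_domain[OF assms]
    by eventually_elim (simp add: N_source_def Phi_top D.zero map_replicate_const)
  from Duhamel_cong_AE[OF 1 this]
  have s: "solves_Duhamel (\<lambda>s. Phi E (iD (u s))) (N_j E p (\<lambda>t. 0) (replicate p u))" .
  then show e: "N E u = N_j E p (\<lambda>t. 0) (replicate p u)"
    by (simp add: solves_Duhamel_iff N_def)
  show "solves_Duhamel (\<lambda>s. Phi E (iD (u s))) (N E u)" "N E u \<in> F"
    unfolding e by (rule s, rule 2)
qed

lemma N_diff:
  assumes "a \<in> F" "b \<in> F"
  shows "N E (\<lambda>t. a t + b t) t = N E a t + (\<Sum>j=1..p. N_j E j a (replicate j b) t)"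
proof -
  interpret D: bounded_linear iD by (rule lin_D)
  have 1: "solves_Duhamel (\<lambda>s. \<Sum>j=1..p. N_source E j a (replicate j b) s) (\<lambda>t. \<Sum>j=1..p. N_j E j a (replicate j b) t)"
    using assms by (intro Duhamel_sum N_j_Duhamel) (auto simp: set_replicate_conv_if)
  have 2: "solves_Duhamel (\<lambda>s. 1 *\<^sub>R Phi E (iD (a s)) + 1 *\<^sub>R (\<Sum>j=1..p. N_source E j a (replicate j b) s))
    (\<lambda>t. 1 *\<^sub>R N E a t + 1 *\<^sub>R (\<Sum>j=1..p. N_j E j a (replicate j b) t))"
    by (intro Duhamel_lincomb 1 N_as_top_form assms)
  have "AE s in lebesgue. Phi E (iD (a s + b s)) =
     1 *\<^sub>R Phi E (iD (a s)) + 1 *\<^sub>R (\<Sum>j=1..p. N_source E j a (replicate j b) s)"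
    using F_in_domain[OF assms(1)] F_in_domain[OF assms(2)]
  proof eventually_elim
    case (elim s)
    have "Phi E (iD (a s) + iD (b s)) - Phi E (iD (a s)) = (\<Sum>j=1..p. Phi_j E j (iD (a s)) (replicate j (iD (b s))))"
      using power_law elim unfolding power_law_def by blast
    then show ?case by (simp add: N_source_def D.add map_replicate_const algebra_simps)
  qed
  then have "N E (\<lambda>t. a t + b t) t = 1 *\<^sub>R N E a t + 1 *\<^sub>R (\<Sum>j=1..p. N_j E j a (replicate j b) t)"
    by (intro Duhamel_local[OF N_as_top_form(2) 2] F_add assms) (auto elim: eventually_mono)
  then show ?thesis by simp
qed

end

section \<open>Size estimates and small slices\<close>

context evolution_problem
begin

text \<open>
  The estimates of \<open>H2\<close> on the whole line, with constants that are uniform on balls of radius \<open>R\<close> in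
  \<open>F\<close>. The first bound is the continuity of a multilinear map. In the others a positive power of an
  \<open>F\<^sub>2\<close> norm is available: that of the coefficient if \<open>j < p\<close>, those of the arguments if \<open>j = p\<close>, and
  their sum for both cases at once on the diagonal, where one full factor \<open>nF v\<close> is kept because
  uniqueness needs a bound that is linear in \<open>v\<close>.
\<close>
definition estimates :: "real \<Rightarrow> real \<Rightarrow> real \<Rightarrow> bool" where
  "estimates \<delta> R K \<longleftrightarrow> 0 \<le> K \<and> (\<forall>j\<in>{1..p}. \<forall>u\<in>F.
     (\<forall>us. nF u \<le> R \<and> set us \<subseteq> F \<and> length us = j \<longrightarrow>
        nF (N_j E j u us) \<le> K * prod_list (map nF us) \<and>
        (j < p \<longrightarrow> nF (N_j E j u us) \<le> K * n2 u powr \<delta> * prod_list (map nF us))) \<and>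
     (\<forall>v\<in>F. nF u \<le> R \<and> nF v \<le> R \<longrightarrow>
        nF (N_j E j u (replicate j v)) \<le> K * (n2 u powr \<delta> + n2 v powr \<delta>) * nF v) \<and>
     (\<forall>us. set us \<subseteq> F \<and> length us = p \<and> (\<forall>v\<in>set us. nF v \<le> R) \<longrightarrow>
        nF (N_j E p u us) \<le> K * (\<Sum>l<p. n2 (us ! l) powr \<delta>)))"

lemma estimatesD:
  assumes "estimates \<delta> R K"
  shows "0 \<le> K"
    "j \<in> {1..p} \<Longrightarrow> u \<in> F \<Longrightarrow> nF u \<le> R \<Longrightarrow> set us \<subseteq> F \<Longrightarrow> length us = j \<Longrightarrow>
       nF (N_j E j u us) \<le> K * prod_list (map nF us)"
    "j \<in> {1..p} \<Longrightarrow> j < p \<Longrightarrow> u \<in> F \<Longrightarrow> nF u \<le> R \<Longrightarrow> set us \<subseteq> F \<Longrightarrow> length us = j \<Longrightarrow>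
       nF (N_j E j u us) \<le> K * n2 u powr \<delta> * prod_list (map nF us)"
    "j \<in> {1..p} \<Longrightarrow> u \<in> F \<Longrightarrow> nF u \<le> R \<Longrightarrow> v \<in> F \<Longrightarrow> nF v \<le> R \<Longrightarrow>
       nF (N_j E j u (replicate j v)) \<le> K * (n2 u powr \<delta> + n2 v powr \<delta>) * nF v"
    "p \<in> {1..p} \<Longrightarrow> u \<in> F \<Longrightarrow> set us \<subseteq> F \<Longrightarrow> length us = p \<Longrightarrow> (\<And>v. v \<in> set us \<Longrightarrow> nF v \<le> R) \<Longrightarrow>
       nF (N_j E p u us) \<le> K * (\<Sum>l<p. n2 (us ! l) powr \<delta>)"
  using assms unfolding estimates_def by blast+

text \<open>
  The exponent is \<open>min d 1\<close> for the exponent \<open>d\<close> of \<open>H2\<close>: with a value of at most \<open>1\<close>, all remaining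
  powers of the full norm are nonnegative and can be bounded by a power of \<open>R + 1\<close>.
\<close>
lemma N_bounds:
  obtains \<delta> where "0 < \<delta>" "\<And>R. 0 \<le> R \<Longrightarrow> \<exists>K. estimates \<delta> R K"
proof -
  have causal: "causal_interval t0 UNIV" by (simp add: causal_interval_def is_interval_univ)
  obtain d C where d: "0 < d" and C: "0 < C" and
    H: "\<forall>u\<in>F. \<forall>us I. set us \<subseteq> F \<and> causal_interval t0 I \<longrightarrow>
        (\<forall>j. 1 \<le> j \<and> j \<le> p - 1 \<and> length us = j \<longrightarrow>
           F_norm E I (N_j E j u us) \<le>
             C * F2_norm E I u powr d * nF u powr (real p - d - real j) *
             (\<Prod>l<j. nF (us ! l))) \<and>
        (length us = p \<longrightarrow>
           F_norm E I (N_j E p u us) \<le>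
             C * (\<Sum>l<p. F2_norm E I (us ! l) powr d * nF (us ! l) powr (1 - d) *
                   (\<Prod>m\<in>{..<p} - {l}. nF (us ! m))))"
    using H2 unfolding H2_def by blast
  have b1: "nF (N_j E j u us) \<le> C * n2 u powr d * nF u powr (real p - d - real j) * prod_list (map nF us)"
    if "1 \<le> j" "j < p" "u \<in> F" "set us \<subseteq> F" "length us = j" for j u us
    using H[rule_format, of u us UNIV] that causal by (auto simp: prod_list_map_nth)
  have b2: "nF (N_j E p u us) \<le> C * (\<Sum>l<p. n2 (us ! l) powr d * nF (us ! l) powr (1 - d) *
                   (\<Prod>m\<in>{..<p} - {l}. nF (us ! m)))"
    if "u \<in> F" "set us \<subseteq> F" "length us = p" for u us
    using H[rule_format, of u us UNIV] that causal by auto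
  define \<delta> where "\<delta> = min d 1"
  have dd: "0 < \<delta>" "\<delta> \<le> d" "\<delta> \<le> 1" using d by (auto simp: \<delta>_def)
  have prodnn: "0 \<le> prod_list (map nF us)" if "set us \<subseteq> F" for us
    using that by (intro prod_list_nonneg_map nF_nonneg) auto
  show ?thesis
  proof (rule that[OF dd(1)])
    fix R :: real assume R: "0 \<le> R"
    define P where "P = (R + 1) powr real p"
    have P1: "1 \<le> P" unfolding P_def using R by (intro ge_one_powr_ge_zero) auto
    have Ple: "(R + 1) powr x \<le> P" if "x \<le> real p" for x
      unfolding P_def using R that by (intro powr_mono) auto
    define K where "K = C * real p * P * P"
    have CK: "C * P \<le> K" "C * real p \<le> K" "C * P * P \<le> K" "C * real p * P * P \<le> K"
    proof -
      have 1: "1 \<le> real p * P" "1 \<le> P * P" "1 \<le> real p"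
        using P1 p_ge_2 mult_mono[of 1 "real p" 1 P] mult_mono[of 1 P 1 P] by auto
      have "C * P * 1 \<le> C * P * (real p * P)" "C * real p * 1 \<le> C * real p * (P * P)"
        "C * P * P * 1 \<le> C * P * P * real p"
        using 1 C P1 by (intro mult_left_mono; simp)+
      then show "C * P \<le> K" "C * real p \<le> K" "C * P * P \<le> K" "C * real p * P * P \<le> K"
        by (auto simp: K_def mult.assoc mult.commute mult.left_commute)
    qed
    have K0: "0 \<le> K" using C P1 by (auto simp: K_def)
    have A: "n2 u powr d * nF u powr (real p - d - real j) \<le> n2 u powr \<delta> * P"
      if "u \<in> F" "nF u \<le> R" "1 \<le> j" "j < p" for u j
    proof -
      have "n2 u powr d * nF u powr (real p - real j - d) \<le> n2 u powr \<delta> * (R + 1) powr (real p - real j - \<delta>)"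
        by (rule powr_interpolate) (use that dd n2_le_nF in auto)
      also have "\<dots> \<le> n2 u powr \<delta> * P"
        using that dd by (intro mult_left_mono Ple) auto
      finally show ?thesis by (simp add: algebra_simps)
    qed
    have n2P: "n2 u powr \<delta> \<le> P" if "u \<in> F" "nF u \<le> R" for u
    proof -
      have "n2 u powr \<delta> \<le> (R + 1) powr \<delta>"
        using that n2_le_nF[of u] dd by (intro powr_mono2) auto
      also have "\<dots> \<le> P" using dd p_ge_2 by (intro Ple) linarith
      finally show ?thesis .
    qed
    have B: "nF (N_j E j u us) \<le> C * P * n2 u powr \<delta> * prod_list (map nF us)"
      if "u \<in> F" "nF u \<le> R" "1 \<le> j" "j < p" "set us \<subseteq> F" "length us = j" for u j us
    proof -
      have "nF (N_j E j u us) \<le> C * (n2 u powr d * nF u powr (real p - d - real j)) * prod_list (map nF us)"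
        using b1[OF that(3,4,1,5,6)] by (simp add: mult.assoc)
      also have "\<dots> \<le> C * (n2 u powr \<delta> * P) * prod_list (map nF us)"
        using A[OF that(1-4)] C prodnn[OF that(5)] by (intro mult_right_mono mult_left_mono) auto
      finally show ?thesis by (simp add: algebra_simps)
    qed
    have B1: "nF (N_j E j u us) \<le> K * prod_list (map nF us)"
      if "u \<in> F" "nF u \<le> R" "j \<in> {1..p}" "set us \<subseteq> F" "length us = j" for u j us
    proof (cases "j < p")
      case True
      have "nF (N_j E j u us) \<le> C * P * n2 u powr \<delta> * prod_list (map nF us)"
        using B that True by auto
      also have "\<dots> \<le> C * P * P * prod_list (map nF us)"
        using C P1 n2P[OF that(1,2)] prodnn[OF that(4)] by (intro mult_right_mono mult_left_mono) auto
      also have "\<dots> \<le> K * prod_list (map nF us)"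
        using CK(3) prodnn[OF that(4)] by (intro mult_right_mono) auto
      finally show ?thesis .
    next
      case False
      then have j: "j = p" using that by auto
      note len = that(5) and usF = that(4)
      have inF: "us ! l \<in> F" if "l < p" for l
        using nth_mem[of l us] that len usF j by auto
      have nn: "0 \<le> nF (us ! l)" if "l < p" for l using inF[OF that] by (rule nF_nonneg)
      have "n2 (us ! l) powr d * nF (us ! l) powr (1 - d) * (\<Prod>m\<in>{..<p} - {l}. nF (us ! m)) \<le> prod_list (map nF us)"
        if l: "l < p" for l
      proof -
        have "n2 (us ! l) powr d * nF (us ! l) powr (1 - d) \<le> nF (us ! l) powr d * nF (us ! l) powr (1 - d)"
          using d n2_le_nF[OF inF[OF l]] by (intro mult_right_mono powr_mono2) auto
        also have "\<dots> \<le> nF (us ! l)"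
          using nn[OF l] by (cases "nF (us ! l) = 0") (auto simp: powr_add[symmetric])
        finally have "n2 (us ! l) powr d * nF (us ! l) powr (1 - d) * (\<Prod>m\<in>{..<p} - {l}. nF (us ! m))
            \<le> nF (us ! l) * (\<Prod>m\<in>{..<p} - {l}. nF (us ! m))"
          using nn by (intro mult_right_mono prod_nonneg) auto
        also have "\<dots> = prod_list (map nF us)"
          using prod.remove[of "{..<p}" l "\<lambda>m. nF (us ! m)"] l j len
          by (simp add: prod_list_map_nth)
        finally show ?thesis .
      qed
      then have "(\<Sum>l<p. n2 (us ! l) powr d * nF (us ! l) powr (1 - d) * (\<Prod>m\<in>{..<p} - {l}. nF (us ! m)))
         \<le> (\<Sum>l<p. prod_list (map nF us))"
        by (intro sum_mono) auto
      then have "nF (N_j E p u us) \<le> C * (\<Sum>l<p. prod_list (map nF us))"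
        using b2[OF that(1,4)] that(5) j C by (auto elim!: order_trans intro!: mult_left_mono)
      also have "\<dots> = C * real p * prod_list (map nF us)" by simp
      also have "\<dots> \<le> K * prod_list (map nF us)"
        using CK(2) prodnn[OF that(4)] by (intro mult_right_mono) auto
      finally show ?thesis using j by simp
    qed
    have nFpow: "nF v ^ n \<le> P" if "v \<in> F" "nF v \<le> R" "n \<le> p" for v n
    proof -
      have "nF v ^ n \<le> (R + 1) ^ n" using that nF_nonneg[of v] by (intro power_mono) auto
      also have "\<dots> = (R + 1) powr real n" using R by (simp add: powr_realpow)
      also have "\<dots> \<le> P" using that by (intro Ple) auto
      finally show ?thesis .
    qed
    have B3: "nF (N_j E j u (replicate j v)) \<le> K * (n2 u powr \<delta> + n2 v powr \<delta>) * nF v"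
      if "u \<in> F" "nF u \<le> R" "j \<in> {1..p}" "v \<in> F" "nF v \<le> R" for u j v
    proof (cases "j < p")
      case True
      have v0: "0 \<le> nF v" using that by (intro nF_nonneg)
      have "nF (N_j E j u (replicate j v)) \<le> C * P * n2 u powr \<delta> * nF v ^ j"
        using B[of u j "replicate j v"] that True by (auto simp: map_replicate prod_list_replicate set_replicate_conv_if)
      also have "nF v ^ j = nF v ^ (j - 1) * nF v" using that by (cases j) auto
      also have "C * P * n2 u powr \<delta> * (nF v ^ (j - 1) * nF v) \<le> C * P * n2 u powr \<delta> * (P * nF v)"
        using C P1 v0 that by (intro mult_left_mono mult_right_mono nFpow) auto
      also have "\<dots> = C * P * P * (n2 u powr \<delta> * nF v)" by (simp add: algebra_simps)
      also have "\<dots> \<le> K * ((n2 u powr \<delta> + n2 v powr \<delta>) * nF v)"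
        using CK(3) C P1 v0 K0 by (intro mult_mono mult_right_mono) auto
      finally show ?thesis by (simp add: mult.assoc)
    next
      case False
      then have j: "j = p" using that by auto
      have v0: "0 \<le> nF v" using that by (intro nF_nonneg)
      have S: "(\<Sum>l<p. n2 (replicate p v ! l) powr d * nF (replicate p v ! l) powr (1 - d) *
          (\<Prod>m\<in>{..<p} - {l}. nF (replicate p v ! m))) = 
          (\<Sum>l<p. n2 v powr d * nF v powr (1 - d) * nF v ^ (p - 1))"
        by (intro sum.cong refl) simp
      have "nF (N_j E j u (replicate j v)) \<le> C * (\<Sum>l<p. n2 v powr d * nF v powr (1 - d) * nF v ^ (p - 1))"
        using b2[of u "replicate p v"] that(1,4) unfolding S j by (auto simp: set_replicate_conv_if)
      also have "\<dots> = C * real p * (n2 v powr d * nF v powr (1 - d) * nF v ^ (p - 1))" by simp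
      also have "\<dots> \<le> C * real p * (n2 v powr \<delta> * P * (P * nF v))"
      proof -
        have "n2 v powr d * nF v powr (1 - d) \<le> n2 v powr \<delta> * (R + 1) powr (1 - \<delta>)"
          using n2_le_nF that dd by (intro powr_interpolate) auto
        also have "\<dots> \<le> n2 v powr \<delta> * P"
          using dd p_ge_2 by (intro mult_left_mono Ple) (auto intro: order_trans)
        finally have X: "n2 v powr d * nF v powr (1 - d) \<le> n2 v powr \<delta> * P" .
        have "nF v ^ (p - 1) = nF v ^ (p - 2) * nF v"
        proof -
          have "p - 1 = Suc (p - 2)" using p_ge_2 by linarith
          then show ?thesis by (simp only: power_Suc2)
        qed
        also have "\<dots> \<le> P * nF v"
          using that v0 by (intro mult_right_mono nFpow) auto
        finally have Y: "nF v ^ (p - 1) \<le> P * nF v" .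
        show ?thesis
          using mult_mono[OF X Y] v0 C P1 by (intro mult_left_mono) auto
      qed
      also have "\<dots> = C * real p * P * P * (n2 v powr \<delta> * nF v)" by (simp add: algebra_simps)
      also have "\<dots> \<le> K * ((n2 u powr \<delta> + n2 v powr \<delta>) * nF v)"
        using K0 v0 by (auto simp: K_def intro!: mult_left_mono mult_right_mono)
      finally show ?thesis by (simp add: mult.assoc)
    qed
    have B2: "nF (N_j E j u us) \<le> K * n2 u powr \<delta> * prod_list (map nF us)"
      if "u \<in> F" "nF u \<le> R" "1 \<le> j" "j < p" "set us \<subseteq> F" "length us = j" for u j us
      using B[OF that] by (rule order_trans)
        (intro mult_right_mono CK(1) prodnn[OF that(5)], simp)
    have B4: "nF (N_j E p u us) \<le> K * (\<Sum>l<p. n2 (us ! l) powr \<delta>)"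
      if "u \<in> F" "set us \<subseteq> F" "length us = p" "\<And>v. v \<in> set us \<Longrightarrow> nF v \<le> R" for u us
    proof -
      have l: "us ! l \<in> F" "nF (us ! l) \<le> R" if "l < p" for l
        using nth_mem[of l us] that \<open>set us \<subseteq> F\<close> \<open>length us = p\<close> \<open>\<And>v. v \<in> set us \<Longrightarrow> nF v \<le> R\<close> by auto
      have "n2 (us ! l) powr d * nF (us ! l) powr (1 - d) * (\<Prod>m\<in>{..<p} - {l}. nF (us ! m))
          \<le> n2 (us ! l) powr \<delta> * P * P" if lp: "l < p" for l
      proof (rule mult_mono)
        have "n2 (us ! l) powr d * nF (us ! l) powr (1 - d) \<le> n2 (us ! l) powr \<delta> * (R + 1) powr (1 - \<delta>)"
          using l[OF lp] dd n2_le_nF by (intro powr_interpolate) auto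
        also have "\<dots> \<le> n2 (us ! l) powr \<delta> * P"
          using dd p_ge_2 by (intro mult_left_mono Ple) (auto intro: order_trans)
        finally show "n2 (us ! l) powr d * nF (us ! l) powr (1 - d) \<le> n2 (us ! l) powr \<delta> * P" .
        have "(\<Prod>m\<in>{..<p} - {l}. nF (us ! m)) \<le> (\<Prod>m\<in>{..<p} - {l}. R + 1)"
        proof (rule prod_mono)
          fix m assume "m \<in> {..<p} - {l}"
          then have "m < p" by simp
          from l[OF this] show "0 \<le> nF (us ! m) \<and> nF (us ! m) \<le> R + 1" using nF_nonneg by auto
        qed
        also have "\<dots> = (R + 1) powr real (p - 1)" using lp R by (subst powr_realpow) simp_all
        also have "\<dots> \<le> P" by (rule Ple) simp
        finally show "(\<Prod>m\<in>{..<p} - {l}. nF (us ! m)) \<le> P" .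
        show "0 \<le> (\<Prod>m\<in>{..<p} - {l}. nF (us ! m))" using l nF_nonneg by (intro prod_nonneg) auto
      qed (use P1 in simp)
      then have "(\<Sum>l<p. n2 (us ! l) powr d * nF (us ! l) powr (1 - d) * (\<Prod>m\<in>{..<p} - {l}. nF (us ! m)))
         \<le> (\<Sum>l<p. n2 (us ! l) powr \<delta> * P * P)"
        by (intro sum_mono) auto
      then have "nF (N_j E p u us) \<le> C * (\<Sum>l<p. n2 (us ! l) powr \<delta> * P * P)"
        using b2[OF that(1-3)] C by (meson mult_left_mono order_less_imp_le order_trans)
      also have "\<dots> = C * P * P * (\<Sum>l<p. n2 (us ! l) powr \<delta>)"
        unfolding sum_distrib_right[symmetric] by (simp only: ac_simps)
      also have "\<dots> \<le> K * (\<Sum>l<p. n2 (us ! l) powr \<delta>)"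
        using CK(3) by (intro mult_right_mono sum_nonneg) auto
      finally show ?thesis .
    qed
    show "\<exists>K. estimates \<delta> R K"
      unfolding estimates_def using B1 B2 B3 B4 K0 by (intro exI[of _ K]) auto
  qed
qed

text \<open>
  A slice is a slab of the clock of width \<open>\<sigma>\<close>. Smallness holds for cutoffs supported in three
  consecutive slices, since a continuous cutoff that equals \<open>1\<close> on one slice reaches into its two
  neighbours.
\<close>
lemma small_slices:
  assumes "a \<in> F" "d \<in> F" "0 < e"
  obtains \<rho> :: "real \<Rightarrow> real" and \<sigma> :: real and n :: nat where
    "continuous_on UNIV \<rho>" "0 < \<sigma>" "\<And>t. 0 \<le> \<rho> t" "\<And>t. \<rho> t < real n * \<sigma>"
    "\<And>s t. s \<in> time_span t0 t \<Longrightarrow> \<rho> s \<le> \<rho> t"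
    "\<And>h c. continuous_on UNIV h \<Longrightarrow> (\<And>t. \<bar>h t\<bar> \<le> 1) \<Longrightarrow>
       (\<And>t. h t \<noteq> 0 \<Longrightarrow> c < \<rho> t \<and> \<rho> t < c + 3 * \<sigma>) \<Longrightarrow>
       n2 (\<lambda>t. h t *\<^sub>R a t) \<le> e \<and> n2 (\<lambda>t. h t *\<^sub>R d t) \<le> e"
proof -
  obtain \<eta> where \<eta>: "0 < \<eta>" "\<And>u h. u \<in> F \<Longrightarrow> continuous_on UNIV h \<Longrightarrow> (\<And>t. \<bar>h t\<bar> \<le> 1) \<Longrightarrow>
     (LINT t:{t. h t \<noteq> 0}|lebesgue. mass u t) \<le> \<eta> \<Longrightarrow> n2 (\<lambda>t. h t *\<^sub>R u t) \<le> e"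
    using cutoff_small[OF assms(3)] by blast
  define g where "g t = mass a t + mass d t" for t
  have g: "integrable lebesgue g" "\<And>t. 0 \<le> g t"
    unfolding g_def using assms mass_integrable mass_nonneg by auto
  obtain \<rho> :: "real \<Rightarrow> real" and \<delta> B :: real where \<rho>: "continuous_on UNIV \<rho>" "0 < \<delta>" "\<And>t. 0 \<le> \<rho> t" "\<And>t. \<rho> t \<le> B"
    "\<And>s t. s \<in> time_span t0 t \<Longrightarrow> \<rho> s \<le> \<rho> t"
    "\<And>a. (LINT t:{t. a < \<rho> t \<and> \<rho> t < a + \<delta>}|lebesgue. g t) \<le> \<eta>"
    by (rule time_slices[OF g \<eta>(1) t0_fin]) blast
  define \<sigma> where "\<sigma> = \<delta> / 3"
  have \<sigma>: "0 < \<sigma>" using \<rho>(2) by (simp add: \<sigma>_def)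
  obtain n where n: "B < real n * \<sigma>" using reals_Archimedean3[OF \<sigma>] by blast
  show ?thesis
  proof (rule that[OF \<rho>(1) \<sigma> \<rho>(3) _ \<rho>(5)])
    show "\<rho> t < real n * \<sigma>" for t using \<rho>(4)[of t] n by linarith
    fix h :: "real \<Rightarrow> real" and c
    assume h: "continuous_on UNIV h" "\<And>t. \<bar>h t\<bar> \<le> 1" "\<And>t. h t \<noteq> 0 \<Longrightarrow> c < \<rho> t \<and> \<rho> t < c + 3 * \<sigma>"
    have "open {t. h t \<noteq> 0}" using open_Collect_neq[OF h(1) continuous_on_const] .
    then have S: "{t. h t \<noteq> 0} \<in> sets lebesgue" by auto
    have "open {t. c < \<rho> t \<and> \<rho> t < c + 3 * \<sigma>}"
      by (intro open_Collect_conj open_Collect_less continuous_on_const \<rho>(1))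
    then have T: "{t. c < \<rho> t \<and> \<rho> t < c + 3 * \<sigma>} \<in> sets lebesgue" by auto
    have "(LINT t:{t. h t \<noteq> 0}|lebesgue. mass u t) \<le> \<eta>"
      if "integrable lebesgue (mass u)" "\<And>t. mass u t \<le> g t" for u
    proof -
      have "(LINT t:{t. h t \<noteq> 0}|lebesgue. mass u t) \<le> (LINT t:{t. c < \<rho> t \<and> \<rho> t < c + 3 * \<sigma>}|lebesgue. g t)"
        unfolding set_lebesgue_integral_def
      proof (intro integral_mono integrable_mult_indicator S T that(1) g(1))
        fix t
        show "indicator {t. h t \<noteq> 0} t *\<^sub>R mass u t \<le> indicator {t. c < \<rho> t \<and> \<rho> t < c + 3 * \<sigma>} t *\<^sub>R g t"
          using h(3)[of t] that(2)[of t] g(2)[of t] by (auto simp: indicator_def)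
      qed
      also have "\<dots> \<le> \<eta>" using \<rho>(6)[of c] by (simp add: \<sigma>_def)
      finally show ?thesis .
    qed
    then show "n2 (\<lambda>t. h t *\<^sub>R a t) \<le> e \<and> n2 (\<lambda>t. h t *\<^sub>R d t) \<le> e"
      using assms mass_integrable mass_nonneg by (intro conjI \<eta>(2) h(1,2)) (auto simp: g_def)
  qed
qed

text \<open>
  Bounded additive maps on \<open>F\<close> commute with absolutely convergent series.
\<close>
lemma bounded_linear_series:
  fixes f :: "(real \<Rightarrow> 'd) \<Rightarrow> 'b::real_normed_vector"
  assumes diff: "\<And>x y. x \<in> F \<Longrightarrow> y \<in> F \<Longrightarrow> f (\<lambda>t. x t - y t) = f x - f y"
    and bound: "\<And>x. x \<in> F \<Longrightarrow> norm (f x) \<le> K * nF x" and "0 \<le> K"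
    and u: "\<And>k. u k \<in> F" and s: "summable (\<lambda>k. nF (u k))"
  shows "(\<lambda>k. f (u k)) sums f (\<lambda>t. \<Sum>k. u k t)"
proof -
  let ?U = "\<lambda>t. \<Sum>k. u k t"
  note U = F_suminf[OF u s]
  have part: "(\<lambda>t. \<Sum>k<n. u k t) \<in> F" for n using F_sum[of "{..<n}" u] u by auto
  have f0: "f (\<lambda>t. 0) = 0" using diff[OF F_zero(1) F_zero(1)] by simp
  have fneg: "f (\<lambda>t. - x t) = - f x" if "x \<in> F" for x using diff[OF F_zero(1) that] f0 by simp
  have fadd: "f (\<lambda>t. x t + y t) = f x + f y" if "x \<in> F" "y \<in> F" for x y
  proof -
    have "(\<lambda>t. - y t) \<in> F" using F_scaleR(1)[OF that(2), of "-1"] by simp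
    from diff[OF that(1) this] fneg[OF that(2)] show ?thesis by simp
  qed
  have fsum: "f (\<lambda>t. \<Sum>k<n. u k t) = (\<Sum>k<n. f (u k))" for n
    by (induction n) (simp_all add: f0 fadd part u)
  have tail: "norm ((\<Sum>k<n. f (u k)) - f ?U) \<le> K * (\<Sum>k. nF (u (k + n)))" for n
  proof -
    have s': "summable (\<lambda>k. nF (u (k + n)))" by (rule summable_ignore_initial_segment[OF s])
    have e: "(\<lambda>t. ?U t - (\<Sum>k<n. u k t)) = (\<lambda>t. \<Sum>k. u (k + n) t)"
      using suminf_minus_initial_segment[OF U(1)] by auto
    have "norm ((\<Sum>k<n. f (u k)) - f ?U) = norm (f (\<lambda>t. ?U t - (\<Sum>k<n. u k t)))"
      by (simp add: diff[OF U(2) part] fsum norm_minus_commute)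
    also have "\<dots> = norm (f (\<lambda>t. \<Sum>k. u (k + n) t))" by (simp only: e)
    also have "\<dots> \<le> K * nF (\<lambda>t. \<Sum>k. u (k + n) t)"
      by (rule bound, rule F_suminf[OF u s'])
    also have "\<dots> \<le> K * (\<Sum>k. nF (u (k + n)))"
      by (intro mult_left_mono F_suminf[OF u s'] assms)
    finally show ?thesis .
  qed
  have z: "(\<lambda>n. K * (\<Sum>k. nF (u (k + n)))) \<longlonglongrightarrow> K * 0"
    by (intro tendsto_mult tendsto_const suminf_exist_split2[OF s])
  have "(\<lambda>n. (\<Sum>k<n. f (u k)) - f ?U) \<longlonglongrightarrow> 0"
    by (rule Lim_null_comparison[OF always_eventually z[unfolded mult_zero_right]]) (rule allI, rule tail)
  then show ?thesis unfolding sums_def by (rule LIM_zero_cancel)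
qed

end

section \<open>The linearized equation and uniqueness\<close>

definition bump :: "real \<Rightarrow> real" where
  "bump x = max 0 (min 1 (min (x + 1) (2 - x)))"

lemma bump: "\<bar>bump x\<bar> \<le> 1" "0 \<le> x \<Longrightarrow> x \<le> 1 \<Longrightarrow> bump x = 1" "bump x \<noteq> 0 \<Longrightarrow> -1 < x \<and> x < 2"
  by (auto simp: bump_def min_def max_def split: if_splits)

lemma bump_continuous [continuous_intros]: "continuous_on S f \<Longrightarrow> continuous_on S (\<lambda>x. bump (f x))"
  unfolding bump_def by (intro continuous_intros)

definition ramp :: "real \<Rightarrow> real \<Rightarrow> real \<Rightarrow> real" where
  "ramp r s x = max 0 (min 1 ((s - x) / (s - r)))"

lemma ramp: assumes "r < s" shows "\<bar>ramp r s x\<bar> \<le> 1" "x \<le> r \<Longrightarrow> ramp r s x = 1" "ramp r s x \<noteq> 0 \<Longrightarrow> x < s"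
  using assms by (auto simp: ramp_def min_def max_def field_simps split: if_splits)

lemma ramp_continuous [continuous_intros]: "r < s \<Longrightarrow> continuous_on S f \<Longrightarrow> continuous_on S (\<lambda>x. ramp r s (f x))"
  unfolding ramp_def by (intro continuous_intros) auto

context evolution_problem
begin

lemma N_1_lincomb:
  assumes "u \<in> F" "x \<in> F" "y \<in> F"
  shows "N_j E 1 u [\<lambda>t. a *\<^sub>R x t + b *\<^sub>R y t] t = a *\<^sub>R N_j E 1 u [x] t + b *\<^sub>R N_j E 1 u [y] t"
  using N_j_multilinear[of 1 u "[]" "[]" x y a b t] assms p_ge_2 by simp

lemma N_1_add:
  assumes "u \<in> F" "x \<in> F" "y \<in> F"
  shows "N_j E 1 u [\<lambda>t. x t + y t] t = N_j E 1 u [x] t + N_j E 1 u [y] t"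
  using N_1_lincomb[of u x y 1 1] assms by simp

lemma N_1_diff:
  assumes "u \<in> F" "x \<in> F" "y \<in> F"
  shows "N_j E 1 u [\<lambda>t. x t - y t] t = N_j E 1 u [x] t - N_j E 1 u [y] t"
  using N_1_lincomb[of u x y 1 "-1"] assms by simp

lemma N_1_in_F: "u \<in> F \<Longrightarrow> x \<in> F \<Longrightarrow> N_j E 1 u [x] \<in> F"
  using p_ge_2 by (intro N_j_Duhamel) auto

text \<open>
  The Neumann series. On a causal set on which \<open>r\<close> vanishes, all its terms vanish by causality.
\<close>
lemma contraction_solve:
  assumes u: "u \<in> F" and half: "\<And>v. v \<in> F \<Longrightarrow> nF (N_j E 1 u [v]) \<le> 1/2 * nF v" and r: "r \<in> F"
  obtains v where "v \<in> F" "\<And>t. v t = r t + N_j E 1 u [v] t" "nF v \<le> 2 * nF r"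
    "\<And>I t. (\<And>t. t \<in> I \<Longrightarrow> time_span t0 t \<subseteq> I \<and> r t = 0) \<Longrightarrow> t \<in> I \<Longrightarrow> v t = 0"
proof -
  define y where "y n = ((\<lambda>v. N_j E 1 u [v]) ^^ n) r" for n
  have y0: "y 0 = r" and yS: "y (Suc n) = N_j E 1 u [y n]" for n by (simp_all add: y_def)
  have yF: "y n \<in> F" for n by (induction n) (simp_all add: y0 yS r N_1_in_F u del: One_nat_def)
  have yn: "nF (y n) \<le> nF r * (1/2) ^ n" for n
  proof (induction n)
    case (Suc n) then show ?case using half[OF yF[of n]] by (simp add: yS)
  qed (simp add: y0)
  have g: "summable (\<lambda>n. nF r * (1/2::real) ^ n)" by (intro summable_mult summable_geometric) simp
  have s: "summable (\<lambda>n. nF (y n))"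
    by (rule summable_comparison_test'[OF g, of 0]) (use yn nF_nonneg[OF yF] in auto)
  define v where "v = (\<lambda>t. \<Sum>n. y n t)"
  note V = F_suminf[OF yF s]
  show ?thesis
  proof (rule that)
    show vF: "v \<in> F" using V(2) by (simp add: v_def)
    have "nF v \<le> (\<Sum>n. nF (y n))" using V(3) by (simp add: v_def)
    also have "\<dots> \<le> (\<Sum>n. nF r * (1/2) ^ n)" by (rule suminf_le[OF yn s g])
    also have "\<dots> = 2 * nF r" by (subst suminf_mult) (simp_all add: summable_geometric suminf_geometric)
    finally show "nF v \<le> 2 * nF r" .
    fix t
    have "(\<lambda>n. N_j E 1 u [y n] t) sums N_j E 1 u [\<lambda>t. \<Sum>n. y n t] t"
    proof (rule bounded_linear_series[where K="1/2"])
      show "norm (N_j E 1 u [x] t) \<le> 1/2 * nF x" if "x \<in> F" for x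
        using norm_le_nF[OF N_1_in_F[OF u that], of t] half[OF that] by linarith
    qed (use N_1_diff u yF s in auto)
    then have "(\<lambda>n. y (Suc n) t) sums N_j E 1 u [v] t" by (simp add: yS v_def)
    then have "(\<lambda>n. y n t) sums (N_j E 1 u [v] t + y 0 t)" by (subst (asm) sums_Suc_iff) (simp add: algebra_simps)
    then show "v t = r t + N_j E 1 u [v] t" by (simp add: v_def y0 sums_unique[symmetric] add.commute)
  next
    fix I t assume I: "\<And>t. t \<in> I \<Longrightarrow> time_span t0 t \<subseteq> I \<and> r t = 0" and t: "t \<in> I"
    have "\<forall>t\<in>I. y n t = 0" for n
    proof (induction n)
      case (Suc n)
      show ?case
      proof
        fix t assume t: "t \<in> I"
        have "N_j E 1 u [y n] t = N_j E 1 u [\<lambda>t. 0] t"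
          by (rule N_j_local) (use p_ge_2 u yF F_zero Suc I[OF t] in auto)
        also have "\<dots> = 0" using N_1_lincomb[of u r r 0 0 t] u r by simp
        finally show "y (Suc n) t = 0" by (simp add: yS)
      qed
    qed (use I in \<open>auto simp: y0\<close>)
    then show "v t = 0" using t by (simp add: v_def)
  qed
qed

lemma small_constant:
  assumes "0 \<le> (K::real)" "0 < \<delta>" "0 < c"
  obtains e where "0 < e" "K * e powr \<delta> \<le> c"
proof (rule that)
  let ?e = "(c / (K + 1)) powr (1 / \<delta>)"
  show "0 < ?e" using assms by simp
  have "K * ?e powr \<delta> = K * c / (K + 1)" using assms by (simp add: powr_powr)
  also have "\<dots> \<le> c" using assms by (simp add: field_simps)
  finally show "K * ?e powr \<delta> \<le> c" .
qed

text \<open>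
  Induction on the number \<open>k\<close> of slices on which the equation holds. A solution \<open>w\<close> on the first \<open>k\<close>
  slices is corrected by the solution \<open>v\<close> of the same equation with the residual \<open>r\<close> of \<open>w\<close> as source
  and with the coefficient cut off around the next slice, which makes the equation contractive.
  Since \<open>v\<close> vanishes on the first \<open>k\<close> slices, the cutoff is invisible up to the end of the next slice.
  The number of slices depends on \<open>u\<close> alone, hence so does the bound.
\<close>
lemma linear_solvable:
  assumes u: "u \<in> F"
  obtains \<Lambda> where "0 \<le> \<Lambda>"
    "\<And>h. h \<in> F \<Longrightarrow> \<exists>w\<in>F. (\<forall>t. w t = h t + N_j E 1 u [w] t) \<and> nF w \<le> \<Lambda> * nF h"
proof -
  obtain \<delta> where \<delta>: "0 < \<delta>" and NB: "\<And>R. 0 \<le> R \<Longrightarrow> \<exists>K. estimates \<delta> R K" by (rule N_bounds) blast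
  obtain K where est: "estimates \<delta> (nF u) K" using NB[OF nF_nonneg[OF u]] by blast
  note K = estimatesD(1)[OF est]
  have KB: "nF (N_j E 1 u' [v]) \<le> K * nF v \<and> nF (N_j E 1 u' [v]) \<le> K * n2 u' powr \<delta> * nF v"
    if "u' \<in> F" "nF u' \<le> nF u" "v \<in> F" for u' v
    using estimatesD(2,3)[OF est, of 1 u' "[v]"] p_ge_2 that by simp
  obtain e where e: "0 < e" "K * e powr \<delta> \<le> 1/2" by (rule small_constant[OF K \<delta>, of "1/2"]) auto
  obtain \<rho> :: "real \<Rightarrow> real" and \<sigma> :: real and n :: nat where
    \<rho>: "continuous_on UNIV \<rho>" "0 < \<sigma>" "\<And>t. 0 \<le> \<rho> t" "\<And>t. \<rho> t < real n * \<sigma>"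
    "\<And>s t. s \<in> time_span t0 t \<Longrightarrow> \<rho> s \<le> \<rho> t" and
    sl: "\<And>h c. continuous_on UNIV h \<Longrightarrow> (\<And>t. \<bar>h t\<bar> \<le> 1) \<Longrightarrow>
       (\<And>t. h t \<noteq> 0 \<Longrightarrow> c < \<rho> t \<and> \<rho> t < c + 3 * \<sigma>) \<Longrightarrow>
       n2 (\<lambda>t. h t *\<^sub>R u t) \<le> e \<and> n2 (\<lambda>t. h t *\<^sub>R u t) \<le> e"
    by (rule small_slices[OF u u e(1)]) blast
  \<comment> \<open>For \<open>k = 0\<close> there is nothing to solve, because \<open>\<rho>\<close> is nonnegative.\<close>
  have "\<exists>\<Lambda>\<ge>0. \<forall>h\<in>F. \<exists>w\<in>F. (\<forall>t. \<rho> t < real k * \<sigma> \<longrightarrow> w t = h t + N_j E 1 u [w] t) \<and> nF w \<le> \<Lambda> * nF h" for k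
  proof (induction k)
    case 0
    show ?case
      using F_zero \<rho>(3) by (intro exI[of _ 0] conjI ballI bexI[of _ "\<lambda>t. 0"]) (auto simp: not_less[symmetric])
  next
    case (Suc k)
    then obtain \<Lambda> where \<Lambda>: "0 \<le> \<Lambda>" and IH: "\<And>h. h \<in> F \<Longrightarrow> \<exists>w\<in>F. (\<forall>t. \<rho> t < real k * \<sigma> \<longrightarrow> w t = h t + N_j E 1 u [w] t) \<and> nF w \<le> \<Lambda> * nF h"
      by blast
    \<comment> \<open>\<open>1\<close> on the slice with number \<open>k\<close> and zero outside of its neighbours\<close>
    define \<theta> where "\<theta> t = bump (\<rho> t / \<sigma> - real k)" for t
    define u' where "u' = (\<lambda>t. \<theta> t *\<^sub>R u t)"
    have \<theta>: "continuous_on UNIV \<theta>" "\<bar>\<theta> t\<bar> \<le> 1" for t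
      unfolding \<theta>_def using \<rho>(1,2) by (auto intro!: continuous_intros bump)
    have u'F: "u' \<in> F" and u'n: "nF u' \<le> nF u"
      using F_multiplier[OF u \<theta>] by (simp_all add: u'_def)
    have "\<theta> t \<noteq> 0 \<Longrightarrow> (real k - 1) * \<sigma> < \<rho> t \<and> \<rho> t < (real k - 1) * \<sigma> + 3 * \<sigma>" for t
      using bump(3)[of "\<rho> t / \<sigma> - real k"] \<rho>(2) by (auto simp: \<theta>_def field_simps)
    from sl[OF \<theta> this] have n2e: "n2 u' \<le> e" by (simp add: u'_def)
    have half: "nF (N_j E 1 u' [v]) \<le> 1/2 * nF v" if "v \<in> F" for v
    proof -
      have "nF (N_j E 1 u' [v]) \<le> K * n2 u' powr \<delta> * nF v" using KB[OF u'F u'n that] by simp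
      also have "\<dots> \<le> K * e powr \<delta> * nF v"
        using K n2e \<delta> nF_nonneg[OF that] by (intro mult_right_mono mult_left_mono powr_mono2) auto
      also have "\<dots> \<le> 1/2 * nF v" using e(2) nF_nonneg[OF that] by (intro mult_right_mono) auto
      finally show ?thesis .
    qed
    show ?case
    proof (intro exI conjI ballI)
      show "0 \<le> \<Lambda> + 2 * (1 + (1 + K) * \<Lambda>)" using \<Lambda> K by auto
      fix h assume h: "h \<in> F"
      obtain w where w: "w \<in> F" "\<And>t. \<rho> t < real k * \<sigma> \<Longrightarrow> w t = h t + N_j E 1 u [w] t" "nF w \<le> \<Lambda> * nF h"
        using IH[OF h] by blast
      define r where "r = (\<lambda>t. h t + N_j E 1 u [w] t - w t)"
      have Nw: "N_j E 1 u [w] \<in> F" by (rule N_1_in_F[OF u w(1)])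
      have rF: "r \<in> F" unfolding r_def by (intro F_diff F_add h Nw w)
      have "nF r \<le> (nF h + nF (N_j E 1 u [w])) + nF w"
        unfolding r_def using F_diff(2)[OF F_add(1)[OF h Nw] w(1)] F_add(2)[OF h Nw] by linarith
      also have "\<dots> \<le> nF h + (1 + K) * nF w"
        using KB[OF u order_refl w(1)] by (simp add: algebra_simps)
      also have "\<dots> \<le> nF h + (1 + K) * (\<Lambda> * nF h)"
        using K w(3) by (intro add_left_mono mult_left_mono) auto
      finally have rn: "nF r \<le> (1 + (1 + K) * \<Lambda>) * nF h" by (simp add: algebra_simps)
      obtain v where v: "v \<in> F" "\<And>t. v t = r t + N_j E 1 u' [v] t" "nF v \<le> 2 * nF r"
        and vI: "\<And>I t. (\<And>t. t \<in> I \<Longrightarrow> time_span t0 t \<subseteq> I \<and> r t = 0) \<Longrightarrow> t \<in> I \<Longrightarrow> v t = 0"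
        using contraction_solve[OF u'F half rF] by metis
      have v0: "v t = 0" if "\<rho> t < real k * \<sigma>" for t
      proof (rule vI[of "{t. \<rho> t < real k * \<sigma>}"])
        show "time_span t0 s \<subseteq> {t. \<rho> t < real k * \<sigma>} \<and> r s = 0" if "s \<in> {t. \<rho> t < real k * \<sigma>}" for s
          using that \<rho>(5) w(2)[of s] by (force simp: r_def)
      qed (use that in auto)
      have loc: "N_j E 1 u' [v] t = N_j E 1 u [v] t" if "\<rho> t < real (Suc k) * \<sigma>" for t
      proof (rule N_j_local)
        fix s assume s: "s \<in> time_span t0 t"
        have "\<rho> s < real (Suc k) * \<sigma>" using \<rho>(5)[OF s] that by simp
        then have "\<theta> s = 1" if "\<not> \<rho> s < real k * \<sigma>"
          unfolding \<theta>_def using that \<rho>(2) by (intro bump(2)) (auto simp: field_simps)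
        then show "map (\<lambda>v. v s) [v] = map (\<lambda>v. v s) [v] \<and> (u' s = u s \<or> 0 \<in> set (map (\<lambda>v. v s) [v]))"
          using v0[of s] by (cases "\<rho> s < real k * \<sigma>") (auto simp: u'_def)
      qed (use u'F u v(1) p_ge_2 in auto)
      show "\<exists>w\<in>F. (\<forall>t. \<rho> t < real (Suc k) * \<sigma> \<longrightarrow> w t = h t + N_j E 1 u [w] t) \<and> nF w \<le> (\<Lambda> + 2 * (1 + (1 + K) * \<Lambda>)) * nF h"
      proof (intro bexI conjI allI impI)
        show "(\<lambda>t. w t + v t) \<in> F" using w v by (intro F_add)
        show "w t + v t = h t + N_j E 1 u [\<lambda>t. w t + v t] t" if "\<rho> t < real (Suc k) * \<sigma>" for t
          using v(2)[of t] loc[OF that] N_1_add[OF u w(1) v(1), of t] by (simp add: r_def)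
        have "nF (\<lambda>t. w t + v t) \<le> \<Lambda> * nF h + 2 * ((1 + (1 + K) * \<Lambda>) * nF h)"
          using F_add(2)[OF w(1) v(1)] w(3) v(3) rn by linarith
        then show "nF (\<lambda>t. w t + v t) \<le> (\<Lambda> + 2 * (1 + (1 + K) * \<Lambda>)) * nF h"
          by (simp add: algebra_simps)
      qed
    qed
  qed
  from this[of n] show ?thesis using \<rho>(4) that by auto
qed

text \<open>
  Suppose that \<open>d\<close> vanishes on the first \<open>k\<close> slices, and let \<open>cut r s\<close> denote the product of \<open>d\<close> with a
  cutoff that falls from \<open>1\<close> to \<open>0\<close> between the clock times \<open>r < s\<close> of the next slice. By causality
  \<open>cut r s\<close> is the product of the same cutoff with the right-hand side formed from \<open>cut s s'\<close> for any
  \<open>s' > s\<close> in the slice and from \<open>a\<close> cut off around the slice. The \<open>F\<^sub>2\<close> norms are small on the slice, so the norm of \<open>cut r s\<close> is at most half that of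
  \<open>cut s s'\<close>. As there is room for arbitrarily many steps \<open>s < s' < s'' < \<dots>\<close> inside the slice, the norm
  of \<open>cut r s\<close> is zero. The set \<open>J\<close> covers the linearized and the full equation.
\<close>
lemma difference_vanishes:
  assumes a: "a \<in> F" and d: "d \<in> F" and J: "J \<subseteq> {1..p}"
    and eq: "\<And>t. d t = (\<Sum>j\<in>J. N_j E j a (replicate j d) t)"
  shows "d t = 0"
proof -
  define R where "R = max (nF a) (nF d)"
  have R: "0 \<le> R" "nF a \<le> R" "nF d \<le> R" using nF_nonneg[OF a] by (auto simp: R_def)
  obtain \<delta> where \<delta>: "0 < \<delta>" and NB: "\<And>R. 0 \<le> R \<Longrightarrow> \<exists>K. estimates \<delta> R K" by (rule N_bounds) blast
  obtain K where est: "estimates \<delta> R K" using NB[OF R(1)] by blast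
  note K = estimatesD(1)[OF est] and KB = estimatesD(4)[OF est]
  obtain e where e: "0 < e" "(2 * real (card J) * K) * e powr \<delta> \<le> 1/2"
    by (rule small_constant[of "2 * real (card J) * K" \<delta> "1/2"]) (use K \<delta> in auto)
  obtain \<rho> :: "real \<Rightarrow> real" and \<sigma> :: real and n :: nat where
    \<rho>: "continuous_on UNIV \<rho>" "0 < \<sigma>" "\<And>t. 0 \<le> \<rho> t" "\<And>t. \<rho> t < real n * \<sigma>"
    "\<And>s t. s \<in> time_span t0 t \<Longrightarrow> \<rho> s \<le> \<rho> t" and
    sl: "\<And>h c. continuous_on UNIV h \<Longrightarrow> (\<And>t. \<bar>h t\<bar> \<le> 1) \<Longrightarrow>
       (\<And>t. h t \<noteq> 0 \<Longrightarrow> c < \<rho> t \<and> \<rho> t < c + 3 * \<sigma>) \<Longrightarrow>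
       n2 (\<lambda>t. h t *\<^sub>R a t) \<le> e \<and> n2 (\<lambda>t. h t *\<^sub>R d t) \<le> e"
    by (rule small_slices[OF a d e(1)]) blast
  define cut where "cut r s t = ramp r s (\<rho> t) *\<^sub>R d t" for r s t
  have rc: "continuous_on UNIV (\<lambda>t. ramp r s (\<rho> t))" if "r < s" for r s
    using that \<rho>(1) by (intro continuous_intros)
  have cutF: "cut r s \<in> F" "nF (cut r s) \<le> nF d" if "r < s" for r s
    using F_multiplier[OF d rc[OF that], of 1] ramp(1)[OF that] by (simp_all add: cut_def[abs_def])
  have "\<forall>t. \<rho> t < real k * \<sigma> \<longrightarrow> d t = 0" for k
  proof (induction k)
    case 0 then show ?case using \<rho>(3) by (auto simp: not_less[symmetric])
  next
    case (Suc k)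
    then have d0: "d t = 0" if "\<rho> t < real k * \<sigma>" for t using that by blast
    let ?top = "real (Suc k) * \<sigma>"
    \<comment> \<open>\<open>1\<close> on the slice with number \<open>k\<close> and zero outside of its neighbours\<close>
    define \<theta> where "\<theta> t = bump (\<rho> t / \<sigma> - real k)" for t
    define a' where "a' = (\<lambda>t. \<theta> t *\<^sub>R a t)"
    have \<theta>: "continuous_on UNIV \<theta>" "\<bar>\<theta> t\<bar> \<le> 1" for t
      unfolding \<theta>_def using \<rho>(1,2) by (auto intro!: continuous_intros bump)
    have \<theta>1: "\<theta> t = 1" if "\<not> \<rho> t < real k * \<sigma>" "\<rho> t \<le> ?top" for t
      unfolding \<theta>_def using that \<rho>(2) by (intro bump(2)) (auto simp: field_simps)
    have a'F: "a' \<in> F" and a'n: "nF a' \<le> nF a"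
      using F_multiplier[OF a \<theta>] by (simp_all add: a'_def)
    have \<theta>s: "\<theta> t \<noteq> 0 \<Longrightarrow> (real k - 1) * \<sigma> < \<rho> t \<and> \<rho> t < (real k - 1) * \<sigma> + 3 * \<sigma>" for t
      using bump(3)[of "\<rho> t / \<sigma> - real k"] \<rho>(2) by (auto simp: \<theta>_def field_simps)
    from sl[OF \<theta> this] have n2a: "n2 a' \<le> e" by (simp add: a'_def)
    have n2d: "n2 (cut r s) \<le> e" if "r < s" "s \<le> ?top" for r s
    proof -
      have "cut r s = (\<lambda>t. (ramp r s (\<rho> t) * \<theta> t) *\<^sub>R d t)"
        using d0 \<theta>1 ramp(3)[OF that(1)] that(2) by (fastforce simp: cut_def fun_eq_iff)
      moreover have "n2 (\<lambda>t. (ramp r s (\<rho> t) * \<theta> t) *\<^sub>R d t) \<le> e"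
      proof (rule sl[THEN conjunct2])
        show "continuous_on UNIV (\<lambda>t. ramp r s (\<rho> t) * \<theta> t)"
          by (intro continuous_on_mult rc that \<theta>)
        show "\<bar>ramp r s (\<rho> t) * \<theta> t\<bar> \<le> 1" for t
          using ramp(1)[OF that(1)] \<theta>(2) by (simp add: abs_mult mult_le_one)
      qed (use \<theta>s in auto)
      ultimately show ?thesis by simp
    qed
    have half: "nF (cut r s) \<le> 1/2 * nF (cut s s')" if "r < s" "s < s'" "s' \<le> ?top" for r s s'
    proof -
      define G where "G t = (\<Sum>j\<in>J. N_j E j a' (replicate j (cut s s')) t)" for t
      have finJ: "finite J" using J finite_subset by blast
      have NF: "N_j E j a' (replicate j (cut s s')) \<in> F" if "j \<in> J" for j
        using that J a'F cutF(1)[OF \<open>s < s'\<close>] by (intro N_j_Duhamel) (auto simp: set_replicate_conv_if)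
      have GF: "G \<in> F" "nF G \<le> (\<Sum>j\<in>J. nF (N_j E j a' (replicate j (cut s s'))))"
        using F_sum[OF finJ NF] by (simp_all add: G_def[abs_def])
      have "cut r s = (\<lambda>t. ramp r s (\<rho> t) *\<^sub>R G t)"
      proof
        fix t
        show "cut r s t = ramp r s (\<rho> t) *\<^sub>R G t"
        proof (cases "ramp r s (\<rho> t) = 0")
          case False
          then have t: "\<rho> t < s" using ramp(3)[OF that(1)] by blast
          have "N_j E j a (replicate j d) t = N_j E j a' (replicate j (cut s s')) t" if "j \<in> J" for j
          proof (rule N_j_local)
            fix x assume "x \<in> time_span t0 t"
            then have x: "\<rho> x \<le> s" using \<rho>(5) t by fastforce
            then have "cut s s' x = d x" using ramp(2)[OF \<open>s < s'\<close>] by (simp add: cut_def)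
            moreover have "a x = a' x \<or> d x = 0"
              using d0[of x] \<theta>1[of x] x \<open>s < s'\<close> \<open>s' \<le> ?top\<close>
          by (cases "\<rho> x < real k * \<sigma>") (auto simp: a'_def)
            moreover have "j \<noteq> 0" using \<open>j \<in> J\<close> J by auto
            ultimately show "map (\<lambda>v. v x) (replicate j d) = map (\<lambda>v. v x) (replicate j (cut s s')) \<and>
               (a x = a' x \<or> 0 \<in> set (map (\<lambda>v. v x) (replicate j d)))"
              by auto
          qed (use \<open>j \<in> J\<close> J a a'F d cutF(1)[OF \<open>s < s'\<close>] in \<open>auto simp: set_replicate_conv_if\<close>)
          then show ?thesis unfolding cut_def G_def using eq[of t] by simp
        qed (simp add: cut_def)
      qed
      then have "nF (cut r s) \<le> nF G"
        using F_multiplier(2)[OF GF(1) rc[OF that(1)] ramp(1)[OF that(1)]] by simp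
      also have "\<dots> \<le> (\<Sum>j\<in>J. K * (e powr \<delta> + e powr \<delta>) * nF (cut s s'))"
      proof (rule order_trans[OF GF(2)], rule sum_mono)
        fix j assume j: "j \<in> J"
        have "nF (N_j E j a' (replicate j (cut s s'))) \<le> K * (n2 a' powr \<delta> + n2 (cut s s') powr \<delta>) * nF (cut s s')"
          using j J R a'F a'n cutF[OF that(2)] by (intro KB) auto
        also have "\<dots> \<le> K * (e powr \<delta> + e powr \<delta>) * nF (cut s s')"
          using K \<delta> n2a n2d[OF that(2,3)] nF_nonneg[OF cutF(1)[OF that(2)]]
          by (intro mult_right_mono mult_left_mono add_mono powr_mono2) auto
        finally show "nF (N_j E j a' (replicate j (cut s s'))) \<le> K * (e powr \<delta> + e powr \<delta>) * nF (cut s s')" .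
      qed
      also have "\<dots> = (2 * real (card J) * K) * e powr \<delta> * nF (cut s s')" by (simp add: algebra_simps)
      also have "\<dots> \<le> 1/2 * nF (cut s s')"
        using e(2) nF_nonneg[OF cutF(1)[OF that(2)]] by (intro mult_right_mono) auto
      finally show ?thesis .
    qed
    have pow: "nF (cut r s) \<le> (1/2) ^ m * nF d" if "r < s" "s < ?top" for r s m
      using that
    proof (induction m arbitrary: r s)
      case 0 then show ?case using cutF(2) by simp
    next
      case (Suc m)
      obtain s' where s': "s < s'" "s' < ?top" using dense[OF Suc.prems(2)] by blast
      have "nF (cut r s) \<le> 1/2 * nF (cut s s')" by (rule half[OF Suc.prems(1) s'(1) less_imp_le[OF s'(2)]])
      also have "\<dots> \<le> 1/2 * ((1/2) ^ m * nF d)" using Suc.IH[OF s'] by simp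
      finally show ?case by simp
    qed
    show ?case
    proof (intro allI impI)
      fix t assume t: "\<rho> t < ?top"
      obtain s where s: "\<rho> t < s" "s < ?top" using dense[OF t] by blast
      have "norm (d t) \<le> (1/2) ^ m * nF d" for m
      proof -
        have "d t = cut (\<rho> t) s t" using ramp(2)[OF s(1)] by (simp add: cut_def)
        then have "norm (d t) \<le> nF (cut (\<rho> t) s)" using norm_le_nF[OF cutF(1)[OF s(1)]] by metis
        then show ?thesis using pow[OF s, of m] by linarith
      qed
      moreover have "(\<lambda>m. (1/2) ^ m * nF d) \<longlonglongrightarrow> 0 * nF d"
        by (intro tendsto_mult tendsto_const LIMSEQ_realpow_zero) auto
      ultimately have "norm (d t) \<le> 0" by (intro LIMSEQ_le_const[of _ 0]) auto
      then show "d t = 0" by simp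
    qed
  qed
  then show ?thesis using \<rho>(4) by blast
qed

lemma linear_unique:
  assumes "u \<in> F" "w \<in> F" "w' \<in> F" "\<And>t. w t = h t + N_j E 1 u [w] t" "\<And>t. w' t = h t + N_j E 1 u [w'] t"
  shows "w = w'"
proof
  fix t
  have "w t - w' t = 0"
  proof (rule difference_vanishes[of u "\<lambda>t. w t - w' t" "{1}"])
    show "w t - w' t = (\<Sum>j\<in>{1}. N_j E j u (replicate j (\<lambda>t. w t - w' t)) t)" for t
      using assms(4,5)[of t] N_1_diff[OF assms(1-3), of t] by simp
  qed (use assms(1) p_ge_2 F_diff(1)[OF assms(2,3)] in auto)
  then show "w t = w' t" by simp
qed

lemma solution_unique:
  assumes "solves E g u" "solves E g v" shows "u = v"
proof
  fix t
  have F: "u \<in> F" "v \<in> F" using assms by (auto simp: solves_def)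
  let ?d = "\<lambda>t. v t - u t"
  have "?d t = 0"
  proof (rule difference_vanishes[of u ?d "{1..p}"])
    show "?d t = (\<Sum>j\<in>{1..p}. N_j E j u (replicate j ?d) t)" for t
    proof -
      have "u t = UD E t g + N E u t" "v t = UD E t g + N E v t"
        using assms unfolding solves_def by blast+
      then have "v t - u t = N E v t - N E u t" by (simp only: add_diff_cancel_left)
      also have "\<dots> = N E (\<lambda>t. u t + ?d t) t - N E u t" by simp
      also have "\<dots> = (\<Sum>j\<in>{1..p}. N_j E j u (replicate j ?d) t)"
        unfolding N_diff[OF F(1) F_diff(1)[OF F(2,1)], of t] by simp
      finally show ?thesis .
    qed
  qed (use F in \<open>auto intro: F_diff\<close>)
  then show "u t = v t" by simp
qed

end

section \<open>The correctors as multilinear maps of the datum\<close>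

text \<open>
  The arguments of an \<open>(m + 1)\<close>-linear map are distributed over maps with \<open>l\<^sub>1 + 1, l\<^sub>2 + 1, \<dots>\<close>
  arguments.
\<close>
primrec chunks :: "nat list \<Rightarrow> 'a list \<Rightarrow> 'a list list" where
  "chunks [] gs = []"
| "chunks (l # ls) gs = take (Suc l) gs # chunks ls (drop (Suc l) gs)"

lemma length_chunks [simp]: "length (chunks ls gs) = length ls"
  by (induction ls arbitrary: gs) auto

lemma chunks_replicate:
  "n = sum_list (map Suc ls) \<Longrightarrow> chunks ls (replicate n g) = map (\<lambda>l. replicate (Suc l) g) ls"
proof (induction ls arbitrary: n)
  case (Cons l ls) then show ?case by (simp add: take_replicate drop_replicate del: replicate.simps take_Suc_Cons)
qed simp

text \<open>
  The index set of the recursion for the correctors. The total number \<open>j + sum_list ls\<close> of arguments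
  of the inner maps is \<open>m + 1\<close>.
\<close>
definition compositions :: "nat \<Rightarrow> nat \<Rightarrow> nat list set" where
  "compositions j m = {ls. length ls = j \<and> j + sum_list ls = m + 1}"

definition lists_upto :: "nat \<Rightarrow> nat \<Rightarrow> nat list set" where
  "lists_upto j n = {ls. length ls = j \<and> set ls \<subseteq> {..n}}"

lemma finite_lists_upto [simp]: "finite (lists_upto j n)"
  using finite_lists_length_eq[of "{..n}" j] by (simp add: lists_upto_def conj_commute)

lemma compositions_subset: "1 \<le> j \<Longrightarrow> m \<le> n \<Longrightarrow> compositions j m \<subseteq> lists_upto j n"
  using member_le_sum_list by (fastforce simp: compositions_def lists_upto_def)

lemma finite_compositions [simp]: "finite (compositions j m)"
proof (cases "j = 0")
  case True then show ?thesis by (simp add: compositions_def)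
next
  case False
  then show ?thesis using compositions_subset[of j m m] finite_subset[OF _ finite_lists_upto] by auto
qed

lemma compositions_less: "2 \<le> j \<Longrightarrow> ls \<in> compositions j m \<Longrightarrow> l \<in> set ls \<Longrightarrow> l < m"
  using member_le_sum_list[of l ls] by (auto simp: compositions_def)

lemma compositions_one: "compositions 1 m = {[m]}"
  by (auto simp: compositions_def length_Suc_conv)

lemma compositions_zero: "2 \<le> j \<Longrightarrow> compositions j 0 = {}"
  by (auto simp: compositions_def)

lemma lists_upto_Suc: "lists_upto (Suc j) n = (\<lambda>(l, ls). l # ls) ` ({..n} \<times> lists_upto j n)"
  by (auto simp: lists_upto_def length_Suc_conv image_iff)

lemma sum_lists_upto_Suc:
  fixes f :: "nat list \<Rightarrow> 'b::comm_monoid_add"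
  shows "sum f (lists_upto (Suc j) n) = (\<Sum>l\<le>n. \<Sum>ls\<in>lists_upto j n. f (l # ls))"
proof -
  have "sum f (lists_upto (Suc j) n) = sum (f \<circ> (\<lambda>(l, ls). l # ls)) ({..n} \<times> lists_upto j n)"
    unfolding lists_upto_Suc by (rule sum.reindex) (auto simp: inj_on_def)
  then show ?thesis by (simp add: sum.cartesian_product split_def)
qed

lemma lists_upto_0: "lists_upto 0 n = {[]}"
  by (auto simp: lists_upto_def)

text \<open>
  The distributive law for the \<open>j\<close>-th power of a sum.
\<close>
lemma sum_prod_lists:
  fixes f :: "nat \<Rightarrow> real"
  shows "(\<Sum>ls\<in>lists_upto j n. prod_list (map f ls)) = (\<Sum>k\<le>n. f k) ^ j"
  by (induction j) (simp_all add: lists_upto_0 sum_lists_upto_Suc sum_distrib_left[symmetric] sum_distrib_right[symmetric])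

locale linearization = evolution_problem E
  for E :: "('d::banach, 'x::banach, 'y::banach, 'z::banach) evolution" +
  fixes ubar :: "real \<Rightarrow> 'd"
  assumes ubar: "ubar \<in> F_space E"
begin

text \<open>
  The inverse of \<open>w \<mapsto> w - N\<^sub>1(ubar, w)\<close> on \<open>F\<close>.
\<close>
definition resolvent :: "(real \<Rightarrow> 'd) \<Rightarrow> real \<Rightarrow> 'd" where
  "resolvent h = (THE w. w \<in> F \<and> (\<forall>t. w t = h t + N_j E 1 ubar [w] t))"

lemma resolvent_unique: "w \<in> F \<Longrightarrow> (\<And>t. w t = h t + N_j E 1 ubar [w] t) \<Longrightarrow> resolvent h = w"
  unfolding resolvent_def by (rule the_equality) (use linear_unique[OF ubar] in \<open>auto\<close>)

lemma resolvent_ex: "h \<in> F \<Longrightarrow> \<exists>w\<in>F. \<forall>t. w t = h t + N_j E 1 ubar [w] t"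
  using linear_solvable[OF ubar] by metis

lemma resolvent:
  assumes "h \<in> F"
  shows "resolvent h \<in> F" "resolvent h t = h t + N_j E 1 ubar [resolvent h] t"
proof -
  obtain w where w: "w \<in> F" "\<And>t. w t = h t + N_j E 1 ubar [w] t" using resolvent_ex[OF assms] by blast
  have e: "resolvent h = w" using resolvent_unique[OF w] .
  show "resolvent h \<in> F" "resolvent h t = h t + N_j E 1 ubar [resolvent h] t"
    unfolding e using w by blast+
qed

lemma resolvent_lincomb:
  assumes "h \<in> F" "k \<in> F"
  shows "resolvent (\<lambda>t. a *\<^sub>R h t + b *\<^sub>R k t) = (\<lambda>t. a *\<^sub>R resolvent h t + b *\<^sub>R resolvent k t)"
proof (rule resolvent_unique)
  show "(\<lambda>t. a *\<^sub>R resolvent h t + b *\<^sub>R resolvent k t) \<in> F"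
    by (intro F_add F_scaleR resolvent assms)
  show "a *\<^sub>R resolvent h t + b *\<^sub>R resolvent k t = a *\<^sub>R h t + b *\<^sub>R k t +
      N_j E 1 ubar [\<lambda>t. a *\<^sub>R resolvent h t + b *\<^sub>R resolvent k t] t" for t
  proof -
    have 1: "a *\<^sub>R resolvent h t = a *\<^sub>R h t + a *\<^sub>R N_j E 1 ubar [resolvent h] t"
      using arg_cong[OF resolvent(2)[OF assms(1), of t], of "scaleR a"] by (simp only: scaleR_right_distrib)
    have 2: "b *\<^sub>R resolvent k t = b *\<^sub>R k t + b *\<^sub>R N_j E 1 ubar [resolvent k] t"
      using arg_cong[OF resolvent(2)[OF assms(2), of t], of "scaleR b"] by (simp only: scaleR_right_distrib)
    show ?thesis
      unfolding N_1_lincomb[OF ubar resolvent(1)[OF assms(1)] resolvent(1)[OF assms(2)]]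
      by (subst 1, subst 2) (simp only: add.assoc add.left_commute)
  qed
qed

text \<open>
  Linear combinations of functions of time are formed at each time separately.
\<close>
definition multilinear_F :: "nat \<Rightarrow> ((real \<Rightarrow> 'd) list \<Rightarrow> real \<Rightarrow> 'd) \<Rightarrow> bool" where
  "multilinear_F j M \<longleftrightarrow>
     (\<forall>vs. set vs \<subseteq> F \<and> length vs = j \<longrightarrow> M vs \<in> F) \<and>
     (\<forall>xs ys x y a b t. set xs \<subseteq> F \<and> set ys \<subseteq> F \<and> x \<in> F \<and> y \<in> F \<and> length xs + 1 + length ys = j \<longrightarrow>
        M (xs @ (\<lambda>t. a *\<^sub>R x t + b *\<^sub>R y t) # ys) t = a *\<^sub>R M (xs @ x # ys) t + b *\<^sub>R M (xs @ y # ys) t)"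

definition multilinear_D :: "nat \<Rightarrow> ('d list \<Rightarrow> real \<Rightarrow> 'd) \<Rightarrow> bool" where
  "multilinear_D k A \<longleftrightarrow>
     (\<forall>gs. length gs = k \<longrightarrow> A gs \<in> F) \<and>
     (\<forall>xs ys x y a b t. length xs + 1 + length ys = k \<longrightarrow>
        A (xs @ (a *\<^sub>R x + b *\<^sub>R y) # ys) t = a *\<^sub>R A (xs @ x # ys) t + b *\<^sub>R A (xs @ y # ys) t)"

lemma N_j_multilinear_F: "j \<in> {1..p} \<Longrightarrow> multilinear_F j (N_j E j ubar)"
  unfolding multilinear_F_def using N_j_Duhamel(2)[OF _ ubar] N_j_multilinear[OF _ ubar] by blast

abbreviation plug :: "(nat \<Rightarrow> 'd list \<Rightarrow> real \<Rightarrow> 'd) \<Rightarrow> nat list \<Rightarrow> 'd list \<Rightarrow> (real \<Rightarrow> 'd) list" where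
  "plug W ls gs \<equiv> map (\<lambda>(l, c). W l c) (zip ls (chunks ls gs))"

lemma plug_subset_F:
  assumes "\<And>l c. l \<in> set ls \<Longrightarrow> length c = Suc l \<Longrightarrow> W l c \<in> F" "length gs = sum_list (map Suc ls)"
  shows "set (plug W ls gs) \<subseteq> F"
  using assms
proof (induction ls arbitrary: gs)
  case (Cons l ls)
  have "W l (take (Suc l) gs) \<in> F" using Cons.prems by simp
  moreover have "set (plug W ls (drop (Suc l) gs)) \<subseteq> F"
    using Cons.prems by (intro Cons.IH) auto
  ultimately show ?case by simp
qed simp

lemma plug_in_F:
  assumes "\<And>l. l \<in> set ls \<Longrightarrow> multilinear_D (Suc l) (W l)" "length gs = sum_list (map Suc ls)"
  shows "set (plug W ls gs) \<subseteq> F"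
  using assms by (intro plug_subset_F) (auto simp: multilinear_D_def)

text \<open>
  By induction on \<open>ls\<close>: a given argument position lies either in the first chunk, where the linearity
  of \<open>W l\<close> is followed by that of \<open>M\<close> in its first slot, or in a later one, where the induction
  hypothesis applies to \<open>M\<close> with its first slot frozen.
\<close>
lemma multilinear_plug:
  assumes "\<And>l. l \<in> set ls \<Longrightarrow> multilinear_D (Suc l) (W l)" "multilinear_F (length ls) M"
  shows "multilinear_D (sum_list (map Suc ls)) (\<lambda>gs. M (plug W ls gs))"
  using assms
proof (induction ls arbitrary: M)
  case Nil
  then show ?case by (simp add: multilinear_D_def multilinear_F_def)
next
  case (Cons l ls)
  have Wl: "multilinear_D (Suc l) (W l)" using Cons.prems by simp
  have Wls: "\<And>l. l \<in> set ls \<Longrightarrow> multilinear_D (Suc l) (W l)" using Cons.prems by simp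
  have M': "multilinear_D (sum_list (map Suc ls)) (\<lambda>gs. M (W l c # plug W ls gs))" if "length c = Suc l" for c
  proof (rule Cons.IH[OF Wls])
    have "W l c \<in> F" using Wl that by (simp add: multilinear_D_def)
    then show "multilinear_F (length ls) (\<lambda>vs. M (W l c # vs))"
      using Cons.prems(2) unfolding multilinear_F_def
      apply (intro conjI allI impI)
      subgoal for vs by simp
      subgoal for xs ys x y a b t
        by (drule conjunct2, drule spec[of _ "W l c # xs"]) simp
      done
  qed
  show ?case unfolding multilinear_D_def
  proof (intro conjI allI impI)
    fix gs :: "'d list" assume "length gs = sum_list (map Suc (l # ls))"
    then show "M (plug W (l # ls) gs) \<in> F"
      using plug_in_F[of "l # ls" W gs] Cons.prems unfolding multilinear_F_def by simp
  next
    fix xs ys :: "'d list" and x y a b t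
    assume len: "length xs + 1 + length ys = sum_list (map Suc (l # ls))"
    show "M (plug W (l # ls) (xs @ (a *\<^sub>R x + b *\<^sub>R y) # ys)) t =
        a *\<^sub>R M (plug W (l # ls) (xs @ x # ys)) t + b *\<^sub>R M (plug W (l # ls) (xs @ y # ys)) t"
    proof (cases "length xs \<le> l")
      case True
      define ys1 where "ys1 = take (l - length xs) ys"
      define ys2 where "ys2 = drop (l - length xs) ys"
      have tk: "take (Suc l) (xs @ z # ys) = xs @ z # ys1" for z
        using True by (simp add: ys1_def Suc_diff_le)
      have dr: "drop (Suc l) (xs @ z # ys) = ys2" for z
        using True by (simp add: ys2_def Suc_diff_le)
      have l1: "length xs + 1 + length ys1 = Suc l" using len True by (auto simp: ys1_def)
      have l2: "length ys2 = sum_list (map Suc ls)" using len True by (auto simp: ys2_def)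
      have e: "W l (xs @ (a *\<^sub>R x + b *\<^sub>R y) # ys1) = (\<lambda>t. a *\<^sub>R W l (xs @ x # ys1) t + b *\<^sub>R W l (xs @ y # ys1) t)"
        using Wl l1 unfolding multilinear_D_def by blast
      have "W l (xs @ z # ys1) \<in> F" for z using Wl l1 unfolding multilinear_D_def by simp
      then show ?thesis
        using Cons.prems(2)[unfolded multilinear_F_def, THEN conjunct2, rule_format,
          of "[]" "plug W ls ys2" "W l (xs @ x # ys1)" "W l (xs @ y # ys1)" a b t]
          plug_in_F[OF Wls l2]
        by (simp add: tk dr e del: take_append drop_append)
    next
      case False
      define c where "c = take (Suc l) xs"
      have tk: "take (Suc l) (xs @ z # ys) = c" for z using False by (simp add: c_def)
      have dr: "drop (Suc l) (xs @ z # ys) = drop (Suc l) xs @ z # ys" for z using False by simp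
      have lc: "length c = Suc l" using False by (simp add: c_def)
      show ?thesis
        using M'[OF lc, unfolded multilinear_D_def, THEN conjunct2, rule_format,
          of "drop (Suc l) xs" ys a x b y t] len False
        by (simp add: tk dr del: take_append drop_append)
    qed
  qed
qed

lemma multilinear_sum:
  assumes "finite S" "\<And>i. i \<in> S \<Longrightarrow> multilinear_D k (A i)"
  shows "multilinear_D k (\<lambda>gs t. \<Sum>i\<in>S. A i gs t)"
proof -
  have "A i gs \<in> F" if "i \<in> S" "length gs = k" for i gs using assms(2) that by (simp add: multilinear_D_def)
  moreover have "A i (xs @ (a *\<^sub>R x + b *\<^sub>R y) # ys) t = a *\<^sub>R A i (xs @ x # ys) t + b *\<^sub>R A i (xs @ y # ys) t"
    if "i \<in> S" "length xs + 1 + length ys = k" for i xs ys x y a b t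
    using assms(2)[OF that(1)] that(2) unfolding multilinear_D_def by blast
  ultimately show ?thesis
    using F_sum[OF assms(1)] by (auto simp: multilinear_D_def sum.distrib scaleR_sum_right)
qed

lemma multilinear_resolvent:
  assumes "multilinear_D k A" shows "multilinear_D k (\<lambda>gs. resolvent (A gs))"
  unfolding multilinear_D_def
proof (intro conjI allI impI)
  show "resolvent (A gs) \<in> F" if "length gs = k" for gs
    using assms that by (intro resolvent) (simp add: multilinear_D_def)
  fix xs ys :: "'d list" and x y :: 'd and a b t assume len: "length xs + 1 + length ys = k"
  have e: "A (xs @ (a *\<^sub>R x + b *\<^sub>R y) # ys) = (\<lambda>t. a *\<^sub>R A (xs @ x # ys) t + b *\<^sub>R A (xs @ y # ys) t)"
    using assms len unfolding multilinear_D_def by blast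
  have "A (xs @ z # ys) \<in> F" for z using assms len unfolding multilinear_D_def by simp
  then show "resolvent (A (xs @ (a *\<^sub>R x + b *\<^sub>R y) # ys)) t =
    a *\<^sub>R resolvent (A (xs @ x # ys)) t + b *\<^sub>R resolvent (A (xs @ y # ys)) t"
    unfolding e by (simp add: resolvent_lincomb)
qed

text \<open>
  The corrector \<open>w\<^sub>m\<close> with each occurrence of the datum replaced by an independent argument. The
  implicit term \<open>N\<^sub>1(ubar, w\<^sub>m)\<close> is absorbed by the resolvent, so the recursion only calls smaller
  indices.
\<close>
function cascade :: "nat \<Rightarrow> 'd list \<Rightarrow> real \<Rightarrow> 'd" where
  "cascade m gs = resolvent (if m = 0 then (\<lambda>t. UD E t (hd gs)) else
     (\<lambda>t. \<Sum>j\<in>{2..p}. \<Sum>ls\<in>compositions j m.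
        N_j E j ubar (map (\<lambda>(l, c). cascade l c) (zip ls (chunks ls gs))) t))"
  by pat_completeness auto
termination
  by (relation "Wellfounded.measure fst") (auto dest!: set_zip_leftD intro: compositions_less)

declare cascade.simps [simp del]

lemma H1_bound: obtains C where "0 < C" "\<And>g. (\<lambda>t. UD E t g) \<in> F" "\<And>g. nF (\<lambda>t. UD E t g) \<le> C * norm g"
  using H1 unfolding H1_def by blast

lemma cascade_multilinear: "multilinear_D (Suc m) (cascade m)"
proof (induction m rule: less_induct)
  case (less m)
  show ?case
  proof (cases "m = 0")
    case True
    have "multilinear_D 1 (\<lambda>gs t. UD E t (hd gs))"
      unfolding multilinear_D_def
      by (auto simp: UD_lincomb length_Suc_conv intro: H1_bound)
    from multilinear_resolvent[OF this] show ?thesis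
      using True by (simp add: cascade.simps[abs_def])
  next
    case False
    have "multilinear_D (Suc m) (\<lambda>gs t. \<Sum>j\<in>{2..p}. \<Sum>ls\<in>compositions j m.
        N_j E j ubar (plug cascade ls gs) t)"
    proof (intro multilinear_sum finite_atLeastAtMost finite_compositions)
      fix j ls assume j: "j \<in> {2..p}" and ls: "ls \<in> compositions j m"
      have s: "sum_list (map Suc ls) = Suc m"
        using ls by (simp add: compositions_def sum_list_Suc)
      have "multilinear_D (sum_list (map Suc ls)) (\<lambda>gs. N_j E j ubar (plug cascade ls gs))"
        using j ls less compositions_less[OF _ ls] N_j_multilinear_F[of j]
        by (intro multilinear_plug) (auto simp: compositions_def)
      then show "multilinear_D (Suc m) (\<lambda>gs. N_j E j ubar (plug cascade ls gs))" by (simp only: s)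
    qed
    from multilinear_resolvent[OF this] show ?thesis
      using False by (simp add: cascade.simps[abs_def])
  qed
qed

lemma cascade_in_F: "length gs = Suc m \<Longrightarrow> cascade m gs \<in> F"
  using cascade_multilinear[of m] by (simp add: multilinear_D_def)

definition corrector :: "'d \<Rightarrow> nat \<Rightarrow> real \<Rightarrow> 'd" where
  "corrector g k = cascade k (replicate (Suc k) g)"

lemma corrector_in_F: "corrector g k \<in> F"
  unfolding corrector_def by (rule cascade_in_F) simp

lemma U_in_F: "(\<lambda>t. UD E t g) \<in> F" by (rule H1_bound) blast

lemma corrector_rest:
  fixes w :: "nat \<Rightarrow> real \<Rightarrow> 'd"
  assumes "\<And>k. w k \<in> F"
  shows "(\<lambda>t. \<Sum>j\<in>{2..p}. \<Sum>ls\<in>compositions j m. N_j E j ubar (map w ls) t) \<in> F"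
  using assms by (intro F_sum[THEN conjunct1] finite_atLeastAtMost finite_compositions N_j_Duhamel(2)[OF _ ubar])
    (auto simp: compositions_def)

lemma corrector_equation:
  "corrector g m = resolvent (if m = 0 then (\<lambda>t. UD E t g) else
     (\<lambda>t. \<Sum>j\<in>{2..p}. \<Sum>ls\<in>compositions j m. N_j E j ubar (map (corrector g) ls) t))"
proof -
  have "plug cascade ls (replicate (Suc m) g) = map (corrector g) ls" if "ls \<in> compositions j m" for j ls
  proof -
    have s: "Suc m = sum_list (map Suc ls)"
      using that by (simp add: compositions_def sum_list_Suc)
    show ?thesis unfolding chunks_replicate[OF s]
      by (rule nth_equalityI) (simp_all add: corrector_def del: replicate.simps)
  qed
  then show ?thesis unfolding corrector_def[of g m] cascade.simps[of m]
    by (simp cong: sum.cong)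
qed

text \<open>
  The two equations of a cascade in one: for \<open>m = 0\<close> the only tuple is \<open>[0]\<close> with \<open>j = 1\<close>.
\<close>
lemma cascade_iff:
  "is_cascade E ubar g w \<longleftrightarrow> (\<forall>k. w k \<in> F) \<and> (\<forall>m t. w m t = (if m = 0 then UD E t g else 0) +
     (\<Sum>j=1..p. \<Sum>ls\<in>compositions j m. N_j E j ubar (map w ls) t))"
proof -
  have z: "(\<Sum>j=1..p. \<Sum>ls\<in>compositions j 0. N_j E j ubar (map w ls) t) = N_j E 1 ubar [w 0] t" for t
  proof -
    have "(\<Sum>j=1..p. \<Sum>ls\<in>compositions j 0. N_j E j ubar (map w ls) t) =
      (\<Sum>j\<in>{1}. \<Sum>ls\<in>compositions j 0. N_j E j ubar (map w ls) t)"
      using p_ge_2 compositions_zero by (intro sum.mono_neutral_right) (auto simp: not_less_eq_eq numeral_2_eq_2)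
    also have "\<dots> = N_j E 1 ubar [w 0] t" using compositions_one[of 0] by simp
    finally show ?thesis .
  qed
  have split: "(\<forall>m t. Q m t) \<longleftrightarrow> (\<forall>t. Q 0 t) \<and> (\<forall>m\<ge>1. \<forall>t. Q m t)" for Q :: "nat \<Rightarrow> real \<Rightarrow> bool"
    by (metis less_one not_le)
  have pos: "(\<forall>m\<ge>1. \<forall>t. w m t = (if m = 0 then UD E t g else 0) + S m t) \<longleftrightarrow> (\<forall>m\<ge>1. \<forall>t. w m t = S m t)"
    for S :: "nat \<Rightarrow> real \<Rightarrow> 'd" by auto
  show ?thesis unfolding is_cascade_def compositions_def[symmetric]
    by (subst split, subst z, subst pos, subst if_P[OF refl]) (rule refl)
qed

lemma split_first: "(\<Sum>j=1..p. \<Sum>ls\<in>compositions j m. N_j E j ubar (map w ls) t) =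
    N_j E 1 ubar [w m] t + (\<Sum>j\<in>{2..p}. \<Sum>ls\<in>compositions j m. N_j E j ubar (map w ls) t)"
proof -
  have "{1..p} = insert 1 {2..p}" using p_ge_2 by auto
  then show ?thesis using compositions_one[of m] by simp
qed

lemma corrector_cascade: "is_cascade E ubar g (corrector g)"
  unfolding cascade_iff
proof (intro conjI allI corrector_in_F)
  fix m t
  let ?h = "if m = 0 then (\<lambda>t. UD E t g) else
     (\<lambda>t. \<Sum>j\<in>{2..p}. \<Sum>ls\<in>compositions j m. N_j E j ubar (map (corrector g) ls) t)"
  have "?h \<in> F" using U_in_F corrector_rest[of "corrector g" m] corrector_in_F by simp
  from resolvent(2)[OF this, of t, folded corrector_equation]
  show "corrector g m t = (if m = 0 then UD E t g else 0) +
     (\<Sum>j=1..p. \<Sum>ls\<in>compositions j m. N_j E j ubar (map (corrector g) ls) t)"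
    unfolding split_first using compositions_zero by auto
qed

lemma cascade_unique:
  assumes "is_cascade E ubar g w" shows "w = corrector g"
proof
  fix m show "w m = corrector g m"
  proof (induction m rule: less_induct)
    case (less m)
    have c: "w m \<in> F" "\<And>t. w m t = (if m = 0 then UD E t g else 0) +
     (\<Sum>j=1..p. \<Sum>ls\<in>compositions j m. N_j E j ubar (map w ls) t)"
      using assms unfolding cascade_iff by blast+
    have e: "map w ls = map (corrector g) ls" if "j \<in> {2..p}" "ls \<in> compositions j m" for j ls
      using less compositions_less[OF _ that(2)] that(1) by auto
    have "corrector g m = w m" unfolding corrector_equation[of g m]
    proof (rule resolvent_unique[OF c(1)])
      fix t
      show "w m t = (if m = 0 then \<lambda>t. UD E t g
           else (\<lambda>t. \<Sum>j = 2..p. \<Sum>ls\<in>compositions j m. N_j E j ubar (map (corrector g) ls) t)) t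
         + N_j E 1 ubar [w m] t"
      proof (cases "m = 0")
        case True
        have "(\<Sum>j = 2..p. \<Sum>ls\<in>compositions j 0. N_j E j ubar (map w ls) t) = 0"
          by (rule sum.neutral) (simp add: compositions_zero)
        then show ?thesis using c(2)[of t] True unfolding split_first by simp
      next
        case False
        have "(\<Sum>j = 2..p. \<Sum>ls\<in>compositions j m. N_j E j ubar (map w ls) t) =
          (\<Sum>j = 2..p. \<Sum>ls\<in>compositions j m. N_j E j ubar (map (corrector g) ls) t)"
          by (intro sum.cong refl) (simp only: e)
        then show ?thesis using c(2)[of t] False unfolding split_first by simp
      qed
    qed
    then show ?case by simp
  qed
qed

end

section \<open>A majorant for the correctors\<close>

text \<open>
  The recursion satisfied by the norms of the maps \<open>cascade m\<close>; here \<open>A\<close> bounds the linear term and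
  \<open>B\<close> the multilinear operators.
\<close>
function majorant :: "nat \<Rightarrow> real \<Rightarrow> real \<Rightarrow> nat \<Rightarrow> real" where
  "majorant p A B m = (if m = 0 then A else
     B * (\<Sum>j\<in>{2..p}. \<Sum>ls\<in>compositions j m. prod_list (map (majorant p A B) ls)))"
  by pat_completeness auto
termination
  by (relation "Wellfounded.measure (\<lambda>(p, A, B, m). m)") (auto intro: compositions_less)

declare majorant.simps [simp del]

lemma majorant_nonneg: "0 \<le> A \<Longrightarrow> 0 \<le> B \<Longrightarrow> 0 \<le> majorant p A B m"
proof (induction m rule: less_induct)
  case (less m)
  show ?case
    unfolding majorant.simps[of p A B m] using less compositions_less
    by (auto intro!: mult_nonneg_nonneg sum_nonneg prod_list_nonneg_map)
qed

lemma prod_list_mult_power: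
  fixes f :: "nat \<Rightarrow> real"
  shows "prod_list (map (\<lambda>l. f l * x ^ l) ls) = prod_list (map f ls) * x ^ sum_list ls"
  by (induction ls) (simp_all add: power_add)

text \<open>
  Let \<open>s n\<close> be the partial sums of the power series with coefficients \<open>majorant p A B m\<close>. Multiplying
  out, \<open>s (n + 1) \<le> A + B (\<Sum>j=2..p. x ^ (j - 1) * s n ^ j)\<close>. As every term of the sum contains a factor \<open>x\<close>,
  the bound \<open>2 (A + 1)\<close> is inherited by \<open>s (n + 1)\<close> for small \<open>x\<close>.
\<close>
lemma majorant_partial_sums:
  assumes A: "0 \<le> A" and B: "0 \<le> B"
  obtains x where "0 < x" "x \<le> 1" "\<And>n. (\<Sum>m\<le>n. majorant p A B m * x ^ m) \<le> 2 * (A + 1)"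
proof -
  define \<beta> where "\<beta> = 2 * (A + 1)"
  \<comment> \<open>so small that the \<open>p - 1\<close> terms of degree at least two add up to at most \<open>1\<close>\<close>
  define x where "x = min 1 (1 / (B * real p * \<beta> ^ p + 1))"
  have \<beta>: "1 \<le> \<beta>" "0 \<le> \<beta>" using A by (auto simp: \<beta>_def)
  have nn: "0 \<le> B * real p * \<beta> ^ p" using B \<beta> by simp
  have x: "0 < x" "x \<le> 1" using nn by (auto simp: x_def)
  have "B * real p * \<beta> ^ p * x \<le> B * real p * \<beta> ^ p * (1 / (B * real p * \<beta> ^ p + 1))"
    using nn by (intro mult_left_mono) (auto simp: x_def)
  also have "\<dots> \<le> 1" using nn by (simp add: field_simps)
  finally have small: "B * real p * \<beta> ^ p * x \<le> 1" .
  let ?b = "majorant p A B"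
  have b0: "0 \<le> ?b m" for m using majorant_nonneg[OF A B] .
  have "(\<Sum>m\<le>n. ?b m * x ^ m) \<le> \<beta>" for n
  proof (induction n)
    case 0 then show ?case using A by (simp add: \<beta>_def majorant.simps)
  next
    case (Suc n)
    let ?S = "\<Sum>m\<le>n. ?b m * x ^ m"
    have S0: "0 \<le> ?S" using b0 x by (intro sum_nonneg mult_nonneg_nonneg) auto
    define f where "f ls = prod_list (map (\<lambda>l. ?b l * x ^ l) ls)" for ls
    have f0: "0 \<le> f ls" for ls unfolding f_def using b0 x by (intro prod_list_nonneg_map) auto
    have step: "?b (Suc m) * x ^ Suc m = B * (\<Sum>j\<in>{2..p}. x ^ (j - 1) * (\<Sum>ls\<in>compositions j (Suc m). f ls))" for m
    proof -
      have "(\<Sum>ls\<in>compositions j (Suc m). prod_list (map ?b ls)) * x ^ Suc m =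
          x ^ (j - 1) * (\<Sum>ls\<in>compositions j (Suc m). f ls)" if "2 \<le> j" for j
        unfolding sum_distrib_right sum_distrib_left
      proof (rule sum.cong[OF refl])
        fix ls assume "ls \<in> compositions j (Suc m)"
        then have "Suc m = (j - 1) + sum_list ls" using that by (simp add: compositions_def)
        then show "prod_list (map ?b ls) * x ^ Suc m = x ^ (j - 1) * f ls"
          by (simp only: f_def prod_list_mult_power power_add mult.assoc mult.left_commute)
      qed
      then have "(\<Sum>j\<in>{2..p}. (\<Sum>ls\<in>compositions j (Suc m). prod_list (map ?b ls)) * x ^ Suc m) =
         (\<Sum>j\<in>{2..p}. x ^ (j - 1) * (\<Sum>ls\<in>compositions j (Suc m). f ls))"
        by (intro sum.cong) auto
      then show ?thesis
        unfolding majorant.simps[of p A B "Suc m"]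
        by (simp add: sum_distrib_right[symmetric] mult.assoc del: power_Suc)
    qed
    have inner: "(\<Sum>m\<le>n. \<Sum>ls\<in>compositions j (Suc m). f ls) \<le> ?S ^ j" if "2 \<le> j" for j
    proof -
      have "(\<Sum>m\<le>n. \<Sum>ls\<in>compositions j (Suc m). f ls) = (\<Sum>ls\<in>(\<Union>m\<le>n. compositions j (Suc m)). f ls)"
        by (rule sum.UNION_disjoint[symmetric]) (simp, simp, force simp: compositions_def)
      also have "\<dots> \<le> (\<Sum>ls\<in>lists_upto j n. f ls)"
      proof (rule sum_mono2)
        show "(\<Union>m\<le>n. compositions j (Suc m)) \<subseteq> lists_upto j n"
          using compositions_less[OF that] by (fastforce simp: lists_upto_def compositions_def)
      qed (use f0 in auto)
      also have "\<dots> = ?S ^ j" unfolding f_def sum_prod_lists ..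
      finally show ?thesis .
    qed
    have "(\<Sum>m\<le>Suc n. ?b m * x ^ m) = ?b 0 * x ^ 0 + (\<Sum>m\<le>n. ?b (Suc m) * x ^ Suc m)"
      by (rule sum.atMost_Suc_shift)
    also have "?b 0 * x ^ 0 = A" by (simp add: majorant.simps)
    also have "(\<Sum>m\<le>n. ?b (Suc m) * x ^ Suc m) =
       B * (\<Sum>j\<in>{2..p}. x ^ (j - 1) * (\<Sum>m\<le>n. \<Sum>ls\<in>compositions j (Suc m). f ls))"
      unfolding step sum_distrib_left[symmetric] by (subst sum.swap) (simp add: sum_distrib_left)
    also have "\<dots> \<le> B * (\<Sum>j\<in>{2..p}. x * \<beta> ^ p)"
    proof (intro mult_left_mono sum_mono B)
      fix j assume j: "j \<in> {2..p}"
      have "x ^ (j - 1) * (\<Sum>m\<le>n. \<Sum>ls\<in>compositions j (Suc m). f ls) \<le> x * \<beta> ^ p"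
      proof (rule mult_mono)
        have "1 \<le> j - 1" using j by auto
        from power_decreasing[OF this, of x] show "x ^ (j - 1) \<le> x" using x by simp
        have "(\<Sum>m\<le>n. \<Sum>ls\<in>compositions j (Suc m). f ls) \<le> ?S ^ j" using inner j by simp
        also have "\<dots> \<le> \<beta> ^ j" using S0 Suc by (intro power_mono) auto
        also have "\<dots> \<le> \<beta> ^ p" using j \<beta> by (intro power_increasing) auto
        finally show "(\<Sum>m\<le>n. \<Sum>ls\<in>compositions j (Suc m). f ls) \<le> \<beta> ^ p" .
      qed (use x f0 in \<open>auto intro!: sum_nonneg\<close>)
      then show "x ^ (j - 1) * (\<Sum>m\<le>n. \<Sum>ls\<in>compositions j (Suc m). f ls) \<le> x * \<beta> ^ p" .
    qed
    also have "\<dots> = B * (real (card {2..p}) * (x * \<beta> ^ p))" by (simp only: sum_constant)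
    also have "\<dots> \<le> B * (real p * (x * \<beta> ^ p))"
      using B x \<beta> by (intro mult_left_mono mult_right_mono) auto
    also have "\<dots> \<le> 1" using small by (simp add: mult.assoc mult.commute mult.left_commute)
    finally show ?case using A by (simp add: \<beta>_def)
  qed
  then show ?thesis using that x by (simp add: \<beta>_def)
qed

lemma summable_nonneg_bounded:
  fixes f :: "nat \<Rightarrow> real"
  assumes "\<And>n. 0 \<le> f n" "\<And>n. (\<Sum>m\<le>n. f m) \<le> c"
  shows "summable f"
  using assms by (intro bounded_imp_summable[where B=c]) auto

context linearization
begin

lemma N_j_bound:
  obtains K where "0 \<le> K" "\<And>j vs. j \<in> {1..p} \<Longrightarrow> set vs \<subseteq> F \<Longrightarrow> length vs = j \<Longrightarrow>
    nF (N_j E j ubar vs) \<le> K * prod_list (map nF vs)"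
proof -
  obtain \<delta> where NB: "\<And>R. 0 \<le> R \<Longrightarrow> \<exists>K. estimates \<delta> R K" by (rule N_bounds) blast
  obtain K where est: "estimates \<delta> (nF ubar) K" using NB[OF nF_nonneg[OF ubar]] by blast
  show ?thesis using estimatesD(1,2)[OF est] ubar by (intro that[of K]) auto
qed

lemma plug_bound:
  assumes "\<And>l c. l \<in> set ls \<Longrightarrow> length c = Suc l \<Longrightarrow> W l c \<in> F \<and> nF (W l c) \<le> b l * prod_list (map norm c)"
    "length gs = sum_list (map Suc ls)" "\<And>l. 0 \<le> b l"
  shows "prod_list (map nF (plug W ls gs)) \<le> prod_list (map b ls) * prod_list (map norm gs)"
  using assms(1,2)
proof (induction ls arbitrary: gs)
  case (Cons l ls)
  let ?c = "take (Suc l) gs"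
  let ?d = "drop (Suc l) gs"
  have c: "length ?c = Suc l" using Cons.prems(2) by simp
  have IH: "prod_list (map nF (plug W ls ?d)) \<le> prod_list (map b ls) * prod_list (map norm ?d)"
    using Cons.prems by (intro Cons.IH) auto
  have inF: "set (plug W ls ?d) \<subseteq> F"
    using Cons.prems by (intro plug_subset_F) auto
  have "prod_list (map nF (plug W (l # ls) gs)) = nF (W l ?c) * prod_list (map nF (plug W ls ?d))" by simp
  also have "\<dots> \<le> (b l * prod_list (map norm ?c)) * (prod_list (map b ls) * prod_list (map norm ?d))"
    using Cons.prems(1)[of l ?c] c IH assms(3) inF
    by (intro mult_mono) (auto intro!: prod_list_nonneg_map nF_nonneg mult_nonneg_nonneg)
  also have "\<dots> = prod_list (map b (l # ls)) * (prod_list (map norm ?c) * prod_list (map norm ?d))" by simp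
  also have "prod_list (map norm ?c) * prod_list (map norm ?d) = prod_list (map norm gs)"
    by (simp only: prod_list.append[symmetric] map_append[symmetric] append_take_drop_id)
  finally show ?case .
qed simp

text \<open>
  A positive radius of convergence \<open>x\<close> for the operator norms of the maps \<open>cascade m\<close>.
\<close>
lemma cascade_bound:
  obtains b x \<beta> where "\<And>m. 0 \<le> b m" "0 < x" "x \<le> 1" "\<And>n::nat. (\<Sum>m\<le>n. b m * x ^ m) \<le> \<beta>"
    "\<And>m gs. length gs = Suc m \<Longrightarrow> nF (cascade m gs) \<le> b m * prod_list (map norm gs)"
proof -
  obtain K where K: "0 \<le> K" "\<And>j vs. j \<in> {1..p} \<Longrightarrow> set vs \<subseteq> F \<Longrightarrow> length vs = j \<Longrightarrow>
    nF (N_j E j ubar vs) \<le> K * prod_list (map nF vs)" by (rule N_j_bound) blast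
  obtain \<Lambda> where \<Lambda>: "0 \<le> \<Lambda>" "\<And>h. h \<in> F \<Longrightarrow> \<exists>w\<in>F. (\<forall>t. w t = h t + N_j E 1 ubar [w] t) \<and> nF w \<le> \<Lambda> * nF h"
    by (rule linear_solvable[OF ubar]) blast
  have R: "nF (resolvent h) \<le> \<Lambda> * nF h" if "h \<in> F" for h
    using \<Lambda>(2)[OF that] resolvent_unique by blast
  obtain C where C: "0 < C" "\<And>g. nF (\<lambda>t. UD E t g) \<le> C * norm g" by (rule H1_bound) blast
  define b where "b = majorant p (\<Lambda> * C) (\<Lambda> * K)"
  have A: "0 \<le> \<Lambda> * C" and B: "0 \<le> \<Lambda> * K" using \<Lambda> C K by auto
  have b0: "0 \<le> b m" for m unfolding b_def by (rule majorant_nonneg[OF A B])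
  obtain x where x: "0 < x" "x \<le> 1" "\<And>n. (\<Sum>m\<le>n. b m * x ^ m) \<le> 2 * (\<Lambda> * C + 1)"
    unfolding b_def by (rule majorant_partial_sums[OF A B]) blast
  have "nF (cascade m gs) \<le> b m * prod_list (map norm gs)" if "length gs = Suc m" for m gs
    using that
  proof (induction m arbitrary: gs rule: less_induct)
    case (less m)
    show ?case
    proof (cases "m = 0")
      case True
      then obtain g where g: "gs = [g]" using less.prems by (auto simp: length_Suc_conv)
      have "nF (cascade m gs) \<le> \<Lambda> * nF (\<lambda>t. UD E t g)"
        using R[OF U_in_F, of g] True g by (simp add: cascade.simps)
      also have "\<dots> \<le> \<Lambda> * (C * norm g)" using C \<Lambda> by (intro mult_left_mono)
      finally show ?thesis using True g by (simp add: b_def majorant.simps mult.assoc)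
    next
      case False
      let ?Q = "\<lambda>j ls. N_j E j ubar (plug cascade ls gs)"
      have s: "sum_list (map Suc ls) = Suc m" "length ls = j" if "ls \<in> compositions j m" for ls j
        using that by (simp_all add: compositions_def sum_list_Suc)
      have pF: "set (plug cascade ls gs) \<subseteq> F" if "ls \<in> compositions j m" for ls j
        using s[OF that] less.prems cascade_multilinear by (intro plug_in_F) auto
      have QF: "?Q j ls \<in> F" if "j \<in> {2..p}" "ls \<in> compositions j m" for j ls
        using that pF[OF that(2)] s[OF that(2)] by (intro N_j_Duhamel(2)[OF _ ubar]) auto
      have Qb: "nF (?Q j ls) \<le> K * prod_list (map b ls) * prod_list (map norm gs)"
        if "j \<in> {2..p}" "ls \<in> compositions j m" for j ls
      proof -
        have "nF (?Q j ls) \<le> K * prod_list (map nF (plug cascade ls gs))"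
          using that pF[OF that(2)] s[OF that(2)] by (intro K(2)) auto
        also have "\<dots> \<le> K * (prod_list (map b ls) * prod_list (map norm gs))"
        proof (intro mult_left_mono plug_bound K(1) b0)
          show "length gs = sum_list (map Suc ls)" using s[OF that(2)] less.prems by simp
          show "cascade l c \<in> F \<and> nF (cascade l c) \<le> b l * prod_list (map norm c)"
            if "l \<in> set ls" "length c = Suc l" for l c
            using less.IH[OF compositions_less[OF _ \<open>ls \<in> compositions j m\<close> that(1)] that(2)]
              \<open>j \<in> {2..p}\<close> cascade_in_F[OF that(2)] by auto
        qed
        finally show ?thesis by (simp add: mult.assoc)
      qed
      have inner: "(\<lambda>t. \<Sum>ls\<in>compositions j m. ?Q j ls t) \<in> F \<and>
          nF (\<lambda>t. \<Sum>ls\<in>compositions j m. ?Q j ls t) \<le> (\<Sum>ls\<in>compositions j m. nF (?Q j ls))" if "j \<in> {2..p}" for j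
        using QF[OF that] by (intro F_sum) auto
      have outer: "(\<lambda>t. \<Sum>j\<in>{2..p}. \<Sum>ls\<in>compositions j m. ?Q j ls t) \<in> F \<and>
          nF (\<lambda>t. \<Sum>j\<in>{2..p}. \<Sum>ls\<in>compositions j m. ?Q j ls t) \<le> (\<Sum>j\<in>{2..p}. nF (\<lambda>t. \<Sum>ls\<in>compositions j m. ?Q j ls t))"
        using inner by (intro F_sum) auto
      have "nF (cascade m gs) \<le> \<Lambda> * nF (\<lambda>t. \<Sum>j\<in>{2..p}. \<Sum>ls\<in>compositions j m. ?Q j ls t)"
        using R[OF outer[THEN conjunct1]] False by (simp add: cascade.simps[of m])
      also have "\<dots> \<le> \<Lambda> * (\<Sum>j\<in>{2..p}. \<Sum>ls\<in>compositions j m. K * prod_list (map b ls) * prod_list (map norm gs))"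
      proof (intro mult_left_mono \<Lambda>(1) order_trans[OF outer[THEN conjunct2]] sum_mono)
        fix j assume j: "j \<in> {2..p}"
        show "nF (\<lambda>t. \<Sum>ls\<in>compositions j m. ?Q j ls t) \<le> (\<Sum>ls\<in>compositions j m. K * prod_list (map b ls) * prod_list (map norm gs))"
          by (rule order_trans[OF inner[OF j, THEN conjunct2]], rule sum_mono) (rule Qb[OF j])
      qed
      also have "\<dots> = b m * prod_list (map norm gs)"
        unfolding b_def majorant.simps[of p _ _ m] using False
        by (simp add: sum_distrib_left sum_distrib_right mult.assoc)
      finally show ?thesis .
    qed
  qed
  then show ?thesis using that[of b x] x b0 by blast
qed

end

section \<open>The perturbation series solves the equation\<close>

context linearization
begin

lemma multilinear_F_sum:
  assumes M: "multilinear_F j M" and v: "\<And>k. v k \<in> F"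
    and len: "length xs + i = j" and xs: "set xs \<subseteq> F"
  shows "M (xs @ replicate i (\<lambda>t. \<Sum>k\<le>n. v k t)) t = (\<Sum>ls\<in>lists_upto i n. M (xs @ map v ls) t)"
  using len xs
proof (induction i arbitrary: xs)
  case 0 then show ?case by (simp add: lists_upto_0)
next
  case (Suc i)
  let ?s = "\<lambda>n t. \<Sum>k\<le>n. v k t"
  have sF: "?s n \<in> F" for n using F_sum[of "{..n}" v] v by auto
  have add: "M (xs @ (\<lambda>t. x t + y t) # ys) t = M (xs @ x # ys) t + M (xs @ y # ys) t"
    if "x \<in> F" "y \<in> F" "set ys \<subseteq> F" "length ys = i" for x y ys
    using M[unfolded multilinear_F_def, THEN conjunct2, rule_format, of xs ys x y 1 1 t] that Suc.prems
    by simp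
  have slot: "M (xs @ ?s m # ys) t = (\<Sum>k\<le>m. M (xs @ v k # ys) t)"
    if "set ys \<subseteq> F" "length ys = i" for m ys
  proof (induction m)
    case (Suc m) then show ?case using add[OF sF[of m] v[of "Suc m"] that] by simp
  qed simp
  have "M (xs @ replicate (Suc i) (?s n)) t = (\<Sum>k\<le>n. M (xs @ v k # replicate i (?s n)) t)"
    using slot[of "replicate i (?s n)" n] sF[of n] by (simp add: set_replicate_conv_if)
  also have "\<dots> = (\<Sum>k\<le>n. \<Sum>ls\<in>lists_upto i n. M ((xs @ [v k]) @ map v ls) t)"
  proof (rule sum.cong[OF refl])
    fix k
    show "M (xs @ v k # replicate i (?s n)) t = (\<Sum>ls\<in>lists_upto i n. M ((xs @ [v k]) @ map v ls) t)"
      using Suc.IH[of "xs @ [v k]"] Suc.prems v by simp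
  qed
  finally show ?case by (simp add: sum_lists_upto_Suc)
qed

text \<open>
  The arguments \<open>s n\<close> are exchanged for \<open>v\<close> one slot at a time.
\<close>
lemma N_j_diag_continuous:
  assumes j: "j \<in> {1..p}" and s: "\<And>n. s n \<in> F" and v: "v \<in> F" and bd: "\<And>n. nF (s n) \<le> B" "nF v \<le> B"
    and lim: "(\<lambda>n::nat. nF (\<lambda>t. s n t - v t)) \<longlonglongrightarrow> 0"
  shows "(\<lambda>n. N_j E j ubar (replicate j (s n)) t) \<longlonglongrightarrow> N_j E j ubar (replicate j v) t"
proof -
  obtain K where K: "0 \<le> K" "\<And>vs. set vs \<subseteq> F \<Longrightarrow> length vs = j \<Longrightarrow>
    nF (N_j E j ubar vs) \<le> K * prod_list (map nF vs)" using N_j_bound j by metis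
  have B: "0 \<le> B" using bd(2) nF_nonneg[OF v] by simp
  let ?mix = "\<lambda>n i. N_j E j ubar (replicate i (s n) @ replicate (j - i) v) t"
  have "(\<lambda>n. ?mix n i - N_j E j ubar (replicate j v) t) \<longlonglongrightarrow> 0" if "i \<le> j" for i
    using that
  proof (induction i)
    case (Suc i)
    define ys where "ys = replicate (j - Suc i) v"
    have ysF: "set ys \<subseteq> F" using v by (simp add: ys_def set_replicate_conv_if)
    have xsF: "set (replicate i (s n)) \<subseteq> F" for n using s by (simp add: set_replicate_conv_if)
    have len: "length (replicate i (s n)) + 1 + length ys = j" for n using Suc.prems by (simp add: ys_def)
    have dF: "(\<lambda>t. s n t - v t) \<in> F" for n using s v by (rule F_diff)
    have 1: "replicate (Suc i) (s n) @ replicate (j - Suc i) v = replicate i (s n) @ s n # ys" for n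
      by (simp add: ys_def replicate_app_Cons_same)
    have 2: "replicate i (s n) @ replicate (j - i) v = replicate i (s n) @ v # ys" for n
      using Suc.prems by (simp add: ys_def Suc_diff_Suc flip: replicate_Suc)
    have e: "?mix n (Suc i) - ?mix n i = N_j E j ubar (replicate i (s n) @ (\<lambda>t. s n t - v t) # ys) t" for n
      using N_j_multilinear[OF j ubar xsF ysF s v len, where a=1 and b="-1"] unfolding 1 2 by simp
    have "norm (?mix n (Suc i) - ?mix n i) \<le> K * (B ^ i * B ^ (j - Suc i)) * nF (\<lambda>t. s n t - v t)" for n
    proof -
      let ?zs = "replicate i (s n) @ (\<lambda>t. s n t - v t) # ys"
      have zF: "set ?zs \<subseteq> F" using xsF[of n] ysF dF by simp
      have zl: "length ?zs = j" using len by simp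
      have NF: "N_j E j ubar ?zs \<in> F" using j zF zl ubar by (intro N_j_Duhamel(2))
      have "norm (?mix n (Suc i) - ?mix n i) \<le> nF (N_j E j ubar ?zs)" unfolding e by (rule norm_le_nF[OF NF])
      also have "\<dots> \<le> K * prod_list (map nF ?zs)" by (rule K(2)[OF zF zl])
      also have "prod_list (map nF ?zs) = (nF (s n) ^ i * nF v ^ (j - Suc i)) * nF (\<lambda>t. s n t - v t)"
        by (simp add: ys_def prod_list_replicate)
      also have "K * ((nF (s n) ^ i * nF v ^ (j - Suc i)) * nF (\<lambda>t. s n t - v t)) \<le> K * ((B ^ i * B ^ (j - Suc i)) * nF (\<lambda>t. s n t - v t))"
        using K(1) nF_nonneg[OF s] nF_nonneg[OF v] nF_nonneg[OF dF] bd B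
        by (intro mult_left_mono mult_right_mono mult_mono power_mono) auto
      finally show ?thesis by (simp only: mult.assoc)
    qed
    moreover have "(\<lambda>n. K * (B ^ i * B ^ (j - Suc i)) * nF (\<lambda>t. s n t - v t)) \<longlonglongrightarrow> 0"
      using tendsto_mult_right_zero[OF lim] .
    ultimately have "(\<lambda>n. ?mix n (Suc i) - ?mix n i) \<longlonglongrightarrow> 0"
      by (intro Lim_null_comparison[where f="\<lambda>n. ?mix n (Suc i) - ?mix n i"] always_eventually allI)
    from tendsto_add[OF this Suc.IH] Suc.prems show ?case by simp
  qed simp
  from this[of j] show ?thesis by (simp add: LIM_zero_iff)
qed

text \<open>
  Let \<open>s n\<close> be the partial sums of the series. Expanding \<open>N\<^sub>j(ubar, s n, \<dots>, s n)\<close> by multilinearity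
  gives a sum over all tuples of indices at most \<open>n\<close>, and the equations of the cascade account for
  exactly those tuples with \<open>j + sum_list ls \<le> n + 1\<close>. For data in half the radius of convergence the
  remaining tuples contribute at most a constant times \<open>(1/2)\<^sup>n\<close>. Hence the error of \<open>s n\<close> in the
  equation tends to zero, and the limit solves it.
\<close>
lemma series_solution:
  obtains r where "0 < r" "\<And>g. norm g \<le> r \<Longrightarrow> summable (\<lambda>k. nF (corrector g k))"
    "\<And>g g\<^sub>0. norm g \<le> r \<Longrightarrow> solves E g\<^sub>0 ubar \<Longrightarrow> solves E (g\<^sub>0 + g) (\<lambda>t. ubar t + (\<Sum>k. corrector g k t))"
proof -
  obtain b x \<beta> where b: "\<And>m. 0 \<le> b m" and x: "0 < x" "x \<le> 1" and \<beta>: "\<And>n::nat. (\<Sum>m\<le>n. b m * x ^ m) \<le> \<beta>"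
    and cb: "\<And>m gs. length gs = Suc m \<Longrightarrow> nF (cascade m gs) \<le> b m * prod_list (map norm gs)"
    by (rule cascade_bound) blast
  obtain K where K: "0 \<le> K" "\<And>j vs. j \<in> {1..p} \<Longrightarrow> set vs \<subseteq> F \<Longrightarrow> length vs = j \<Longrightarrow>
    nF (N_j E j ubar vs) \<le> K * prod_list (map nF vs)" by (rule N_j_bound) blast
  have bx: "0 \<le> b m * x ^ m" for m using b x by simp
  have sbx: "summable (\<lambda>m. b m * x ^ m)" by (rule summable_nonneg_bounded[OF bx \<beta>])
  define r where "r = x / 2"
  have r: "0 < r" "r \<le> x" "r \<le> 1" using x by (auto simp: r_def)
  have cn: "nF (corrector g k) \<le> (b k * x ^ k) * (1/2) ^ Suc k" if "norm g \<le> r" for g :: 'd and k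
  proof -
    have "nF (corrector g k) \<le> b k * norm g ^ Suc k"
      using cb[of "replicate (Suc k) g" k] by (simp add: corrector_def prod_list_replicate)
    also have "\<dots> \<le> b k * (x / 2) ^ Suc k"
      using that b by (intro mult_left_mono power_mono) (auto simp: r_def)
    also have "(x / 2) ^ Suc k = x ^ k * (1/2) ^ Suc k * x" by (simp add: power_divide)
    also have "b k * (x ^ k * (1/2) ^ Suc k * x) \<le> b k * (x ^ k * (1/2) ^ Suc k * 1)"
      using b x by (intro mult_left_mono) auto
    finally show ?thesis by (simp add: mult.assoc)
  qed
  have summ: "summable (\<lambda>k. nF (corrector g k))" if "norm g \<le> r" for g :: 'd
  proof (rule summable_comparison_test'[OF sbx, of 0])
    fix k
    have "(1/2::real) ^ Suc k \<le> 1" by (rule power_le_one) auto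
    then have "(b k * x ^ k) * (1/2) ^ Suc k \<le> b k * x ^ k" using mult_left_mono[OF _ bx] by fastforce
    then show "norm (nF (corrector g k)) \<le> b k * x ^ k"
      using cn[OF that, of k] nF_nonneg[OF corrector_in_F, of g k] by simp
  qed
  show ?thesis
  proof (rule that[OF r(1) summ])
    fix g g\<^sub>0 :: 'd assume g: "norm g \<le> r" and sol: "solves E g\<^sub>0 ubar"
    let ?v = "corrector g"
    define V where "V = (\<lambda>t. \<Sum>k. ?v k t)"
    define s where "s n = (\<lambda>t. \<Sum>k\<le>n. ?v k t)" for n
    note S = F_suminf[OF corrector_in_F summ[OF g]]
    have VF: "V \<in> F" unfolding V_def by (rule S(2))
    have sF: "s n \<in> F" for n unfolding s_def using F_sum[of "{..n}" ?v] corrector_in_F by auto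
    define T where "T = (\<Sum>k. nF (?v k))"
    have sT: "nF (s n) \<le> T" for n
    proof -
      have "nF (s n) \<le> (\<Sum>k\<le>n. nF (?v k))" unfolding s_def using F_sum[of "{..n}" ?v] corrector_in_F by auto
      also have "\<dots> \<le> T" unfolding T_def
        using summ[OF g] nF_nonneg[OF corrector_in_F] by (intro sum_le_suminf) auto
      finally show ?thesis .
    qed
    have VT: "nF V \<le> T" unfolding V_def T_def by (rule S(3))
    have lim: "(\<lambda>n. nF (\<lambda>t. s n t - V t)) \<longlonglongrightarrow> 0"
    proof -
      have up: "nF (\<lambda>t. s n t - V t) \<le> (\<Sum>k. nF (?v (k + Suc n)))" for n
      proof -
        have s': "summable (\<lambda>k. nF (?v (k + Suc n)))" by (rule summable_ignore_initial_segment[OF summ[OF g]])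
        have e: "V t - s n t = (\<Sum>k. ?v (k + Suc n) t)" for t
          using suminf_minus_initial_segment[OF S(1)[of t], of "Suc n"] by (simp add: V_def s_def lessThan_Suc_atMost)
        have dF: "(\<lambda>t. V t - s n t) \<in> F" by (intro F_diff VF sF)
        have "nF (\<lambda>t. s n t - V t) = nF (\<lambda>t. (-1) *\<^sub>R (V t - s n t))" by simp
        also have "\<dots> \<le> nF (\<lambda>t. V t - s n t)" using F_scaleR(2)[OF dF, of "-1"] by simp
        also have "\<dots> \<le> (\<Sum>k. nF (?v (k + Suc n)))"
          unfolding e by (rule F_suminf(3)[OF corrector_in_F s'])
        finally show ?thesis .
      qed
      have lim2: "(\<lambda>n. \<Sum>k. nF (?v (k + Suc n))) \<longlonglongrightarrow> 0"
        using suminf_exist_split2[OF summ[OF g]] by (rule LIMSEQ_Suc)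
      have low: "0 \<le> nF (\<lambda>t. s n t - V t)" for n by (rule nF_nonneg[OF F_diff(1)[OF sF VF]])
      show ?thesis
        by (rule tendsto_sandwich[OF always_eventually[OF allI[OF low]] always_eventually[OF allI[OF up]] tendsto_const lim2])
    qed
    have Vt: "V t = UD E t g + (\<Sum>j=1..p. N_j E j ubar (replicate j V) t)" for t
    proof -
      define e where "e n = s n t - UD E t g - (\<Sum>j=1..p. N_j E j ubar (replicate j (s n)) t)" for n
      have "(\<lambda>n. s n t) \<longlonglongrightarrow> V t"
        unfolding s_def V_def using summable_LIMSEQ'[OF S(1)] by simp
      moreover have "(\<lambda>n. \<Sum>j=1..p. N_j E j ubar (replicate j (s n)) t) \<longlonglongrightarrow> (\<Sum>j=1..p. N_j E j ubar (replicate j V) t)"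
        by (intro tendsto_sum N_j_diag_continuous[where B=T] sF VF sT VT lim)
      ultimately have l1: "e \<longlonglongrightarrow> V t - UD E t g - (\<Sum>j=1..p. N_j E j ubar (replicate j V) t)"
        unfolding e_def by (intro tendsto_diff tendsto_const)
      have "norm (e n) \<le> (\<Sum>j=1..p. K * \<beta> ^ j) * (1/2) ^ n" for n
      proof -
        let ?A = "\<lambda>ls. N_j E (length ls) ubar (map ?v ls)"
        \<comment> \<open>the tuples that the equations of the first \<open>n + 1\<close> correctors account for\<close>
        define G where "G j = (\<Union>m\<le>n. compositions j m)" for j
        have Gsub: "G j \<subseteq> lists_upto j n" if "j \<in> {1..p}" for j
          unfolding G_def using compositions_subset[of j _ n] that by auto
        have "s n t = (\<Sum>m\<le>n. (if m = 0 then UD E t g else 0) + (\<Sum>j=1..p. \<Sum>ls\<in>compositions j m. N_j E j ubar (map ?v ls) t))"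
          unfolding s_def using corrector_cascade[of g] unfolding cascade_iff by (intro sum.cong refl) blast
        also have "\<dots> = UD E t g + (\<Sum>j=1..p. \<Sum>m\<le>n. \<Sum>ls\<in>compositions j m. N_j E j ubar (map ?v ls) t)"
          unfolding sum.distrib by (subst (2) sum.swap) (simp add: sum.delta)
        also have "(\<Sum>j=1..p. \<Sum>m\<le>n. \<Sum>ls\<in>compositions j m. N_j E j ubar (map ?v ls) t) = (\<Sum>j=1..p. \<Sum>ls\<in>G j. N_j E j ubar (map ?v ls) t)"
          unfolding G_def by (intro sum.cong refl sum.UNION_disjoint[symmetric]) (simp, simp, force simp: compositions_def)
        finally have 1: "s n t = UD E t g + (\<Sum>j=1..p. \<Sum>ls\<in>G j. N_j E j ubar (map ?v ls) t)" .
        have 2: "N_j E j ubar (replicate j (s n)) t = (\<Sum>ls\<in>lists_upto j n. N_j E j ubar (map ?v ls) t)" if "j \<in> {1..p}" for j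
          using multilinear_F_sum[OF N_j_multilinear_F[OF that], of ?v "[]" j n t, OF corrector_in_F] by (simp add: s_def)
        have "e n = (\<Sum>j=1..p. \<Sum>ls\<in>G j. N_j E j ubar (map ?v ls) t) - (\<Sum>j=1..p. \<Sum>ls\<in>lists_upto j n. N_j E j ubar (map ?v ls) t)"
          unfolding e_def 1 using 2 by simp
        also have "\<dots> = - (\<Sum>j=1..p. \<Sum>ls\<in>lists_upto j n - G j. N_j E j ubar (map ?v ls) t)"
          unfolding sum_subtractf[symmetric] sum_negf[symmetric]
          by (intro sum.cong refl) (simp add: sum_diff[OF finite_lists_upto Gsub] sum_negf)
        finally have "norm (e n) \<le> (\<Sum>j=1..p. \<Sum>ls\<in>lists_upto j n - G j. norm (N_j E j ubar (map ?v ls) t))"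
          by (simp only: norm_minus_cancel) (intro sum_norm_le order_trans[OF norm_sum] sum_mono order_refl)
        also have "\<dots> \<le> (\<Sum>j=1..p. (K * \<beta> ^ j) * (1/2) ^ n)"
        proof (rule sum_mono)
          fix j assume j: "j \<in> {1..p}"
          have one: "norm (N_j E j ubar (map ?v ls) t) \<le> K * ((1/2) ^ n * prod_list (map (\<lambda>l. b l * x ^ l) ls))"
            if ls: "ls \<in> lists_upto j n - G j" for ls
          proof -
            have len: "length ls = j" using ls by (simp add: lists_upto_def)
            have big: "n \<le> sum_list (map Suc ls)"
            proof (rule ccontr)
              assume "\<not> n \<le> sum_list (map Suc ls)"
              then have "ls \<in> compositions j (j + sum_list ls - 1)" "j + sum_list ls - 1 \<le> n"
                using len j by (auto simp: compositions_def sum_list_Suc)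
              then show False using ls by (auto simp: G_def)
            qed
            have P: "prod_list (map (\<lambda>l. nF (?v l)) ms) \<le> prod_list (map (\<lambda>l. b l * x ^ l) ms) * (1/2) ^ sum_list (map Suc ms)" for ms
            proof (induction ms)
              case (Cons m ms)
              have "nF (?v m) * prod_list (map (\<lambda>l. nF (?v l)) ms) \<le>
                ((b m * x ^ m) * (1/2) ^ Suc m) * (prod_list (map (\<lambda>l. b l * x ^ l) ms) * (1/2) ^ sum_list (map Suc ms))"
                using Cons cn[OF g, of m] bx nF_nonneg[OF corrector_in_F]
                by (intro mult_mono) (auto intro!: prod_list_nonneg_map mult_nonneg_nonneg b)
              then show ?case by (simp add: power_add mult.assoc mult.left_commute)
            qed simp
            have mF: "set (map ?v ls) \<subseteq> F" "length (map ?v ls) = j" using corrector_in_F len by auto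
            have "norm (N_j E j ubar (map ?v ls) t) \<le> nF (N_j E j ubar (map ?v ls))"
              by (rule norm_le_nF[OF N_j_Duhamel(2)[OF j ubar mF]])
            also have "\<dots> \<le> K * prod_list (map nF (map ?v ls))" by (rule K(2)[OF j mF])
            also have "\<dots> \<le> K * (prod_list (map (\<lambda>l. b l * x ^ l) ls) * (1/2) ^ sum_list (map Suc ls))"
              using P[of ls] K(1) by (intro mult_left_mono) (simp_all add: o_def)
            also have "\<dots> \<le> K * (prod_list (map (\<lambda>l. b l * x ^ l) ls) * (1/2) ^ n)"
              using big K(1) bx by (intro mult_left_mono power_decreasing prod_list_nonneg_map) auto
            finally show ?thesis by (simp add: mult.commute)
          qed
          have "(\<Sum>ls\<in>lists_upto j n - G j. norm (N_j E j ubar (map ?v ls) t)) \<le>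
             (\<Sum>ls\<in>lists_upto j n - G j. K * ((1/2) ^ n * prod_list (map (\<lambda>l. b l * x ^ l) ls)))"
            by (rule sum_mono) (rule one)
          also have "\<dots> \<le> (\<Sum>ls\<in>lists_upto j n. K * ((1/2) ^ n * prod_list (map (\<lambda>l. b l * x ^ l) ls)))"
            using K(1) b x by (intro sum_mono2 mult_nonneg_nonneg prod_list_nonneg_map) auto
          also have "\<dots> = K * ((1/2) ^ n * (\<Sum>k\<le>n. b k * x ^ k) ^ j)"
            by (simp only: sum_distrib_left[symmetric] sum_prod_lists)
          also have "\<dots> \<le> K * ((1/2) ^ n * \<beta> ^ j)"
            using K(1) \<beta>[of n] bx by (intro mult_left_mono power_mono sum_nonneg) auto
          finally show "(\<Sum>ls\<in>lists_upto j n - G j. norm (N_j E j ubar (map ?v ls) t)) \<le> (K * \<beta> ^ j) * (1/2) ^ n"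
            by (simp add: mult.commute mult.left_commute)
        qed
        finally show ?thesis by (simp add: sum_distrib_right)
      qed
      moreover have "(\<lambda>n. (\<Sum>j=1..p. K * \<beta> ^ j) * (1/2) ^ n) \<longlonglongrightarrow> 0"
        by (intro tendsto_mult_right_zero LIMSEQ_realpow_zero) auto
      ultimately have "e \<longlonglongrightarrow> 0"
        by (intro Lim_null_comparison[where f=e] always_eventually allI)
      with l1 have "V t - UD E t g - (\<Sum>j=1..p. N_j E j ubar (replicate j V) t) = 0"
        by (rule LIMSEQ_unique)
      then show ?thesis by (simp add: algebra_simps)
    qed
    show "solves E (g\<^sub>0 + g) (\<lambda>t. ubar t + (\<Sum>k. ?v k t))"
      unfolding solves_def
    proof (intro conjI allI)
      show "(\<lambda>t. ubar t + (\<Sum>k. ?v k t)) \<in> F" using F_add(1)[OF ubar VF] by (simp add: V_def)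
      fix t
      have "ubar t + V t = UD E t (g\<^sub>0 + g) + N E (\<lambda>t. ubar t + V t) t"
      proof -
        have u: "ubar t = UD E t g\<^sub>0 + N E ubar t" using sol unfolding solves_def by blast
        have "UD E t (g\<^sub>0 + g) = UD E t g\<^sub>0 + UD E t g" using UD_lincomb[of t 1 g\<^sub>0 1 g] by simp
        then have "UD E t (g\<^sub>0 + g) + N E (\<lambda>t. ubar t + V t) t = (UD E t g\<^sub>0 + N E ubar t) +
          (UD E t g + (\<Sum>j=1..p. N_j E j ubar (replicate j V) t))"
          unfolding N_diff[OF ubar VF] by (simp only: add.assoc add.left_commute)
        then show ?thesis by (simp only: u[symmetric] Vt[symmetric])
      qed
      then show "ubar t + (\<Sum>k. ?v k t) = UD E t (g\<^sub>0 + g) + N E (\<lambda>t. ubar t + (\<Sum>k. ?v k t)) t"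
        by (simp add: V_def)
    qed
  qed
qed

lemma cascade_scaled: "cascade m (map (\<lambda>g. c *\<^sub>R g) gs) t = c ^ length gs *\<^sub>R cascade m gs t" if "length gs = Suc m"
proof -
  have "cascade m (map (\<lambda>g. c *\<^sub>R g) xs @ ys) t = c ^ length xs *\<^sub>R cascade m (xs @ ys) t" if "length xs + length ys = Suc m" for xs ys
    using that
  proof (induction xs arbitrary: ys rule: rev_induct)
    case (snoc a xs)
    have "cascade m (map (\<lambda>g. c *\<^sub>R g) (xs @ [a]) @ ys) t = c ^ length xs *\<^sub>R cascade m (xs @ (c *\<^sub>R a) # ys) t"
      using snoc.IH[of "(c *\<^sub>R a) # ys"] snoc.prems by simp
    also have "cascade m (xs @ (c *\<^sub>R a) # ys) t = c *\<^sub>R cascade m (xs @ a # ys) t"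
      using cascade_multilinear[of m, unfolded multilinear_D_def, THEN conjunct2, rule_format, of xs ys c a 0 a t] snoc.prems
      by simp
    finally show ?case by (simp add: mult.commute)
  qed simp
  from this[of gs "[]"] that show ?thesis by simp
qed

lemma corrector_scaled: "corrector (c *\<^sub>R g) k t = c ^ Suc k *\<^sub>R corrector g k t"
  using cascade_scaled[of "replicate (Suc k) g" k c t] by (simp add: corrector_def)

end

section \<open>Scattering\<close>

lemma real_Cauchy_at_top:
  fixes f :: "real \<Rightarrow> 'a::banach"
  assumes "\<And>e. 0 < e \<Longrightarrow> \<exists>T. \<forall>s t. T \<le> s \<and> s \<le> t \<longrightarrow> norm (f t - f s) \<le> e"
  shows "\<exists>l. (f \<longlongrightarrow> l) at_top"
proof -
  have "Cauchy (\<lambda>n. f (real n))"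
  proof (rule metric_CauchyI)
    fix e :: real assume "0 < e"
    then obtain T where T: "\<And>s t. T \<le> s \<Longrightarrow> s \<le> t \<Longrightarrow> norm (f t - f s) \<le> e / 2"
      using assms[of "e/2"] by auto
    obtain N where N: "T \<le> real N" using real_arch_simple by blast
    have "dist (f (real m)) (f (real n)) < e" if "N \<le> m" "N \<le> n" for m n
    proof (cases "m \<le> n")
      case True
      then show ?thesis using T[of "real m" "real n"] N that \<open>0 < e\<close> by (simp add: dist_norm norm_minus_commute)
    next
      case False
      then show ?thesis using T[of "real n" "real m"] N that \<open>0 < e\<close> by (simp add: dist_norm)
    qed
    then show "\<exists>M. \<forall>m\<ge>M. \<forall>n\<ge>M. dist (f (real m)) (f (real n)) < e" by blast
  qed
  then obtain l where l: "(\<lambda>n. f (real n)) \<longlonglongrightarrow> l" using Cauchy_convergent_iff convergent_def by blast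
  have "(f \<longlongrightarrow> l) at_top"
  proof (rule tendstoI)
    fix e :: real assume e: "0 < e"
    then obtain T where T: "\<And>s t. T \<le> s \<Longrightarrow> s \<le> t \<Longrightarrow> norm (f t - f s) \<le> e / 2"
      using assms[of "e/2"] by auto
    obtain N where N: "\<And>n. N \<le> n \<Longrightarrow> dist (f (real n)) l < e / 2"
      using l e by (metis half_gt_zero lim_sequentially)
    obtain n where n: "max T (real N) \<le> real n" using real_arch_simple by blast
    have "dist (f t) l < e" if "real n \<le> t" for t
    proof -
      have "dist (f t) (f (real n)) \<le> e / 2" using T[of "real n" t] n that by (simp add: dist_norm)
      moreover have "dist (f (real n)) l < e / 2" using N[of n] n by simp
      ultimately show ?thesis using dist_triangle[of "f t" l "f (real n)"] by linarith
    qed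
    then show "\<forall>\<^sub>F t in at_top. dist (f t) l < e" unfolding eventually_at_top_linorder by blast
  qed
  then show ?thesis ..
qed

context evolution_problem
begin

text \<open>
  A cutoff to late times: it rises from \<open>0\<close> at \<open>T\<close> to \<open>1\<close> at \<open>T + 1\<close>.
\<close>
definition late :: "real \<Rightarrow> real \<Rightarrow> real" where
  "late T t = max 0 (min 1 (t - T))"

lemma late: "\<bar>late T t\<bar> \<le> 1" "T + 1 \<le> t \<Longrightarrow> late T t = 1" "late T t \<noteq> 0 \<Longrightarrow> T < t" "continuous_on UNIV (late T)"
proof -
  show "continuous_on UNIV (late T)" unfolding late_def by (intro continuous_intros)
qed (auto simp: late_def min_def max_def split: if_splits)

lemma late_small:
  assumes u: "u \<in> F" and e: "0 < e"
  shows "\<exists>T\<^sub>0. \<forall>T\<ge>T\<^sub>0. n2 (\<lambda>t. late T t *\<^sub>R u t) \<le> e"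
proof -
  obtain \<eta> where \<eta>: "0 < \<eta>" "\<And>u h. u \<in> F \<Longrightarrow> continuous_on UNIV h \<Longrightarrow> (\<And>t. \<bar>h t\<bar> \<le> 1) \<Longrightarrow>
     (LINT t:{t. h t \<noteq> 0}|lebesgue. mass u t) \<le> \<eta> \<Longrightarrow> n2 (\<lambda>t. h t *\<^sub>R u t) \<le> e"
    using cutoff_small[OF e] by blast
  note im = mass_integrable[OF u]
  have "(\<lambda>n. \<integral>t. indicator {real n<..} t * mass u t \<partial>lebesgue) \<longlonglongrightarrow> (\<integral>t. 0 \<partial>(lebesgue :: real measure))"
  proof (rule integral_dominated_convergence[where w="mass u"])
    show "AE t in lebesgue. (\<lambda>n. indicator {real n<..} t * mass u t) \<longlonglongrightarrow> 0"
    proof (rule AE_I2)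
      fix t :: real
      obtain N where "t \<le> real N" using real_arch_simple by blast
      then have "\<forall>\<^sub>F n in sequentially. indicator {real n<..} t * mass u t = 0"
        unfolding eventually_sequentially by (intro exI[of _ N]) auto
      then show "(\<lambda>n. indicator {real n<..} t * mass u t) \<longlonglongrightarrow> 0" by (rule tendsto_eventually)
    qed
    show "(\<lambda>t. indicator {real n<..} t * mass u t) \<in> borel_measurable lebesgue" for n
      using integrable_mult_indicator[OF _ im, of "{real n<..}"] by auto
  qed (use im mass_nonneg in \<open>auto simp: indicator_def\<close>)
  then have "\<forall>\<^sub>F n in sequentially. (\<integral>t. indicator {real n<..} t * mass u t \<partial>lebesgue) < \<eta>"
    using \<eta>(1) by (intro order_tendstoD(2)) auto
  then obtain n where n: "(\<integral>t. indicator {real n<..} t * mass u t \<partial>lebesgue) < \<eta>"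
    by (auto simp: eventually_sequentially)
  have "n2 (\<lambda>t. late T t *\<^sub>R u t) \<le> e" if T: "real n \<le> T" for T
  proof (rule \<eta>(2)[OF u late(4,1)])
    have "open {t. late T t \<noteq> 0}" using open_Collect_neq[OF late(4) continuous_on_const] .
    then have S: "{t. late T t \<noteq> 0} \<in> sets lebesgue" by auto
    have "(LINT t:{t. late T t \<noteq> 0}|lebesgue. mass u t) \<le> (\<integral>t. indicator {real n<..} t *\<^sub>R mass u t \<partial>lebesgue)"
      unfolding set_lebesgue_integral_def
    proof (intro integral_mono integrable_mult_indicator S im)
      fix t
      show "indicator {t. late T t \<noteq> 0} t *\<^sub>R mass u t \<le> indicator {real n<..} t *\<^sub>R mass u t"
        using late(3)[of T t] T mass_nonneg[of u t] by (auto simp: indicator_def)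
    qed auto
    then show "(LINT t:{t. late T t \<noteq> 0}|lebesgue. mass u t) \<le> \<eta>" using n by simp
  qed
  then show ?thesis by blast
qed

lemma late_small_list:
  assumes "set us \<subseteq> F" "0 < e"
  shows "\<exists>T\<^sub>0. \<forall>T\<ge>T\<^sub>0. \<forall>u\<in>set us. n2 (\<lambda>t. late T t *\<^sub>R u t) \<le> e"
  using assms(1)
proof (induction us)
  case (Cons u us)
  obtain T1 where T1: "\<forall>T\<ge>T1. n2 (\<lambda>t. late T t *\<^sub>R u t) \<le> e" using late_small[of u e] Cons.prems assms by auto
  obtain T2 where T2: "\<forall>T\<ge>T2. \<forall>u\<in>set us. n2 (\<lambda>t. late T t *\<^sub>R u t) \<le> e" using Cons by auto
  show ?case by (rule exI[of _ "max T1 T2"]) (use T1 T2 in auto)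
qed simp

text \<open>
  For \<open>j < p\<close> the smallness comes from the coefficient and for \<open>j = p\<close> from the arguments, so all of
  them are cut off.
\<close>
lemma late_N_j_small:
  assumes j: "j \<in> {1..p}" and u: "u \<in> F" and us: "set us \<subseteq> F" "length us = j" and e: "0 < e"
  shows "\<exists>T. nF (N_j E j (\<lambda>t. late T t *\<^sub>R u t) (map (\<lambda>v t. late T t *\<^sub>R v t) us)) \<le> e"
proof -
  define R where "R = sum_list (map nF (u # us))"
  have nn: "0 \<le> nF v" if "v \<in> set (u # us)" for v using that u us nF_nonneg by auto
  have RF: "nF v \<le> R" if "v \<in> set (u # us)" for v
    unfolding R_def using nn that by (intro member_le_sum_list) auto
  have R: "0 \<le> R" using nn[of u] RF[of u] by simp
  have lF: "(\<lambda>t. late T t *\<^sub>R v t) \<in> F" "nF (\<lambda>t. late T t *\<^sub>R v t) \<le> R" if "v \<in> set (u # us)" for v T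
  proof -
    have v: "v \<in> F" using that u us by auto
    show "(\<lambda>t. late T t *\<^sub>R v t) \<in> F" "nF (\<lambda>t. late T t *\<^sub>R v t) \<le> R"
      using F_multiplier[OF v late(4,1)] RF[OF that] by (auto intro: order_trans)
  qed
  have lus: "set (map (\<lambda>v t. late T t *\<^sub>R v t) us) \<subseteq> F" for T using lF(1) by auto
  have uusF: "set (u # us) \<subseteq> F" using u us by auto
  obtain \<delta> where \<delta>: "0 < \<delta>" and NB: "\<And>R. 0 \<le> R \<Longrightarrow> \<exists>K. estimates \<delta> R K" by (rule N_bounds) blast
  obtain K where est: "estimates \<delta> R K" using NB[OF R] by blast
  note K = estimatesD(1)[OF est]
  show ?thesis
  proof (cases "j < p")
    case True
    have K': "0 \<le> K * R ^ j" using K R by simp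
    obtain e' where e': "0 < e'" "K * R ^ j * e' powr \<delta> \<le> e" by (rule small_constant[OF K' \<delta> e])
    obtain T where T: "n2 (\<lambda>t. late T t *\<^sub>R u t) \<le> e'" using late_small[OF u e'(1)] by blast
    let ?us = "map (\<lambda>v t. late T t *\<^sub>R v t) us"
    have pr: "prod_list (map nF (map (\<lambda>v t. late T t *\<^sub>R v t) vs)) \<le> R ^ length vs \<and>
       0 \<le> prod_list (map nF (map (\<lambda>v t. late T t *\<^sub>R v t) vs))" if "set vs \<subseteq> set us" for vs
      using that
    proof (induction vs)
      case (Cons v vs)
      then show ?case using lF[of v T] nF_nonneg[OF lF(1)[of v T]] R
        by (auto intro!: mult_mono mult_nonneg_nonneg)
    qed simp
    have "nF (N_j E j (\<lambda>t. late T t *\<^sub>R u t) ?us) \<le> K * n2 (\<lambda>t. late T t *\<^sub>R u t) powr \<delta> * prod_list (map nF ?us)"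
      using lF[of u T] lus[of T] us j True by (intro estimatesD(3)[OF est]) auto
    also have "\<dots> \<le> K * e' powr \<delta> * R ^ j"
      using K T \<delta> pr[of us] us by (intro mult_mono mult_left_mono powr_mono2) auto
    also have "\<dots> \<le> e" using e'(2) by (simp add: mult.assoc mult.commute mult.left_commute)
    finally show ?thesis by blast
  next
    case False
    then have jp: "j = p" using j by auto
    have K': "0 \<le> K * real p" using K by simp
    obtain e' where e': "0 < e'" "K * real p * e' powr \<delta> \<le> e" by (rule small_constant[OF K' \<delta> e])
    obtain T where T: "\<And>v. v \<in> set us \<Longrightarrow> n2 (\<lambda>t. late T t *\<^sub>R v t) \<le> e'" using late_small_list[OF us(1) e'(1)] by blast
    let ?us = "map (\<lambda>v t. late T t *\<^sub>R v t) us"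
    have "nF (N_j E p (\<lambda>t. late T t *\<^sub>R u t) ?us) \<le> K * (\<Sum>l<p. n2 (?us ! l) powr \<delta>)"
      using lF[of _ T] lus[of T] us jp j by (intro estimatesD(5)[OF est]) auto
    also have "\<dots> \<le> K * (\<Sum>l<p. e' powr \<delta>)"
      using T us jp \<delta> K by (intro mult_left_mono sum_mono powr_mono2) auto
    also have "\<dots> \<le> e" using e'(2) by (simp add: mult.assoc)
    finally show ?thesis using jp by blast
  qed
qed

text \<open>
  Cutting off the arguments at a late time \<open>T\<close> makes the operator small and does not change its source
  after \<open>T + 1\<close>. The difference is then a free evolution, which \<open>U(-t)\<close> freezes, so the oscillation of
  \<open>U(-t)N\<^sub>j(\<dots>)(t)\<close> at late times is that of the small operator.
\<close>
lemma N_j_scatters: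
  assumes j: "j \<in> {1..p}" and u: "u \<in> F" and us: "set us \<subseteq> F" "length us = j"
  shows "\<exists>v. scatters_to E (N_j E j u us) v"
  unfolding scatters_to_def
proof (rule real_Cauchy_at_top)
  fix e :: real assume e: "0 < e"
  obtain M where M: "0 \<le> M" "\<And>t g. norm (UD E t g) \<le> M * norm g" by (rule UD_bound) blast
  obtain T where T: "nF (N_j E j (\<lambda>t. late T t *\<^sub>R u t) (map (\<lambda>v t. late T t *\<^sub>R v t) us)) \<le> e / (2 * M + 1)"
    using late_N_j_small[OF j u us, of "e / (2 * M + 1)"] e M by auto
  define u' where "u' = (\<lambda>t. late T t *\<^sub>R u t)"
  define us' where "us' = map (\<lambda>v t. late T t *\<^sub>R v t) us"
  have F': "u' \<in> F" "set us' \<subseteq> F" "length us' = j"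
    using u us F_multiplier(1)[OF _ late(4,1)] by (auto simp: u'_def us'_def)
  let ?N = "N_j E j u us" and ?N' = "N_j E j u' us'"
  have N'F: "?N' \<in> F" by (rule N_j_Duhamel(2)[OF j F'])
  have d: "solves_Duhamel (\<lambda>s. 1 *\<^sub>R N_source E j u us s + (-1) *\<^sub>R N_source E j u' us' s) (\<lambda>t. 1 *\<^sub>R ?N t + (-1) *\<^sub>R ?N' t)"
    by (intro Duhamel_lincomb N_j_Duhamel j u us F')
  have z: "1 *\<^sub>R N_source E j u us s + (-1) *\<^sub>R N_source E j u' us' s = 0" if "T + 1 \<le> s" for s
    using late(2)[OF that] by (simp add: N_source_def u'_def us'_def o_def)
  obtain r where r: "t0 \<le> ereal r" using t0_fin by (cases t0) auto
  have "norm (UD E (- t) (?N t) - UD E (- s) (?N s)) \<le> e" if st: "max (T + 1) r \<le> s" "s \<le> t" for s t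
  proof -
    have s0: "t0 \<le> ereal s" using r st by (meson ereal_less_eq(3) max.boundedE order_trans)
    have "1 *\<^sub>R ?N t + (-1) *\<^sub>R ?N' t = UD E (t - s) (1 *\<^sub>R ?N s + (-1) *\<^sub>R ?N' s)"
      by (rule Duhamel_free_after[OF d _ s0]) (use z st in auto)
    then have "UD E (- t) (1 *\<^sub>R ?N t + (-1) *\<^sub>R ?N' t) = UD E (- t) (UD E (t - s) (1 *\<^sub>R ?N s + (-1) *\<^sub>R ?N' s))"
      by simp
    also have "\<dots> = UD E (- s) (1 *\<^sub>R ?N s + (-1) *\<^sub>R ?N' s)" by (simp add: UD_add[symmetric])
    finally have "UD E (- t) (?N t) - UD E (- t) (?N' t) = UD E (- s) (?N s) - UD E (- s) (?N' s)"
      unfolding UD_lincomb by simp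
    then have "UD E (- t) (?N t) - UD E (- s) (?N s) = UD E (- t) (?N' t) - UD E (- s) (?N' s)"
      by (simp add: algebra_simps)
    then have "norm (UD E (- t) (?N t) - UD E (- s) (?N s)) \<le> norm (UD E (- t) (?N' t)) + norm (UD E (- s) (?N' s))"
      by (simp only: norm_triangle_ineq4)
    also have "\<dots> \<le> M * nF ?N' + M * nF ?N'"
      using M(1) norm_le_nF[OF N'F] by (intro add_mono order_trans[OF M(2)] mult_left_mono) auto
    also have "\<dots> = 2 * M * nF ?N'" by simp
    also have "\<dots> \<le> 2 * M * (e / (2 * M + 1))"
      using T M(1) unfolding u'_def us'_def by (intro mult_left_mono) auto
    also have "\<dots> \<le> e" using M(1) e by (simp add: field_simps)
    finally show ?thesis .
  qed
  then show "\<exists>T. \<forall>s t. T \<le> s \<and> s \<le> t \<longrightarrow> norm (UD E (- t) (?N t) - UD E (- s) (?N s)) \<le> e"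
    by blast
qed

lemma scatters_lincomb:
  "scatters_to E u v \<Longrightarrow> scatters_to E u' v' \<Longrightarrow> scatters_to E (\<lambda>t. a *\<^sub>R u t + b *\<^sub>R u' t) (a *\<^sub>R v + b *\<^sub>R v')"
  unfolding scatters_to_def UD_lincomb by (intro tendsto_intros)

lemma scatters_add: "scatters_to E u v \<Longrightarrow> scatters_to E u' v' \<Longrightarrow> scatters_to E (\<lambda>t. u t + u' t) (v + v')"
  using scatters_lincomb[of u v u' v' 1 1] by simp

lemma scatters_free: "scatters_to E (\<lambda>t. UD E t g) g"
  unfolding scatters_to_def by (simp add: UD_inverse)

lemma scatters_zero: "scatters_to E (\<lambda>t. 0) 0"
  using scatters_lincomb[OF scatters_free scatters_free, of 0 0 0 0] by simp

lemma scatters_unique: "scatters_to E u v \<Longrightarrow> scatters_to E u v' \<Longrightarrow> v = v'"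
  unfolding scatters_to_def by (rule tendsto_unique) auto

lemma scatters_sum:
  assumes "finite S" "\<And>k. k \<in> S \<Longrightarrow> \<exists>v. scatters_to E (u k) v"
  shows "\<exists>v. scatters_to E (\<lambda>t. \<Sum>k\<in>S. u k t) v"
  using assms
proof (induction S)
  case empty then show ?case using scatters_zero by auto
next
  case (insert x S)
  obtain a where a: "scatters_to E (u x) a" using insert.prems[of x] by auto
  obtain b where b: "scatters_to E (\<lambda>t. \<Sum>k\<in>S. u k t) b" using insert.IH insert.prems by auto
  note ab = a b
  show ?case using scatters_add[OF ab] insert.hyps by auto
qed

lemma scatters_bound:
  obtains M where "0 \<le> M" "\<And>t g. norm (UD E t g) \<le> M * norm g"
    "\<And>u v. u \<in> F \<Longrightarrow> scatters_to E u v \<Longrightarrow> norm v \<le> M * nF u"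
proof -
  obtain M where M: "0 \<le> M" "\<And>t g. norm (UD E t g) \<le> M * norm g" by (rule UD_bound) blast
  have "norm v \<le> M * nF u" if "u \<in> F" "scatters_to E u v" for u v
  proof (rule tendsto_upperbound[OF tendsto_norm[OF that(2)[unfolded scatters_to_def]]])
    show "\<forall>\<^sub>F t in at_top. norm (UD E (- t) (u t)) \<le> M * nF u"
      using M(1) norm_le_nF[OF that(1)] by (intro always_eventually allI order_trans[OF M(2)] mult_left_mono)
  qed simp
  then show ?thesis using that M by blast
qed

lemma solution_scatters:
  assumes "solves E g u" shows "\<exists>v. scatters_to E u v"
proof -
  have u: "u \<in> F" "\<And>t. u t = UD E t g + N E u t" using assms by (auto simp: solves_def)
  have "\<exists>v. scatters_to E (N E u) v"
    unfolding N_as_top_form(1)[OF u(1)] using p_ge_2 u F_zero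
    by (intro N_j_scatters) (auto simp: set_replicate_conv_if)
  then obtain v where v: "scatters_to E (N E u) v" ..
  have e: "u = (\<lambda>t. UD E t g + N E u t)" using u(2) by (rule ext)
  show ?thesis by (subst e) (rule exI, rule scatters_add[OF scatters_free v])
qed

text \<open>
  The series \<open>\<Sum>k. U(-t)u\<^sub>k(t)\<close> converges uniformly in \<open>t\<close>, so the limits can be exchanged.
\<close>
lemma scatters_suminf:
  assumes u: "\<And>k. u k \<in> F" and s: "summable (\<lambda>k. nF (u k))" and a: "\<And>k. scatters_to E (u k) (a k)"
  shows "summable (\<lambda>k. norm (a k))" "scatters_to E (\<lambda>t. \<Sum>k. u k t) (\<Sum>k. a k)"
proof -
  obtain M where M: "0 \<le> M" "\<And>t g. norm (UD E t g) \<le> M * norm g"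
    "\<And>u v. u \<in> F \<Longrightarrow> scatters_to E u v \<Longrightarrow> norm v \<le> M * nF u" by (rule scatters_bound) blast
  have sM: "summable (\<lambda>k. M * nF (u k))" by (rule summable_mult[OF s])
  show sa: "summable (\<lambda>k. norm (a k))"
    by (rule summable_comparison_test'[OF sM, of 0]) (use M(3)[OF u a] in auto)
  note S = F_suminf[OF u s]
  have le: "norm (UD E (- t) (u k t)) \<le> M * nF (u k)" for k t
    using M(1) norm_le_nF[OF u] by (intro order_trans[OF M(2)] mult_left_mono)
  have ul: "uniform_limit UNIV (\<lambda>n t. \<Sum>k<n. UD E (- t) (u k t)) (\<lambda>t. \<Sum>k. UD E (- t) (u k t)) sequentially"
    by (rule Weierstrass_m_test[OF _ sM]) (use le in auto)
  have l2: "(\<lambda>n. \<Sum>k<n. a k) \<longlonglongrightarrow> (\<Sum>k. a k)"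
    by (rule summable_LIMSEQ[OF summable_norm_cancel[OF sa]])
  have ev: "\<forall>\<^sub>F n in sequentially. ((\<lambda>t. \<Sum>k<n. UD E (- t) (u k t)) \<longlongrightarrow> (\<Sum>k<n. a k)) at_top"
    using a by (intro always_eventually allI tendsto_sum) (auto simp: scatters_to_def)
  have "((\<lambda>t. \<Sum>k. UD E (- t) (u k t)) \<longlongrightarrow> (\<Sum>k. a k)) at_top"
    by (rule swap_uniform_limit'[OF ev l2 ul _ sequentially_bot]) simp
  moreover have "UD E (- t) (\<Sum>k. u k t) = (\<Sum>k. UD E (- t) (u k t))" for t
    by (rule bounded_linear.suminf[OF UD_bounded_linear S(1)])
  ultimately show "scatters_to E (\<lambda>t. \<Sum>k. u k t) (\<Sum>k. a k)"
    by (simp add: scatters_to_def)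
qed

end

context linearization
begin

lemma cascade_scatters:
  assumes "length gs = Suc m" shows "\<exists>v. scatters_to E (cascade m gs) v"
proof -
  define h where "h = (if m = 0 then (\<lambda>t. UD E t (hd gs)) else
     (\<lambda>t. \<Sum>j\<in>{2..p}. \<Sum>ls\<in>compositions j m. N_j E j ubar (plug cascade ls gs) t))"
  have c: "cascade m gs = resolvent h" unfolding h_def by (subst cascade.simps) (rule refl)
  have pF: "set (plug cascade ls gs) \<subseteq> F \<and> length (plug cascade ls gs) = j" if "ls \<in> compositions j m" for ls j
    using that assms cascade_multilinear by (intro conjI plug_in_F) (auto simp: compositions_def sum_list_Suc)
  have NF: "N_j E j ubar (plug cascade ls gs) \<in> F" "\<exists>v. scatters_to E (N_j E j ubar (plug cascade ls gs)) v"
    if "j \<in> {2..p}" "ls \<in> compositions j m" for j ls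
  proof -
    have j: "j \<in> {1..p}" using that by auto
    note pl = pF[OF that(2), THEN conjunct1] pF[OF that(2), THEN conjunct2]
    show "N_j E j ubar (plug cascade ls gs) \<in> F" by (rule N_j_Duhamel(2)[OF j ubar pl])
    show "\<exists>v. scatters_to E (N_j E j ubar (plug cascade ls gs)) v" by (rule N_j_scatters[OF j ubar pl])
  qed
  have hF: "h \<in> F"
  proof (cases "m = 0")
    case False
    have "(\<lambda>t. \<Sum>j\<in>{2..p}. \<Sum>ls\<in>compositions j m. N_j E j ubar (plug cascade ls gs) t) \<in> F"
      by (intro F_sum[THEN conjunct1] finite_atLeastAtMost finite_compositions NF(1))
    then show ?thesis using False by (simp add: h_def)
  qed (simp add: h_def U_in_F)
  have hs: "\<exists>v. scatters_to E h v"
  proof (cases "m = 0")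
    case True then show ?thesis using scatters_free by (auto simp: h_def)
  next
    case False
    have "\<exists>v. scatters_to E (\<lambda>t. \<Sum>j\<in>{2..p}. \<Sum>ls\<in>compositions j m. N_j E j ubar (plug cascade ls gs) t) v"
      by (intro scatters_sum finite_atLeastAtMost finite_compositions NF(2))
    then show ?thesis using False by (simp add: h_def)
  qed
  then obtain v where v: "scatters_to E h v" ..
  obtain v' where v': "scatters_to E (N_j E 1 ubar [resolvent h]) v'"
    using N_j_scatters[of 1 ubar "[resolvent h]"] ubar resolvent(1)[OF hF] p_ge_2 by auto
  have "resolvent h = (\<lambda>t. h t + N_j E 1 ubar [resolvent h] t)" using resolvent(2)[OF hF] by (rule ext)
  then have "scatters_to E (resolvent h) (v + v')"
    using scatters_add[OF v v'] by metis
  then show ?thesis unfolding c by blast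
qed

end

section \<open>Real analyticity from power series\<close>

lemma multilinear_slot:
  assumes "multilinear_on UNIV k M" "length xs + 1 + length ys = k"
  shows "M (xs @ (a *\<^sub>R x + b *\<^sub>R y) # ys) = a *\<^sub>R M (xs @ x # ys) + b *\<^sub>R M (xs @ y # ys)"
  using assms unfolding multilinear_on_def by auto

lemma multilinear_slot_add:
  assumes "multilinear_on UNIV k M" "length xs + 1 + length ys = k"
  shows "M (xs @ (x + y) # ys) = M (xs @ x # ys) + M (xs @ y # ys)"
  using multilinear_slot[OF assms, of 1 x 1 y] by simp

text \<open>
  The slots are switched from \<open>a\<close> to \<open>a + b\<close> one at a time, starting from the last one.
\<close>
lemma multilinear_telescope:
  assumes "multilinear_on UNIV (length xs + m) M"
  shows "M (xs @ replicate m (a + b)) - M (xs @ replicate m a) =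
    (\<Sum>l<m. M (xs @ replicate l a @ b # replicate (m - 1 - l) (a + b)))"
  using assms
proof (induction m arbitrary: xs)
  case (Suc m)
  have 1: "M (xs @ (a + b) # replicate m (a + b)) = M (xs @ a # replicate m (a + b)) + M (xs @ b # replicate m (a + b))"
    by (rule multilinear_slot_add[OF Suc.prems]) simp
  have 2: "M (xs @ a # replicate m (a + b)) - M (xs @ a # replicate m a) =
      (\<Sum>l<m. M (xs @ replicate (Suc l) a @ b # replicate (m - 1 - l) (a + b)))"
    using Suc.IH[of "xs @ [a]"] Suc.prems by simp
  show ?case
    unfolding sum.lessThan_Suc_shift
    using 1 2 by (simp add: algebra_simps)
qed simp

text \<open>
  Telescoping twice leaves at most \<open>k\<^sup>2\<close> terms with two slots \<open>b\<close> and \<open>k - 2\<close> slots \<open>a\<close> or \<open>a + b\<close>.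
\<close>
lemma multilinear_taylor:
  fixes M :: "'a::real_normed_vector list \<Rightarrow> 'b::real_normed_vector"
  assumes M: "multilinear_on UNIV k M" and L: "\<And>gs. length gs = k \<Longrightarrow> norm (M gs) \<le> L * prod_list (map norm gs)"
    and L0: "0 \<le> L" and s: "norm a \<le> s" "norm (a + b) \<le> s"
  shows "norm (M (replicate k (a + b)) - M (replicate k a) - (\<Sum>i<k. M (replicate i a @ b # replicate (k - 1 - i) a)))
     \<le> L * (norm b)\<^sup>2 * s ^ (k - 2) * (real k)\<^sup>2"
proof -
  have s0: "0 \<le> s" using s(1) norm_ge_zero order_trans by blast
  have inner: "norm (M (replicate i a @ b # replicate (k - 1 - i) (a + b)) - M (replicate i a @ b # replicate (k - 1 - i) a))
      \<le> real k * (L * (norm b)\<^sup>2 * s ^ (k - 2))" if i: "i < k" for i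
  proof -
    let ?m = "k - 1 - i"
    have "M (replicate i a @ b # replicate ?m (a + b)) - M (replicate i a @ b # replicate ?m a) =
      (\<Sum>l<?m. M (replicate i a @ b # replicate l a @ b # replicate (?m - 1 - l) (a + b)))"
      using multilinear_telescope[of "replicate i a @ [b]" ?m M a b] M i by simp
    also have "norm \<dots> \<le> (\<Sum>l<?m. L * (norm b)\<^sup>2 * s ^ (k - 2))"
    proof (rule sum_norm_le)
      fix l assume "l \<in> {..<?m}"
      then have l: "l < ?m" by simp
      have "norm (M (replicate i a @ b # replicate l a @ b # replicate (?m - 1 - l) (a + b))) \<le>
         L * (norm a ^ i * (norm b * (norm a ^ l * (norm b * norm (a + b) ^ (?m - 1 - l)))))"
        using L[of "replicate i a @ b # replicate l a @ b # replicate (?m - 1 - l) (a + b)"] i l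
        by (simp add: prod_list_replicate)
      also have "\<dots> \<le> L * (s ^ i * (norm b * (s ^ l * (norm b * s ^ (?m - 1 - l)))))"
        using L0 s s0 by (intro mult_left_mono mult_mono power_mono) auto
      also have "s ^ i * (norm b * (s ^ l * (norm b * s ^ (?m - 1 - l)))) = (norm b)\<^sup>2 * s ^ (i + l + (?m - 1 - l))"
        by (simp add: power_add power2_eq_square)
      also have "i + l + (?m - 1 - l) = k - 2" using i l by simp
      finally show "norm (M (replicate i a @ b # replicate l a @ b # replicate (?m - 1 - l) (a + b))) \<le> L * (norm b)\<^sup>2 * s ^ (k - 2)"
        by (simp add: mult.assoc)
    qed
    also have "\<dots> = real ?m * (L * (norm b)\<^sup>2 * s ^ (k - 2))" by simp
    also have "\<dots> \<le> real k * (L * (norm b)\<^sup>2 * s ^ (k - 2))"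
      using L0 s0 by (intro mult_right_mono) auto
    finally show ?thesis .
  qed
  have "M (replicate k (a + b)) - M (replicate k a) - (\<Sum>i<k. M (replicate i a @ b # replicate (k - 1 - i) a)) =
    (\<Sum>i<k. M (replicate i a @ b # replicate (k - 1 - i) (a + b)) - M (replicate i a @ b # replicate (k - 1 - i) a))"
    using multilinear_telescope[of "[]" k M a b] M by (simp add: sum_subtractf)
  also have "norm \<dots> \<le> (\<Sum>i<k. real k * (L * (norm b)\<^sup>2 * s ^ (k - 2)))"
    by (rule sum_norm_le) (use inner in auto)
  also have "\<dots> = L * (norm b)\<^sup>2 * s ^ (k - 2) * (real k)\<^sup>2" by (simp add: power2_eq_square)
  finally show ?thesis .
qed

text \<open>
  A power series at \<open>x\<close> whose coefficients are bounded multilinear maps. One number \<open>R\<close> serves for the growth of the coefficients and for the radius \<open>1 / R\<close>.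
\<close>
definition expansion ::
  "(nat \<Rightarrow> 'a::real_normed_vector list \<Rightarrow> 'b::real_normed_vector) \<Rightarrow> real \<Rightarrow> real \<Rightarrow> ('a \<Rightarrow> 'b) \<Rightarrow> 'a \<Rightarrow> bool" where
  "expansion P K R f x \<longleftrightarrow> (\<forall>k. multilinear_on UNIV k (P k)) \<and>
     (\<forall>k gs. length gs = k \<longrightarrow> norm (P k gs) \<le> K * R ^ k * prod_list (map norm gs)) \<and>
     (\<forall>y. norm y * R < 1 \<longrightarrow> (\<lambda>k. P k (replicate k y)) sums f (x + y))"

lemma expansionD:
  assumes "expansion P K R f x"
  shows "multilinear_on UNIV k (P k)"
    "length gs = k \<Longrightarrow> norm (P k gs) \<le> K * R ^ k * prod_list (map norm gs)"
    "norm y * R < 1 \<Longrightarrow> (\<lambda>k. P k (replicate k y)) sums f (x + y)"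
  using assms unfolding expansion_def by blast+

text \<open>
  The coefficients of the derivative in direction \<open>h\<close>: the new argument is inserted in every possible
  place.
\<close>
definition deriv_coeff :: "(nat \<Rightarrow> 'a list \<Rightarrow> 'b::comm_monoid_add) \<Rightarrow> 'a \<Rightarrow> nat \<Rightarrow> 'a list \<Rightarrow> 'b" where
  "deriv_coeff P h k gs = (\<Sum>i\<le>k. P (Suc k) (take i gs @ h # drop i gs))"

lemma nat_le_2_power: "real k \<le> 2 ^ k" "real (Suc k) \<le> 2 ^ k" "(real k)\<^sup>2 \<le> 4 ^ k"
proof -
  have "Suc k \<le> 2 ^ k" for k :: nat by (simp add: Suc_leI)
  then have a: "real (Suc k) \<le> 2 ^ k" for k by (metis of_nat_le_iff of_nat_numeral of_nat_power)
  then show b: "real k \<le> 2 ^ k" "real (Suc k) \<le> 2 ^ k" using a[of k] by auto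
  have "(real k)\<^sup>2 \<le> (2 ^ k)\<^sup>2" using b(1) by (intro power_mono) auto
  also have "(2 ^ k)\<^sup>2 = (4::real) ^ k" by (simp add: power2_eq_square flip: power_mult_distrib)
  finally show "(real k)\<^sup>2 \<le> 4 ^ k" .
qed

lemma deriv_coeff_multilinear:
  fixes P :: "nat \<Rightarrow> 'a::real_vector list \<Rightarrow> 'b::real_vector"
  assumes "\<And>k. multilinear_on UNIV k (P k)" shows "multilinear_on UNIV k (deriv_coeff P h k)"
  unfolding multilinear_on_def
proof (intro allI impI ballI)
  fix xs ys :: "'a list" and x y a b assume "length xs + 1 + length ys = k \<and> set xs \<subseteq> UNIV \<and> set ys \<subseteq> UNIV"
  then have len: "length xs + 1 + length ys = k" by simp
  have "P (Suc k) (take i (xs @ (a *\<^sub>R x + b *\<^sub>R y) # ys) @ h # drop i (xs @ (a *\<^sub>R x + b *\<^sub>R y) # ys)) =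
     a *\<^sub>R P (Suc k) (take i (xs @ x # ys) @ h # drop i (xs @ x # ys)) + b *\<^sub>R P (Suc k) (take i (xs @ y # ys) @ h # drop i (xs @ y # ys))"
    if "i \<le> k" for i
  proof (cases "i \<le> length xs")
    case True
    then show ?thesis
      using multilinear_slot[OF assms[of "Suc k"], of "take i xs @ h # drop i xs" ys a x b y] len by simp
  next
    case False
    define j where "j = i - length xs - 1"
    have i: "i = Suc (length xs + j)" using False by (simp add: j_def)
    show ?thesis
      using multilinear_slot[OF assms[of "Suc k"], of xs "take j ys @ h # drop j ys" a x b y] len that
      by (simp add: i)
  qed
  then show "deriv_coeff P h k (xs @ (a *\<^sub>R x + b *\<^sub>R y) # ys) =
      a *\<^sub>R deriv_coeff P h k (xs @ x # ys) + b *\<^sub>R deriv_coeff P h k (xs @ y # ys)"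
    by (simp add: deriv_coeff_def sum.distrib scaleR_sum_right)
qed

lemma deriv_coeff_bound:
  fixes P :: "nat \<Rightarrow> 'a::real_normed_vector list \<Rightarrow> 'b::real_normed_vector"
  assumes "\<And>k gs. length gs = k \<Longrightarrow> norm (P k gs) \<le> K * R ^ k * prod_list (map norm gs)"
    "0 \<le> K" "0 < R" "length gs = k"
  shows "norm (deriv_coeff P h k gs) \<le> real (Suc k) * (K * R ^ Suc k * norm h * prod_list (map norm gs))"
proof -
  have "norm (deriv_coeff P h k gs) \<le> (\<Sum>i\<le>k. K * R ^ Suc k * norm h * prod_list (map norm gs))"
    unfolding deriv_coeff_def
  proof (rule sum_norm_le)
    fix i assume "i \<in> {..k}"
    have e: "prod_list (map norm gs) = prod_list (map norm (take i gs)) * prod_list (map norm (drop i gs))"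
      by (metis append_take_drop_id map_append prod_list.append)
    show "norm (P (Suc k) (take i gs @ h # drop i gs)) \<le> K * R ^ Suc k * norm h * prod_list (map norm gs)"
      using assms(1)[of "take i gs @ h # drop i gs" "Suc k"] assms(4) unfolding e
      by (simp add: ac_simps)
  qed
  then show ?thesis by simp
qed

lemma deriv_coeff_replicate:
  "deriv_coeff P h k (replicate k y) = (\<Sum>i<Suc k. P (Suc k) (replicate i y @ h # replicate (k - i) y))"
  unfolding deriv_coeff_def lessThan_Suc_atMost
  by (intro sum.cong) (auto simp: take_replicate drop_replicate min_def)

text \<open>
  The second-order remainders of the single terms, bounded by \<open>multilinear_taylor\<close> with
  \<open>s = 1 / (8 R)\<close>, form a convergent series because \<open>k\<^sup>2\<close> grows more slowly than \<open>4\<^sup>k\<close>. The estimate holds around every point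
  \<open>x + y\<close> near the center \<open>x\<close>, so no expansion has to be moved to a new center.
\<close>
lemma expansion_deriv:
  fixes f :: "'a::banach \<Rightarrow> 'b::banach"
  assumes "expansion P K R f x" "0 \<le> K" "0 < R" and y: "norm y * R \<le> 1/16" and b: "norm b * R \<le> 1/16"
  shows "summable (\<lambda>k. deriv_coeff P b k (replicate k y))"
    "norm (f (x + y + b) - f (x + y) - (\<Sum>k. deriv_coeff P b k (replicate k y))) \<le> 128 * K * R\<^sup>2 * (norm b)\<^sup>2"
proof -
  have M: "multilinear_on UNIV k (P k)" and L: "\<And>gs. length gs = k \<Longrightarrow> norm (P k gs) \<le> (K * R ^ k) * prod_list (map norm gs)"
    and S: "\<And>y. norm y * R < 1 \<Longrightarrow> (\<lambda>k. P k (replicate k y)) sums f (x + y)" for k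
    by (rule expansionD[OF assms(1)]; assumption)+
  define Q where "Q k = (\<Sum>i<k. P k (replicate i y @ b # replicate (k - 1 - i) y))" for k
  have QS: "deriv_coeff P b k (replicate k y) = Q (Suc k)" for k
    by (simp add: deriv_coeff_replicate Q_def)
  have y1: "norm (y + b) * R \<le> 1/8"
  proof -
    have "norm (y + b) * R \<le> (norm y + norm b) * R"
      using assms(3) by (intro mult_right_mono norm_triangle_ineq) auto
    then show ?thesis using y b by (simp add: algebra_simps)
  qed
  have qb: "norm (Q (Suc k)) \<le> (K * R * norm b) * (1/2) ^ k" for k
  proof -
    have yk: "prod_list (map norm (replicate k y)) = norm y ^ k" by (simp add: prod_list_replicate)
    have "norm (Q (Suc k)) \<le> real (Suc k) * (K * R ^ Suc k * norm b * norm y ^ k)"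
      using deriv_coeff_bound[OF L assms(2,3), of "replicate k y" k b] by (simp only: QS yk length_replicate)
    also have "\<dots> = real (Suc k) * (K * R * norm b * (norm y * R) ^ k)"
      by (simp add: power_mult_distrib)
    also have "\<dots> \<le> 2 ^ k * (K * R * norm b * (1/16) ^ k)"
      using assms(2,3) y nat_le_2_power(2)[of k] by (intro mult_mono mult_left_mono power_mono) auto
    also have "\<dots> = (K * R * norm b) * (1/8) ^ k" by (simp add: power_divide field_simps flip: power_mult_distrib)
    also have "\<dots> \<le> (K * R * norm b) * (1/2) ^ k"
      using assms(2,3) by (intro mult_left_mono power_mono) auto
    finally show ?thesis .
  qed
  have sQS: "summable (\<lambda>k. Q (Suc k))"
    by (rule summable_comparison_test'[OF summable_mult[OF summable_geometric[of "1/2::real"]], of 0 _ "K * R * norm b"])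
      (use qb in auto)
  then show "summable (\<lambda>k. deriv_coeff P b k (replicate k y))" by (simp add: QS)
  have sQ: "summable Q" using sQS summable_Suc_iff by blast
  have Q0: "Q 0 = 0" by (simp add: Q_def)
  have sum_eq: "(\<Sum>k. deriv_coeff P b k (replicate k y)) = suminf Q"
    unfolding QS using suminf_split_head[OF sQ] Q0 by simp
  define e where "e k = P k (replicate k (y + b)) - P k (replicate k y) - Q k" for k
  have "(\<lambda>k. P k (replicate k (y + b))) sums f (x + y + b)"
    using S[of "y + b"] y1 by (simp add: add.assoc)
  moreover have "(\<lambda>k. P k (replicate k y)) sums f (x + y)" using S[of y] y by simp
  ultimately have es: "e sums (f (x + y + b) - f (x + y) - suminf Q)"
    unfolding e_def by (intro sums_diff summable_sums sQ)
  have eb: "norm (e k) \<le> (64 * K * R\<^sup>2 * (norm b)\<^sup>2) * (1/2) ^ k" for k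
  proof (cases "k < 2")
    case True
    then have "k = 0 \<or> k = 1" by auto
    then have "e k = 0"
    proof
      assume k: "k = 1"
      show ?thesis using multilinear_slot_add[OF M[of 1], of "[]" "[]" y b] by (simp add: e_def Q_def k)
    qed (simp add: e_def Q_def)
    then show ?thesis using assms(2) by simp
  next
    case False
    define m where "m = k - 2"
    have k: "k = m + 2" using False by (simp add: m_def)
    have "norm y \<le> 1 / (8 * R)" "norm (y + b) \<le> 1 / (8 * R)"
      using y y1 assms(3) by (auto simp: field_simps)
    then have "norm (e k) \<le> K * R ^ k * (norm b)\<^sup>2 * (1 / (8 * R)) ^ (k - 2) * (real k)\<^sup>2"
      unfolding e_def Q_def using assms(2,3) by (intro multilinear_taylor[OF M L]) auto
    also have "K * R ^ k * (norm b)\<^sup>2 * (1 / (8 * R)) ^ (k - 2) = 64 * K * R\<^sup>2 * (norm b)\<^sup>2 * (1/8) ^ k"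
      using assms(3) by (simp add: k power_add power_divide power_mult_distrib field_simps power2_eq_square)
    also have "64 * K * R\<^sup>2 * (norm b)\<^sup>2 * (1/8) ^ k * (real k)\<^sup>2 \<le> 64 * K * R\<^sup>2 * (norm b)\<^sup>2 * (1/8) ^ k * 4 ^ k"
      using assms(2) nat_le_2_power(3)[of k] by (intro mult_left_mono) auto
    also have "\<dots> = 64 * K * R\<^sup>2 * (norm b)\<^sup>2 * (1/2) ^ k" by (simp add: mult.assoc flip: power_mult_distrib)
    finally show ?thesis .
  qed
  have "norm (suminf e) \<le> (\<Sum>k. (64 * K * R\<^sup>2 * (norm b)\<^sup>2) * (1/2) ^ k)"
    by (rule norm_suminf_le) (use eb in \<open>auto intro!: summable_mult summable_geometric\<close>)
  also have "\<dots> = 128 * K * R\<^sup>2 * (norm b)\<^sup>2"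
    by (subst suminf_mult) (simp_all add: suminf_geometric summable_geometric)
  finally show "norm (f (x + y + b) - f (x + y) - (\<Sum>k. deriv_coeff P b k (replicate k y))) \<le> 128 * K * R\<^sup>2 * (norm b)\<^sup>2"
    using es by (simp add: sum_eq sums_iff)
qed

lemma deriv_coeff_lincomb:
  assumes "\<And>k. multilinear_on UNIV k (P k)" "length gs = k"
  shows "deriv_coeff P (a *\<^sub>R h + b *\<^sub>R h') k gs = a *\<^sub>R deriv_coeff P h k gs + b *\<^sub>R deriv_coeff P h' k gs"
proof -
  have "P (Suc k) (take i gs @ (a *\<^sub>R h + b *\<^sub>R h') # drop i gs) =
    a *\<^sub>R P (Suc k) (take i gs @ h # drop i gs) + b *\<^sub>R P (Suc k) (take i gs @ h' # drop i gs)" if "i \<le> k" for i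
    by (rule multilinear_slot[OF assms(1)]) (use assms(2) that in auto)
  then show ?thesis by (simp add: deriv_coeff_def sum.distrib scaleR_sum_right)
qed

text \<open>
  A remainder of second order is more than differentiability asks for.
\<close>
lemma has_vector_derivative_quadratic:
  fixes \<phi> :: "real \<Rightarrow> 'b::real_normed_vector"
  assumes "0 < r" "\<And>t. \<bar>t\<bar> \<le> r \<Longrightarrow> norm (\<phi> t - \<phi> 0 - t *\<^sub>R D) \<le> C * t\<^sup>2"
  shows "(\<phi> has_vector_derivative D) (at 0)"
  unfolding has_vector_derivative_def has_derivative_at_alt
proof (intro conjI allI impI bounded_linear_scaleR_left)
  fix e :: real assume e: "0 < e"
  define d where "d = min r (e / (\<bar>C\<bar> + 1))"
  have "norm (\<phi> y - \<phi> 0 - (y - 0) *\<^sub>R D) \<le> e * norm (y - 0)" if "norm (y - 0) < d" for y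
  proof -
    have y: "\<bar>y\<bar> \<le> r" "\<bar>y\<bar> \<le> e / (\<bar>C\<bar> + 1)" using that by (auto simp: d_def)
    have "norm (\<phi> y - \<phi> 0 - y *\<^sub>R D) \<le> C * y\<^sup>2" using assms(2) y by simp
    also have "\<dots> \<le> (\<bar>C\<bar> + 1) * (\<bar>y\<bar> * \<bar>y\<bar>)"
      by (intro mult_mono) (auto simp: power2_eq_square)
    also have "\<dots> = ((\<bar>C\<bar> + 1) * \<bar>y\<bar>) * \<bar>y\<bar>" by simp
    also have "\<dots> \<le> e * \<bar>y\<bar>" using y(2) by (intro mult_right_mono) (auto simp: field_simps)
    finally show ?thesis by simp
  qed
  moreover have "0 < d" using assms(1) e by (simp add: d_def)
  ultimately show "\<exists>d>0. \<forall>y. norm (y - 0) < d \<longrightarrow> norm (\<phi> y - \<phi> 0 - (y - 0) *\<^sub>R D) \<le> e * norm (y - 0)" by blast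
qed

lemma expansion_vector_derivative:
  fixes f :: "'a::banach \<Rightarrow> 'b::banach"
  assumes ex: "expansion P K R f x" "0 \<le> K" "0 < R" and y: "norm y * R \<le> 1/16"
  shows "((\<lambda>t. f (x + y + t *\<^sub>R h)) has_vector_derivative (\<Sum>k. deriv_coeff P h k (replicate k y))) (at 0)"
proof (rule has_vector_derivative_quadratic)
  define r where "r = 1 / (16 * R * (norm h + 1))"
  show "0 < r" using ex(3) by (simp add: r_def add_pos_nonneg add_nonneg_pos)
  fix t :: real assume t: "\<bar>t\<bar> \<le> r"
  have M: "multilinear_on UNIV k (P k)" for k using ex(1) by (simp add: expansion_def)
  have sc: "deriv_coeff P (t *\<^sub>R h) k gs = t *\<^sub>R deriv_coeff P h k gs" if "length gs = k" for k gs t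
    using deriv_coeff_lincomb[OF M that, of t h 0 h] by simp
  have small: "norm (s *\<^sub>R h) * R \<le> 1/16" if "\<bar>s\<bar> \<le> r" for s
  proof -
    have "norm (s *\<^sub>R h) * R \<le> r * (norm h + 1) * R"
      using that ex(3) by (auto intro!: mult_mono)
    also have "\<dots> = 1/16"
    proof -
      have "norm h + 1 \<noteq> 0" using norm_ge_zero[of h] by linarith
      then show ?thesis using ex(3) by (simp add: r_def)
    qed
    finally show ?thesis .
  qed
  have sh: "summable (\<lambda>k. deriv_coeff P h k (replicate k y))"
  proof -
    have "summable (\<lambda>k. r *\<^sub>R deriv_coeff P h k (replicate k y))"
      using expansion_deriv(1)[OF ex y small[of r]] \<open>0 < r\<close> by (simp add: sc)
    from summable_scaleR_right[OF this, of "1/r"] show ?thesis using \<open>0 < r\<close> by simp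
  qed
  have "norm (f (x + y + t *\<^sub>R h) - f (x + y) - (\<Sum>k. deriv_coeff P (t *\<^sub>R h) k (replicate k y))) \<le> 128 * K * R\<^sup>2 * (norm (t *\<^sub>R h))\<^sup>2"
    by (rule expansion_deriv(2)[OF ex y small[OF t]])
  also have "(\<Sum>k. deriv_coeff P (t *\<^sub>R h) k (replicate k y)) = t *\<^sub>R (\<Sum>k. deriv_coeff P h k (replicate k y))"
    using suminf_scaleR_right[OF sh] by (simp add: sc)
  finally show "norm (f (x + y + t *\<^sub>R h) - f (x + y + 0 *\<^sub>R h) - t *\<^sub>R (\<Sum>k. deriv_coeff P h k (replicate k y)))
      \<le> 128 * K * R\<^sup>2 * (norm h)\<^sup>2 * t\<^sup>2"
    by (simp add: power_mult_distrib mult.assoc mult.commute mult.left_commute)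
qed

text \<open>
  Defined by limits, hence without reference to an expansion: different expansions lead to the same
  derivatives.
\<close>
primrec iterated_derivative :: "('a::real_normed_vector \<Rightarrow> 'b::real_normed_vector) \<Rightarrow> 'a list \<Rightarrow> 'a \<Rightarrow> 'b" where
  "iterated_derivative A [] x = A x"
| "iterated_derivative A (h # vs) x = vector_derivative (\<lambda>t. iterated_derivative A vs (x + t *\<^sub>R h)) (at 0)"

text \<open>
  Each derivative multiplies the growth rate by \<open>16\<close>, which leaves room for the factor \<open>k + 1\<close> in
  \<open>deriv_coeff_bound\<close>. The constants are linear in the norms of the directions, so that the bounds are
  those of a multilinear map.
\<close>
lemma iterated_derivative_expansion:
  fixes A :: "'a::banach \<Rightarrow> 'b::banach"
  assumes "\<And>x. \<exists>P K R. 0 \<le> K \<and> 0 < R \<and> expansion P K R A x"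
  shows "\<exists>K\<ge>0. \<exists>R>0. \<forall>vs. length vs = n \<longrightarrow> (\<exists>P. expansion P (K * prod_list (map norm vs)) R (iterated_derivative A vs) x)"
proof (induction n)
  case 0
  show ?case using assms[of x] by auto
next
  case (Suc n)
  then obtain K R where K: "0 \<le> K" and R: "0 < R" and
    IH: "\<And>vs. length vs = n \<Longrightarrow> \<exists>P. expansion P (K * prod_list (map norm vs)) R (iterated_derivative A vs) x" by blast
  have "\<exists>P. expansion P (K * R * prod_list (map norm ws)) (16 * R) (iterated_derivative A ws) x"
    if "length ws = Suc n" for ws
  proof -
    obtain h vs where ws: "ws = h # vs" and vs: "length vs = n" using \<open>length ws = Suc n\<close> by (auto simp: length_Suc_conv)
    let ?K = "K * prod_list (map norm vs)"
    have K': "0 \<le> ?K" using K by (intro mult_nonneg_nonneg prod_list_nonneg_map) auto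
    obtain P where P: "expansion P ?K R (iterated_derivative A vs) x" using IH[OF vs] by blast
    have M: "multilinear_on UNIV k (P k)" and L: "\<And>gs. length gs = k \<Longrightarrow> norm (P k gs) \<le> ?K * R ^ k * prod_list (map norm gs)" for k
      by (rule expansionD[OF P]; assumption)+
    have "expansion (deriv_coeff P h) (K * R * prod_list (map norm ws)) (16 * R) (iterated_derivative A ws) x"
      unfolding expansion_def
    proof (intro conjI allI impI)
      show "multilinear_on UNIV k (deriv_coeff P h k)" for k by (rule deriv_coeff_multilinear[OF M])
      fix k and gs :: "'a list" assume gs: "length gs = k"
      have g0: "0 \<le> prod_list (map norm gs)" by (intro prod_list_nonneg_map) auto
      have "norm (deriv_coeff P h k gs) \<le> real (Suc k) * (?K * R ^ Suc k * norm h * prod_list (map norm gs))"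
        by (rule deriv_coeff_bound[OF L K' R gs])
      also have "\<dots> \<le> 16 ^ k * (?K * R ^ Suc k * norm h * prod_list (map norm gs))"
      proof (rule mult_right_mono)
        have "real (Suc k) \<le> 2 ^ k" by (rule nat_le_2_power)
        also have "\<dots> \<le> (16::real) ^ k" by (rule power_mono) auto
        finally show "real (Suc k) \<le> 16 ^ k" .
      qed (use K' R g0 in \<open>auto intro!: mult_nonneg_nonneg\<close>)
      finally show "norm (deriv_coeff P h k gs) \<le> K * R * prod_list (map norm ws) * (16 * R) ^ k * prod_list (map norm gs)"
        by (simp add: ws power_mult_distrib ac_simps)
    next
      fix y :: 'a assume y: "norm y * (16 * R) < 1"
      then have y': "norm y * R \<le> 1/16" by simp
      have "iterated_derivative A ws (x + y) = (\<Sum>k. deriv_coeff P h k (replicate k y))"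
        unfolding ws using vector_derivative_at[OF expansion_vector_derivative[OF P K' R y', of h]] by simp
      moreover have "summable (\<lambda>k. deriv_coeff P h k (replicate k y))"
      proof -
        define c where "c = 1 / (16 * R * (norm h + 1))"
        have h1: "0 < norm h + 1" using norm_ge_zero[of h] by linarith
        have c: "0 < c" using R h1 by (simp add: c_def)
        have "norm (c *\<^sub>R h) * R \<le> c * (norm h + 1) * R" using c R by (auto intro!: mult_mono)
        also have "\<dots> = 1/16" using R h1 by (simp add: c_def)
        finally have "summable (\<lambda>k. deriv_coeff P (c *\<^sub>R h) k (replicate k y))"
          by (rule expansion_deriv(1)[OF P K' R y'])
        moreover have "deriv_coeff P (c *\<^sub>R h) k (replicate k y) = c *\<^sub>R deriv_coeff P h k (replicate k y)" for k
          using deriv_coeff_lincomb[OF M, of "replicate k y" k c h 0 h] by simp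
        ultimately have "summable (\<lambda>k. c *\<^sub>R deriv_coeff P h k (replicate k y))" by simp
        from summable_scaleR_right[OF this, of "1/c"] show ?thesis using c by simp
      qed
      ultimately show "(\<lambda>k. deriv_coeff P h k (replicate k y)) sums iterated_derivative A ws (x + y)"
        by (simp add: summable_sums)
    qed
    then show ?thesis by blast
  qed
  then show ?case using K R by (intro exI[of _ "K * R"] conjI exI[of _ "16 * R"]) auto
qed

lemma expansion_at_center:
  assumes "expansion P K R f x" shows "f x = P 0 []"
proof -
  have s: "(\<lambda>k. P k (replicate k 0)) sums f x" using assms[unfolded expansion_def, THEN conjunct2, THEN conjunct2, rule_format, of 0] by simp
  have "P k (replicate k 0) = 0" if "k \<noteq> 0" for k
    using assms[unfolded expansion_def, THEN conjunct2, THEN conjunct1, rule_format, of "replicate k 0" k] that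
    by (simp add: prod_list_replicate power_0_left)
  then have "(\<lambda>k. P k (replicate k 0)) sums (\<Sum>k\<in>{0}. P k (replicate k 0))"
    by (intro sums_finite) auto
  with s show ?thesis using sums_unique2 by fastforce
qed

text \<open>
  The \<open>n\<close>-th derivative at \<open>x\<close> is \<open>iterated_derivative A\<close> on lists of length \<open>n\<close>. It is linear in the outermost
  direction because the coefficients of its expansion are, and in the others because
  differentiation is linear. The remainder in \<open>expansion_deriv\<close> at the center is quadratic in the
  increment, uniformly in the other directions.
\<close>
lemma analytic_from_expansions:
  fixes A :: "'a::banach \<Rightarrow> 'b::banach"
  assumes ex: "\<And>x. \<exists>P K R. 0 \<le> K \<and> 0 < R \<and> expansion P K R A x"
  shows "real_analytic A"
  unfolding real_analytic_def
proof
  let ?D = "iterated_derivative A"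
  have E: "\<exists>K\<ge>0. \<exists>R>0. \<forall>vs. length vs = n \<longrightarrow> (\<exists>P. expansion P (K * prod_list (map norm vs)) R (?D vs) x)" for n x
    by (rule iterated_derivative_expansion[OF ex])
  have E1: "\<exists>P K R. 0 \<le> K \<and> 0 < R \<and> expansion P K R (?D vs) x" for vs x
  proof -
    obtain K R P where "0 \<le> K" "0 < R" "expansion P (K * prod_list (map norm vs)) R (?D vs) x"
      using E[of "length vs" x] by blast
    moreover have "0 \<le> K * prod_list (map norm vs)" using \<open>0 \<le> K\<close> by (intro mult_nonneg_nonneg prod_list_nonneg_map) auto
    ultimately show ?thesis by blast
  qed
  have deriv: "((\<lambda>t. ?D vs (x + t *\<^sub>R h)) has_vector_derivative ?D (h # vs) x) (at 0)" for vs x h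
  proof -
    obtain P K R where P: "0 \<le> K" "0 < R" "expansion P K R (?D vs) x" using E1 by blast
    show ?thesis using expansion_vector_derivative[OF P(3,1,2), of 0 h] vector_derivative_at by fastforce
  qed
  have lin: "?D (xs @ (a *\<^sub>R x + b *\<^sub>R y) # ys) z = a *\<^sub>R ?D (xs @ x # ys) z + b *\<^sub>R ?D (xs @ y # ys) z" for xs ys x y z a b
  proof (induction xs arbitrary: z)
    case Nil
    obtain P K R where P: "0 \<le> K" "0 < R" "expansion P K R (?D ys) z" using E1 by blast
    have d: "?D (h # ys) z = deriv_coeff P h 0 []" for h
    proof -
      have "(\<Sum>k. deriv_coeff P h k (replicate k 0)) = (\<Sum>k\<in>{0}. deriv_coeff P h k (replicate k 0))"
      proof (rule suminf_finite)
        fix k assume "k \<notin> {0::nat}"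
        then show "deriv_coeff P h k (replicate k 0) = 0"
          using deriv_coeff_bound[OF expansionD(2)[OF P(3)] P(1,2), of "replicate k 0" k h] by (simp add: prod_list_replicate power_0_left)
      qed simp
      then show ?thesis
        using vector_derivative_at[OF expansion_vector_derivative[OF P(3,1,2), of 0 h]] P by simp
    qed
    show ?case unfolding append_Nil d
      using P(3) by (intro deriv_coeff_lincomb) (auto simp: expansion_def)
  next
    case (Cons h xs)
    have "((\<lambda>t. a *\<^sub>R ?D (xs @ x # ys) (z + t *\<^sub>R h) + b *\<^sub>R ?D (xs @ y # ys) (z + t *\<^sub>R h)) has_vector_derivative
        a *\<^sub>R ?D (h # xs @ x # ys) z + b *\<^sub>R ?D (h # xs @ y # ys) z) (at 0)"
      by (intro has_vector_derivative_add deriv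
        bounded_linear.has_vector_derivative[OF bounded_linear_scaleR_right])
    then show ?case using Cons.IH vector_derivative_at by simp
  qed
  show "infinitely_frechet_differentiable A"
    unfolding infinitely_frechet_differentiable_def
  proof (intro exI[of _ "\<lambda>n x vs. ?D vs x"] conjI allI impI)
    show "?D [] x = A x" for x by simp
    show "bounded_multilinear n (\<lambda>vs. ?D vs x)" for n x
      unfolding bounded_multilinear_def
    proof
      show "multilinear_on UNIV n (\<lambda>vs. ?D vs x)" unfolding multilinear_on_def using lin by simp
      obtain K R where K: "0 \<le> K" "0 < R" and KR: "\<And>vs. length vs = n \<Longrightarrow> \<exists>P. expansion P (K * prod_list (map norm vs)) R (?D vs) x"
        using E[of n x] by blast
      have "norm (?D vs x) \<le> K * prod_list (map norm vs)" if "length vs = n" for vs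
      proof -
        obtain P where P: "expansion P (K * prod_list (map norm vs)) R (?D vs) x" using KR[OF \<open>length vs = n\<close>] by blast
        show ?thesis using expansion_at_center[OF P] P[unfolded expansion_def, THEN conjunct2, THEN conjunct1, rule_format, of "[]" 0] by simp
      qed
      then show "\<exists>K. \<forall>vs. length vs = n \<longrightarrow> norm (?D vs x) \<le> K * prod_list (map norm vs)" by blast
    qed
    fix n x and e :: real assume e: "0 < e"
    obtain K R where K: "0 \<le> K" "0 < R" and KR: "\<And>vs. length vs = n \<Longrightarrow> \<exists>P. expansion P (K * prod_list (map norm vs)) R (?D vs) x"
      using E[of n x] by blast
    define c where "c = 128 * K * R\<^sup>2 + 1"
    have c: "0 < c" using K by (simp add: c_def add_nonneg_pos)
    define d where "d = min (1 / (16 * R)) (e / c)"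
    have "norm (?D vs (x + h) - ?D vs x - ?D (h # vs) x) \<le> e * norm h * prod_list (map norm vs)"
      if h: "norm h < d" and vs: "length vs = n" for h vs
    proof -
      let ?\<pi> = "prod_list (map norm vs)"
      have p0: "0 \<le> ?\<pi>" by (intro prod_list_nonneg_map) auto
      have K': "0 \<le> K * ?\<pi>" using K p0 by simp
      obtain P where P: "expansion P (K * ?\<pi>) R (?D vs) x" using KR[OF vs] by blast
      have hR: "norm h * R \<le> 1/16" using h K(2) by (simp add: d_def field_simps)
      have hc: "c * norm h \<le> e" using h c by (simp add: d_def field_simps)
      have "?D (h # vs) x = (\<Sum>k. deriv_coeff P h k (replicate k 0))"
        using vector_derivative_at[OF expansion_vector_derivative[OF P K' K(2), of 0 h]] by simp
      then have "norm (?D vs (x + h) - ?D vs x - ?D (h # vs) x) \<le> 128 * (K * ?\<pi>) * R\<^sup>2 * (norm h)\<^sup>2"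
        using expansion_deriv(2)[OF P K' K(2) _ hR, of 0] by simp
      also have "\<dots> = (128 * K * R\<^sup>2 * norm h) * (norm h * ?\<pi>)" by (simp add: power2_eq_square)
      also have "\<dots> \<le> e * (norm h * ?\<pi>)"
      proof (rule mult_right_mono)
        have "128 * K * R\<^sup>2 * norm h \<le> c * norm h" by (intro mult_right_mono) (auto simp: c_def)
        then show "128 * K * R\<^sup>2 * norm h \<le> e" using hc by linarith
      qed (use p0 in simp)
      finally show ?thesis by (simp add: mult.assoc)
    qed
    moreover have "0 < d" using K(2) e c by (simp add: d_def)
    ultimately show "\<exists>d>0. \<forall>h. norm h < d \<longrightarrow> (\<forall>vs. length vs = n \<longrightarrow>
        norm (?D vs (x + h) - ?D vs x - ?D (h # vs) x) \<le> e * norm h * prod_list (map norm vs))" by blast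
  qed
  show "locally_norm_convergent_series A"
    unfolding locally_norm_convergent_series_def
  proof
    fix f :: 'a
    obtain P K R where P: "0 \<le> K" "0 < R" "expansion P K R A f" using ex by blast
    have L: "\<And>k gs. length gs = k \<Longrightarrow> norm (P k gs) \<le> K * R ^ k * prod_list (map norm gs)"
      and S: "\<And>y. norm y * R < 1 \<Longrightarrow> (\<lambda>k. P k (replicate k y)) sums A (f + y)"
      and M: "\<And>k. multilinear_on UNIV k (P k)"
      by (rule expansionD[OF P(3)]; assumption)+
    show "\<exists>\<epsilon>\<^sub>0>0. \<forall>g. norm g \<le> 1 \<longrightarrow> (\<exists>v. \<forall>\<epsilon>::real. 0 < \<epsilon> \<and> \<epsilon> \<le> \<epsilon>\<^sub>0 \<longrightarrow>
       summable (\<lambda>j. \<epsilon> ^ j * norm (v j)) \<and> A (f + \<epsilon> *\<^sub>R g) = A f + \<epsilon> *\<^sub>R (\<Sum>j. \<epsilon> ^ j *\<^sub>R v j))"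
    proof (intro exI[of _ "1 / (2 * R)"] conjI allI impI)
      show "0 < 1 / (2 * R)" using P(2) by simp
      fix g :: 'a assume g: "norm g \<le> 1"
      define v where "v j = P (Suc j) (replicate (Suc j) g)" for j
      show "\<exists>v. \<forall>\<epsilon>::real. 0 < \<epsilon> \<and> \<epsilon> \<le> 1 / (2 * R) \<longrightarrow>
         summable (\<lambda>j. \<epsilon> ^ j * norm (v j)) \<and> A (f + \<epsilon> *\<^sub>R g) = A f + \<epsilon> *\<^sub>R (\<Sum>j. \<epsilon> ^ j *\<^sub>R v j)"
      proof (intro exI[of _ v] allI impI)
        fix \<epsilon> :: real assume "0 < \<epsilon> \<and> \<epsilon> \<le> 1 / (2 * R)"
        then have \<epsilon>: "0 < \<epsilon>" "\<epsilon> * R \<le> 1/2" using P(2) by (auto simp: field_simps)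
        have vb: "\<epsilon> ^ j * norm (v j) \<le> (K * R) * (1/2) ^ j" for j
        proof -
          have "norm (v j) \<le> K * R ^ Suc j * norm g ^ Suc j"
            using L[of "replicate (Suc j) g" "Suc j"] by (simp only: v_def map_replicate prod_list_replicate length_replicate)
          also have "\<dots> \<le> K * R ^ Suc j * 1"
            using g P by (intro mult_left_mono power_le_one) auto
          finally have "\<epsilon> ^ j * norm (v j) \<le> \<epsilon> ^ j * (K * R ^ Suc j)"
            using \<epsilon> by (intro mult_left_mono) auto
          also have "\<dots> = (K * R) * (\<epsilon> * R) ^ j" by (simp add: power_mult_distrib)
          also have "\<dots> \<le> (K * R) * (1/2) ^ j" using \<epsilon> P by (intro mult_left_mono power_mono) auto
          finally show ?thesis .
        qed
        have sv: "summable (\<lambda>j. \<epsilon> ^ j * norm (v j))"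
          by (rule summable_comparison_test'[OF summable_mult[OF summable_geometric[of "1/2::real"]], of 0 _ "K * R"])
            (use vb \<epsilon> in auto)
        have sn: "summable (\<lambda>j. \<epsilon> ^ j *\<^sub>R v j)"
          by (rule summable_norm_cancel) (use sv \<epsilon> in simp)
        have hom: "P k (replicate k (\<epsilon> *\<^sub>R g)) = \<epsilon> ^ k *\<^sub>R P k (replicate k g)" for k
        proof -
          have "P k (replicate i (\<epsilon> *\<^sub>R g) @ replicate (k - i) g) = \<epsilon> ^ i *\<^sub>R P k (replicate k g)" if "i \<le> k" for i
            using that
          proof (induction i)
            case (Suc i)
            have "replicate (Suc i) (\<epsilon> *\<^sub>R g) @ replicate (k - Suc i) g = replicate i (\<epsilon> *\<^sub>R g) @ (\<epsilon> *\<^sub>R g + 0 *\<^sub>R g) # replicate (k - Suc i) g"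
              by (simp add: replicate_app_Cons_same)
            also have "P k \<dots> = \<epsilon> *\<^sub>R P k (replicate i (\<epsilon> *\<^sub>R g) @ g # replicate (k - Suc i) g) + 0 *\<^sub>R P k (replicate i (\<epsilon> *\<^sub>R g) @ g # replicate (k - Suc i) g)"
              by (rule multilinear_slot[OF M]) (use Suc.prems in simp)
            also have "replicate i (\<epsilon> *\<^sub>R g) @ g # replicate (k - Suc i) g = replicate i (\<epsilon> *\<^sub>R g) @ replicate (k - i) g"
              using Suc.prems by (simp add: Suc_diff_Suc flip: replicate_Suc)
            finally show ?case using Suc by simp
          qed simp
          from this[of k] show ?thesis by simp
        qed
        have "norm (\<epsilon> *\<^sub>R g) * R \<le> \<epsilon> * 1 * R" using \<epsilon> g P by (auto intro!: mult_mono)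
        then have "(\<lambda>k. P k (replicate k (\<epsilon> *\<^sub>R g))) sums A (f + \<epsilon> *\<^sub>R g)" using \<epsilon> by (intro S) linarith
        then have A: "(\<lambda>k. \<epsilon> ^ k *\<^sub>R P k (replicate k g)) sums A (f + \<epsilon> *\<^sub>R g)" by (simp only: hom)
        have "A (f + \<epsilon> *\<^sub>R g) = (\<Sum>k. \<epsilon> ^ Suc k *\<^sub>R P (Suc k) (replicate (Suc k) g)) + P 0 []"
          using suminf_split_head[OF sums_summable[OF A]] sums_unique[OF A] by simp
        also have "(\<Sum>k. \<epsilon> ^ Suc k *\<^sub>R P (Suc k) (replicate (Suc k) g)) = \<epsilon> *\<^sub>R (\<Sum>j. \<epsilon> ^ j *\<^sub>R v j)"
          using suminf_scaleR_right[OF sn, of \<epsilon>] by (simp add: v_def)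
        also have "P 0 [] = A f" using expansion_at_center[OF P(3)] by simp
        finally show "summable (\<lambda>j. \<epsilon> ^ j * norm (v j)) \<and> A (f + \<epsilon> *\<^sub>R g) = A f + \<epsilon> *\<^sub>R (\<Sum>j. \<epsilon> ^ j *\<^sub>R v j)"
          using sv by simp
      qed
    qed
  qed
qed

section \<open>The scattering operator\<close>

context linearization
begin

lemma perturbation_series:
  obtains r where "0 < r" "\<And>g. norm g \<le> r \<Longrightarrow> summable (\<lambda>k. nF (corrector g k))"
    "\<And>g g\<^sub>0. norm g \<le> r \<Longrightarrow> solves E g\<^sub>0 ubar \<Longrightarrow> solves E (g\<^sub>0 + g) (\<lambda>t. ubar t + (\<Sum>k. corrector g k t))"
    "\<And>g v a. norm g \<le> r \<Longrightarrow> scatters_to E ubar v \<Longrightarrow> (\<And>k. scatters_to E (corrector g k) (a k)) \<Longrightarrow>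
       summable (\<lambda>k. norm (a k)) \<and> scatters_to E (\<lambda>t. ubar t + (\<Sum>k. corrector g k t)) (v + (\<Sum>k. a k))"
proof -
  obtain r where r: "0 < r" "\<And>g. norm g \<le> r \<Longrightarrow> summable (\<lambda>k. nF (corrector g k))"
    "\<And>g g\<^sub>0. norm g \<le> r \<Longrightarrow> solves E g\<^sub>0 ubar \<Longrightarrow> solves E (g\<^sub>0 + g) (\<lambda>t. ubar t + (\<Sum>k. corrector g k t))"
    by (rule series_solution) blast
  show ?thesis
  proof (rule that[OF r])
    fix g :: 'd and v a
    assume g: "norm g \<le> r" and v: "scatters_to E ubar v" and a: "\<And>k. scatters_to E (corrector g k) (a k)"
    note s = scatters_suminf[OF corrector_in_F r(2)[OF g] a]
    show "summable (\<lambda>k. norm (a k)) \<and> scatters_to E (\<lambda>t. ubar t + (\<Sum>k. corrector g k t)) (v + (\<Sum>k. a k))"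
      using s(1) scatters_add[OF v s(2)] by blast
  qed
qed

text \<open>
  Near \<open>g\<^sub>0\<close> the solution is the perturbation series around \<open>ubar\<close>. Its asymptotic state is the sum of
  the asymptotic states of the terms, which are bounded multilinear maps of the increment.
\<close>
lemma scattering_expansion:
  assumes sol: "solves E g\<^sub>0 ubar"
    and S: "\<And>g u. solves E g u \<Longrightarrow> scatters_to E u (S g)"
  shows "\<exists>P K R. 0 \<le> K \<and> 0 < R \<and> expansion P K R S g\<^sub>0"
proof -
  obtain r where r: "0 < r"
    and ser: "\<And>g g\<^sub>0. norm g \<le> r \<Longrightarrow> solves E g\<^sub>0 ubar \<Longrightarrow> solves E (g\<^sub>0 + g) (\<lambda>t. ubar t + (\<Sum>k. corrector g k t))"
    and sc: "\<And>g v a. norm g \<le> r \<Longrightarrow> scatters_to E ubar v \<Longrightarrow> (\<And>k. scatters_to E (corrector g k) (a k)) \<Longrightarrow>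
       summable (\<lambda>k. norm (a k)) \<and> scatters_to E (\<lambda>t. ubar t + (\<Sum>k. corrector g k t)) (v + (\<Sum>k. a k))"
    by (rule perturbation_series) blast
  obtain b x \<beta> where b: "\<And>m. 0 \<le> b m" and x: "0 < x" "x \<le> 1" and \<beta>: "\<And>n::nat. (\<Sum>m\<le>n. b m * x ^ m) \<le> \<beta>"
    and cb: "\<And>m gs. length gs = Suc m \<Longrightarrow> nF (cascade m gs) \<le> b m * prod_list (map norm gs)"
    by (rule cascade_bound) blast
  obtain M where M: "0 \<le> M" "\<And>u v. u \<in> F \<Longrightarrow> scatters_to E u v \<Longrightarrow> norm v \<le> M * nF u"
    by (rule scatters_bound) blast
  have bx: "0 \<le> b m * x ^ m" for m using b x by simp
  have b\<beta>: "b m * x ^ m \<le> \<beta>" for m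
    using member_le_sum[of m "{..m}" "\<lambda>m. b m * x ^ m"] bx \<beta>[of m] by (auto intro: order_trans)
  have \<beta>0: "0 \<le> \<beta>" using bx[of 0] b\<beta>[of 0] by linarith
  \<comment> \<open>The coefficients grow at most like \<open>(1 / x)\<^sup>k\<close>, and the series represents \<open>S\<close> within distance \<open>r\<close>.\<close>
  define R where "R = max (1 / x) (1 / r)"
  have R: "0 < R" "1 \<le> R" "1 / x \<le> R" "1 / r \<le> R" using x r by (auto simp: R_def le_max_iff_disj less_max_iff_disj)
  have bR: "b m \<le> \<beta> * R ^ m" for m
  proof -
    have "b m = b m * x ^ m * (1 / x) ^ m" using x by (simp add: power_divide)
    also have "\<dots> \<le> \<beta> * R ^ m" using b\<beta> bx R x \<beta>0 by (intro mult_mono power_mono) auto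
    finally show ?thesis .
  qed
  define Q where "Q k gs = (SOME v. scatters_to E (cascade k gs) v)" for k gs
  have Q: "scatters_to E (cascade k gs) (Q k gs)" if "length gs = Suc k" for k gs
    unfolding Q_def using someI_ex[OF cascade_scatters[OF that]] .
  define P where "P k gs = (if k = 0 then S g\<^sub>0 else Q (k - 1) gs)" for k gs
  define K where "K = max (norm (S g\<^sub>0)) (M * \<beta>)"
  have K: "0 \<le> K" "norm (S g\<^sub>0) \<le> K" "M * \<beta> \<le> K" by (auto simp: K_def intro: le_max_iff_disj[THEN iffD2])
  have "expansion P K R S g\<^sub>0"
    unfolding expansion_def
  proof (intro conjI allI impI)
    show "multilinear_on UNIV k (P k)" for k
      unfolding multilinear_on_def
    proof (intro allI impI ballI)
      fix xs ys :: "'d list" and y z a c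
      assume "length xs + 1 + length ys = k \<and> set xs \<subseteq> UNIV \<and> set ys \<subseteq> UNIV"
      then have len: "length xs + 1 + length ys = k" by simp
      define m where "m = k - 1"
      have k: "k = Suc m" using len by (simp add: m_def)
      have e: "cascade m (xs @ (a *\<^sub>R y + c *\<^sub>R z) # ys) = (\<lambda>t. a *\<^sub>R cascade m (xs @ y # ys) t + c *\<^sub>R cascade m (xs @ z # ys) t)"
        using cascade_multilinear[of m, unfolded multilinear_D_def, THEN conjunct2, rule_format] len k by auto
      have l: "length (xs @ w # ys) = Suc m" for w using len k by simp
      have "Q m (xs @ (a *\<^sub>R y + c *\<^sub>R z) # ys) = a *\<^sub>R Q m (xs @ y # ys) + c *\<^sub>R Q m (xs @ z # ys)"
        using Q[OF l, of "a *\<^sub>R y + c *\<^sub>R z"] scatters_lincomb[OF Q[OF l] Q[OF l], of a y c z]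
        unfolding e by (rule scatters_unique)
      then show "P k (xs @ (a *\<^sub>R y + c *\<^sub>R z) # ys) = a *\<^sub>R P k (xs @ y # ys) + c *\<^sub>R P k (xs @ z # ys)"
        by (simp add: P_def k)
    qed
    fix k and gs :: "'d list" assume len: "length gs = k"
    show "norm (P k gs) \<le> K * R ^ k * prod_list (map norm gs)"
    proof (cases k)
      case 0 then show ?thesis using K len by (simp add: P_def)
    next
      case (Suc m)
      have p0: "0 \<le> prod_list (map norm gs)" by (intro prod_list_nonneg_map) auto
      have l: "length gs = Suc m" using len Suc by simp
      have "norm (Q m gs) \<le> M * nF (cascade m gs)" by (rule M(2)[OF cascade_in_F[OF l] Q[OF l]])
      also have "\<dots> \<le> M * (\<beta> * R ^ m * prod_list (map norm gs))"
        using M(1) bR[of m] p0 by (intro mult_left_mono order_trans[OF cb[OF l]] mult_right_mono)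
      also have "\<dots> = (M * \<beta>) * (R ^ m * prod_list (map norm gs))" by simp
      also have "\<dots> \<le> K * (R ^ Suc m * prod_list (map norm gs))"
        using K M(1) \<beta>0 R p0 by (intro mult_mono mult_right_mono power_increasing) auto
      finally show ?thesis using Suc by (simp add: P_def mult.assoc)
    qed
  next
    fix y :: 'd assume "norm y * R < 1"
    moreover have "norm y * (1 / r) \<le> norm y * R" using R by (intro mult_left_mono) auto
    ultimately have "norm y * (1 / r) < 1" by linarith
    then have y: "norm y \<le> r" using r by (simp add: field_simps)
    have c: "scatters_to E (corrector y k) (P (Suc k) (replicate (Suc k) y))" for k
      using Q[of "replicate (Suc k) y" k] by (simp add: P_def corrector_def)
    have s: "summable (\<lambda>k. norm (P (Suc k) (replicate (Suc k) y)))"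
      and l: "scatters_to E (\<lambda>t. ubar t + (\<Sum>k. corrector y k t)) (S g\<^sub>0 + (\<Sum>k. P (Suc k) (replicate (Suc k) y)))"
      using sc[OF y S[OF sol] c] by blast+
    have "S (g\<^sub>0 + y) = (\<Sum>k. P (Suc k) (replicate (Suc k) y)) + P 0 []"
      using scatters_unique[OF S[OF ser[OF y sol]] l] by (simp add: P_def)
    moreover have "(\<lambda>k. P (Suc k) (replicate (Suc k) y)) sums (\<Sum>k. P (Suc k) (replicate (Suc k) y))"
      by (rule summable_sums[OF summable_norm_cancel[OF s]])
    ultimately show "(\<lambda>k. P k (replicate k y)) sums S (g\<^sub>0 + y)"
      using sums_Suc[of "\<lambda>k. P k (replicate k y)"] by simp
  qed
  then show ?thesis using K R by blast
qed

end

text \<open>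
  Every datum has its own solution \<open>u\<close> to expand around. As solutions are unique, the asymptotic states
  found in the expansions are the values of one operator.
\<close>
lemma (in evolution_problem) scattering_operator_analytic:
  assumes "\<And>g. \<exists>u. solves E g u"
  shows "\<exists>S. is_scattering_operator E S \<and> real_analytic S"
proof -
  define S where "S g = (SOME v. \<exists>u. solves E g u \<and> scatters_to E u v)" for g
  have S: "scatters_to E u (S g)" if sol: "solves E g u" for g u
  proof -
    have "\<exists>v. \<exists>u. solves E g u \<and> scatters_to E u v" using sol solution_scatters[OF sol] by blast
    then have "\<exists>u. solves E g u \<and> scatters_to E u (S g)" unfolding S_def by (rule someI_ex)
    then show ?thesis using solution_unique[OF sol] by blast
  qed
  have "\<exists>P K R. 0 \<le> K \<and> 0 < R \<and> expansion P K R S g" for g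
  proof -
    obtain u where u: "solves E g u" using assms by blast
    interpret linearization E u
      by unfold_locales (use u in \<open>simp add: solves_def\<close>)
    show ?thesis by (rule scattering_expansion[OF u S])
  qed
  then have "real_analytic S" by (rule analytic_from_expansions)
  then show ?thesis using S unfolding is_scattering_operator_def by blast
qed

theorem lemma2p9:
  fixes E :: "('d::banach, 'x::banach, 'y::banach, 'z::banach) evolution"
    and ubar :: "real \<Rightarrow> 'd" and ubar\<^sub>0 u\<^sub>0 :: 'd
  assumes "evolution_setting E" and "H1 E" and "H2 E" and "group_uniformly_bounded E"
    and "solves E ubar\<^sub>0 ubar"
  shows "(\<exists>!w. is_cascade E ubar u\<^sub>0 w) \<and>
    (\<exists>ubar_plus. scatters_to E ubar ubar_plus \<and>
      (\<forall>w. is_cascade E ubar u\<^sub>0 w \<longrightarrow>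
        (\<exists>w_plus. (\<forall>k. scatters_to E (w k) (w_plus k)) \<and>
          (\<exists>\<epsilon>\<^sub>0>0. \<forall>\<epsilon>::real. 0 < \<epsilon> \<and> \<epsilon> \<le> \<epsilon>\<^sub>0 \<longrightarrow>
            summable (\<lambda>k. norm (\<epsilon> ^ k *\<^sub>R w_plus k)) \<and>
            summable (\<lambda>k. \<epsilon> ^ k * F_norm E UNIV (w k)) \<and>
            (let u_eps = (\<lambda>t. ubar t + \<epsilon> *\<^sub>R (\<Sum>k. \<epsilon> ^ k *\<^sub>R w k t)) in
               solves E (ubar\<^sub>0 + \<epsilon> *\<^sub>R u\<^sub>0) u_eps \<and>
               (\<forall>v. solves E (ubar\<^sub>0 + \<epsilon> *\<^sub>R u\<^sub>0) v \<longrightarrow> v = u_eps) \<and>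
               scatters_to E u_eps (ubar_plus + \<epsilon> *\<^sub>R (\<Sum>k. \<epsilon> ^ k *\<^sub>R w_plus k))))))) \<and>
    (init_time E = -\<infinity> \<and> (\<forall>g. \<exists>u. solves E g u) \<longrightarrow>
      (\<exists>S. is_scattering_operator E S \<and> real_analytic S))"
proof -
  interpret evolution_problem E
    by unfold_locales (fact assms)+
  interpret linearization E ubar
    by unfold_locales (use assms(5) in \<open>simp add: solves_def\<close>)
  obtain ubar_plus where plus: "scatters_to E ubar ubar_plus"
    using solution_scatters[OF assms(5)] by blast
  obtain r where r: "0 < r" "\<And>g. norm g \<le> r \<Longrightarrow> summable (\<lambda>k. F_norm E UNIV (corrector g k))"
    and sol: "\<And>g g\<^sub>0. norm g \<le> r \<Longrightarrow> solves E g\<^sub>0 ubar \<Longrightarrow> solves E (g\<^sub>0 + g) (\<lambda>t. ubar t + (\<Sum>k. corrector g k t))"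
    and sc: "\<And>g v a. norm g \<le> r \<Longrightarrow> scatters_to E ubar v \<Longrightarrow> (\<And>k. scatters_to E (corrector g k) (a k)) \<Longrightarrow>
       summable (\<lambda>k. norm (a k)) \<and> scatters_to E (\<lambda>t. ubar t + (\<Sum>k. corrector g k t)) (v + (\<Sum>k. a k))"
    by (rule perturbation_series) blast
  define w where "w = corrector u\<^sub>0"
  define w_plus where "w_plus k = (SOME v. scatters_to E (w k) v)" for k
  have wp: "scatters_to E (w k) (w_plus k)" for k
    unfolding w_plus_def w_def corrector_def by (rule someI_ex, rule cascade_scatters) simp
  have wF: "w k \<in> F_space E" for k unfolding w_def by (rule corrector_in_F)
  define \<epsilon>\<^sub>0 where "\<epsilon>\<^sub>0 = r / (norm u\<^sub>0 + 1)"
  have n1: "0 < norm u\<^sub>0 + 1" using norm_ge_zero[of u\<^sub>0] by linarith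
  have "summable (\<lambda>k. norm (\<epsilon> ^ k *\<^sub>R w_plus k)) \<and>
        summable (\<lambda>k. \<epsilon> ^ k * F_norm E UNIV (w k)) \<and>
        (let u_eps = (\<lambda>t. ubar t + \<epsilon> *\<^sub>R (\<Sum>k. \<epsilon> ^ k *\<^sub>R w k t)) in
           solves E (ubar\<^sub>0 + \<epsilon> *\<^sub>R u\<^sub>0) u_eps \<and>
           (\<forall>v. solves E (ubar\<^sub>0 + \<epsilon> *\<^sub>R u\<^sub>0) v \<longrightarrow> v = u_eps) \<and>
           scatters_to E u_eps (ubar_plus + \<epsilon> *\<^sub>R (\<Sum>k. \<epsilon> ^ k *\<^sub>R w_plus k)))"
    if \<epsilon>: "0 < \<epsilon>" "\<epsilon> \<le> \<epsilon>\<^sub>0" for \<epsilon>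
  proof -
    have "norm (\<epsilon> *\<^sub>R u\<^sub>0) \<le> \<epsilon> * (norm u\<^sub>0 + 1)" using \<epsilon>(1) by simp
    also have "\<dots> \<le> r" using \<epsilon>(2) n1 by (simp add: \<epsilon>\<^sub>0_def field_simps)
    finally have g: "norm (\<epsilon> *\<^sub>R u\<^sub>0) \<le> r" .
    \<comment> \<open>The corrector with index \<open>k\<close> is homogeneous of degree \<open>k + 1\<close> in the datum; one power of \<open>\<epsilon>\<close> stays in front of the series.\<close>
    have ck: "corrector (\<epsilon> *\<^sub>R u\<^sub>0) k = (\<lambda>t. \<epsilon> ^ Suc k *\<^sub>R w k t)" for k
      unfolding w_def by (rule ext) (rule corrector_scaled)
    have a: "scatters_to E (corrector (\<epsilon> *\<^sub>R u\<^sub>0) k) (\<epsilon> ^ Suc k *\<^sub>R w_plus k)" for k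
      unfolding ck using scatters_lincomb[OF wp[of k] wp[of k], of "\<epsilon> ^ Suc k" 0] by simp
    note sca = sc[OF g plus a]
    have s1: "summable (\<lambda>k. norm (\<epsilon> ^ k *\<^sub>R w_plus k))"
    proof -
      have "summable (\<lambda>k. (1 / \<epsilon>) * norm (\<epsilon> ^ Suc k *\<^sub>R w_plus k))" using sca by (intro summable_mult) blast
      then show ?thesis using \<epsilon>(1) by simp
    qed
    have s2: "summable (\<lambda>k. \<epsilon> ^ k * F_norm E UNIV (w k))"
    proof (rule summable_comparison_test'[OF summable_mult[OF r(2)[OF g], of "1 / \<epsilon>"], of 0])
      fix k
      have "F_norm E UNIV (w k) = F_norm E UNIV (\<lambda>t. (1 / \<epsilon> ^ Suc k) *\<^sub>R (\<epsilon> ^ Suc k *\<^sub>R w k t))"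
        using \<epsilon>(1) by simp
      also have "\<dots> \<le> \<bar>1 / \<epsilon> ^ Suc k\<bar> * F_norm E UNIV (corrector (\<epsilon> *\<^sub>R u\<^sub>0) k)"
        unfolding ck[symmetric]
        using F_scaleR(2)[OF corrector_in_F[of "\<epsilon> *\<^sub>R u\<^sub>0" k], of "1 / \<epsilon> ^ Suc k"] by (simp only: ck)
      finally have "\<epsilon> ^ k * F_norm E UNIV (w k) \<le> \<epsilon> ^ k * (\<bar>1 / \<epsilon> ^ Suc k\<bar> * F_norm E UNIV (corrector (\<epsilon> *\<^sub>R u\<^sub>0) k))"
        using \<epsilon>(1) by (intro mult_left_mono) auto
      then show "norm (\<epsilon> ^ k * F_norm E UNIV (w k)) \<le> 1 / \<epsilon> * F_norm E UNIV (corrector (\<epsilon> *\<^sub>R u\<^sub>0) k)"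
        using \<epsilon>(1) nF_nonneg[OF wF[of k]] by simp
    qed
    have scale: "(\<Sum>k. \<epsilon> ^ Suc k *\<^sub>R f k) = \<epsilon> *\<^sub>R (\<Sum>k. \<epsilon> ^ k *\<^sub>R f k)" if "summable (\<lambda>k. \<epsilon> ^ k *\<^sub>R f k)" for f :: "nat \<Rightarrow> 'd"
      using suminf_scaleR_right[OF that, of \<epsilon>] by simp
    have sw: "summable (\<lambda>k. \<epsilon> ^ k *\<^sub>R w k t)" for t
    proof (rule summable_norm_cancel, rule summable_comparison_test'[OF s2, of 0])
      show "norm (norm (\<epsilon> ^ k *\<^sub>R w k t)) \<le> \<epsilon> ^ k * F_norm E UNIV (w k)" for k
        using \<epsilon>(1) norm_le_nF[OF wF] by (simp add: mult_left_mono)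
    qed
    have ue: "(\<lambda>t. ubar t + (\<Sum>k. corrector (\<epsilon> *\<^sub>R u\<^sub>0) k t)) = (\<lambda>t. ubar t + \<epsilon> *\<^sub>R (\<Sum>k. \<epsilon> ^ k *\<^sub>R w k t))"
      unfolding ck scale[OF sw] ..
    have sp: "(\<Sum>k. \<epsilon> ^ Suc k *\<^sub>R w_plus k) = \<epsilon> *\<^sub>R (\<Sum>k. \<epsilon> ^ k *\<^sub>R w_plus k)"
      by (rule scale[OF summable_norm_cancel[OF s1]])
    have sl: "solves E (ubar\<^sub>0 + \<epsilon> *\<^sub>R u\<^sub>0) (\<lambda>t. ubar t + \<epsilon> *\<^sub>R (\<Sum>k. \<epsilon> ^ k *\<^sub>R w k t))"
      using sol[OF g assms(5)] unfolding ue .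
    have st: "scatters_to E (\<lambda>t. ubar t + \<epsilon> *\<^sub>R (\<Sum>k. \<epsilon> ^ k *\<^sub>R w k t)) (ubar_plus + \<epsilon> *\<^sub>R (\<Sum>k. \<epsilon> ^ k *\<^sub>R w_plus k))"
      using sca[THEN conjunct2] unfolding ue sp .
    show ?thesis unfolding Let_def using s1 s2 sl st solution_unique[OF _ sl] by blast
  qed
  note main = this
  have e0: "0 < \<epsilon>\<^sub>0" using r(1) n1 by (simp add: \<epsilon>\<^sub>0_def)
  have uniq: "w' = w" if "is_cascade E ubar u\<^sub>0 w'" for w'
    unfolding w_def by (rule cascade_unique[OF that])
  show ?thesis
  proof (intro conjI impI)
    show "\<exists>!w. is_cascade E ubar u\<^sub>0 w"
      using corrector_cascade uniq by blast
    show "\<exists>S. is_scattering_operator E S \<and> real_analytic S"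
      if "init_time E = -\<infinity> \<and> (\<forall>g. \<exists>u. solves E g u)"
      by (rule scattering_operator_analytic) (use that in blast)
  next
    show "\<exists>ubar_plus. scatters_to E ubar ubar_plus \<and>
      (\<forall>w. is_cascade E ubar u\<^sub>0 w \<longrightarrow>
        (\<exists>w_plus. (\<forall>k. scatters_to E (w k) (w_plus k)) \<and>
          (\<exists>\<epsilon>\<^sub>0>0. \<forall>\<epsilon>::real. 0 < \<epsilon> \<and> \<epsilon> \<le> \<epsilon>\<^sub>0 \<longrightarrow>
            summable (\<lambda>k. norm (\<epsilon> ^ k *\<^sub>R w_plus k)) \<and>
            summable (\<lambda>k. \<epsilon> ^ k * F_norm E UNIV (w k)) \<and>
            (let u_eps = (\<lambda>t. ubar t + \<epsilon> *\<^sub>R (\<Sum>k. \<epsilon> ^ k *\<^sub>R w k t)) in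
               solves E (ubar\<^sub>0 + \<epsilon> *\<^sub>R u\<^sub>0) u_eps \<and>
               (\<forall>v. solves E (ubar\<^sub>0 + \<epsilon> *\<^sub>R u\<^sub>0) v \<longrightarrow> v = u_eps) \<and>
               scatters_to E u_eps (ubar_plus + \<epsilon> *\<^sub>R (\<Sum>k. \<epsilon> ^ k *\<^sub>R w_plus k))))))"
    proof (rule exI[of _ ubar_plus], rule conjI[OF plus], intro allI impI)
      fix w' assume "is_cascade E ubar u\<^sub>0 w'"
      then have w': "w' = w" by (rule uniq)
      show "\<exists>w_plus. (\<forall>k. scatters_to E (w' k) (w_plus k)) \<and>
          (\<exists>\<epsilon>\<^sub>0>0. \<forall>\<epsilon>::real. 0 < \<epsilon> \<and> \<epsilon> \<le> \<epsilon>\<^sub>0 \<longrightarrow>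
            summable (\<lambda>k. norm (\<epsilon> ^ k *\<^sub>R w_plus k)) \<and>
            summable (\<lambda>k. \<epsilon> ^ k * F_norm E UNIV (w' k)) \<and>
            (let u_eps = (\<lambda>t. ubar t + \<epsilon> *\<^sub>R (\<Sum>k. \<epsilon> ^ k *\<^sub>R w' k t)) in
               solves E (ubar\<^sub>0 + \<epsilon> *\<^sub>R u\<^sub>0) u_eps \<and>
               (\<forall>v. solves E (ubar\<^sub>0 + \<epsilon> *\<^sub>R u\<^sub>0) v \<longrightarrow> v = u_eps) \<and>
               scatters_to E u_eps (ubar_plus + \<epsilon> *\<^sub>R (\<Sum>k. \<epsilon> ^ k *\<^sub>R w_plus k))))"
        unfolding w'
        by (rule exI[of _ w_plus], rule conjI[OF allI[OF wp]], rule exI[of _ \<epsilon>\<^sub>0], rule conjI[OF e0],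
          intro allI impI, erule conjE, rule main)
    qed
  qed
qed

end
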